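(* For every integer $L\ge1$, there is an explicitly constructed Frobenius parabolic $\mathfrak g$, with principal grading $\mathfrak g=\bigoplus_j\mathfrak g_j$ and principal multiplicities $h_j=\dim\mathfrak g_j$, such that, for every $j=3,\ldots,L+2$, $$h_j-h_{j+1}\le-\bigl(2(L+5)^2-1\bigr).$$ In particular, $$h_3<h_4<\cdots<h_{L+3}.$$ The total rise over this block is $$h_{L+3}-h_3=\frac{L(5L^2+43L+106)}2.$$ For every $e\in\mathfrak g_1$, each of the $L$ maps $$\operatorname{ad} e:\mathfrak g_j\longrightarrow\mathfrak g_{j+1},\qquad j=3,\ldots,L+2,$$ has cokernel dimension at least $2(L+5)^2-1$.
   Context: All Lie algebras are finite-dimensional over $\mathbb C$. A Lie algebra $\mathfrak g$ is Frobenius if there is $F\in\mathfrak g^*$ (a Frobenius functional) whose Kirillov form $B_F(x,y)=F([x,y])$ is nondegenerate. For such $F$ the principal element $H=\widehat F\in\mathfrak g$ is the unique element with $F([H,x])=F(x)$ for all $x\in\mathfrak g$. Parabolics here are of type $A$. For compositions $A=(a_1,\ldots,a_u)$ and $B=(b_1,\ldots,b_v)$ of $n$, which cut $1,\ldots,n$ into consecutive blocks, let $\alpha(i)$ and $\beta(i)$ be the $A$-block and $B$-block containing $i$. The seaweed $\mathfrak q(A\mid B)\subseteq\mathfrak{sl}_n$ is $$\mathfrak q(A\mid B)=\mathfrak h\oplus\bigoplus_{i>j,\ \alpha(i)=\alpha(j)}\mathbb C E_{ij}\oplus\bigoplus_{i<j,\ \beta(i)=\beta(j)}\mathbb C E_{ij},$$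 where $\mathfrak h$ is the trace-zero diagonal subalgebra and $E_{ij}$ are the matrix units. The parabolics considered are the seaweeds $\mathfrak q((n)\mid B)$, and a Frobenius parabolic is one that is Frobenius as a Lie algebra. For these algebras $\operatorname{ad}H$ is semisimple with integral eigenvalues. The principal grading is $\mathfrak g=\bigoplus_{j\in\mathbb Z}\mathfrak g_j$ with $\mathfrak g_j=\{x\in\mathfrak g:[H,x]=jx\}$. The principal multiplicities are $h_j=\dim\mathfrak g_j$, and they do not depend on the choice of Frobenius functional. *)

theory Defs
  imports "Jordan_Normal_Form.VS_Connect" "HOL-Algebra.AbelCoset"
begin

section \<open>Linear algebra\<close>

text \<open>
  The quotient of a module by a submodule, on cosets. The multiplicative part of the record
  is irrelevant for modules and is filled with dummies.
\<close>

definition quotient_module ::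
    "('a, 'b, 'c) module_scheme \<Rightarrow> 'b set \<Rightarrow> ('a, 'b set) module" where
  "quotient_module V W =
    \<lparr>carrier = a_rcosets\<^bsub>V\<^esub> W,
     mult = (\<lambda>X Y. W),
     one = W,
     zero = W,
     add = set_add V,
     smult = (\<lambda>c X. \<Union>x\<in>X. W +>\<^bsub>V\<^esub> (c \<odot>\<^bsub>V\<^esub> x))\<rparr>"

definition cokernel ::
    "('a, 'b, 'c) module_scheme \<Rightarrow> ('a, 'd, 'e) module_scheme \<Rightarrow> ('b \<Rightarrow> 'd) \<Rightarrow> ('a, 'd set) module"
  where "cokernel U V T = quotient_module V (T ` carrier U)"

lemma quotient_module_vectorspace:
  assumes "subspace K W V"
  shows "vectorspace K (quotient_module V W)"
proof -
  interpret VS: vectorspace K V using assms by (simp add: subspace_def)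
  have sub: "submodule K W V" using assms by (simp add: subspace_def)
  have WV: "W \<subseteq> carrier V" and Wsm: "\<And>c w. c \<in> carrier K \<Longrightarrow> w \<in> W \<Longrightarrow> c \<odot>\<^bsub>V\<^esub> w \<in> W"
    and Wadd: "\<And>v w. v \<in> W \<Longrightarrow> w \<in> W \<Longrightarrow> v \<oplus>\<^bsub>V\<^esub> w \<in> W" and W0: "\<zero>\<^bsub>V\<^esub> \<in> W"
    using sub by (auto simp: submodule_def)
  have Wneg: "\<ominus>\<^bsub>V\<^esub> w \<in> W" if "w \<in> W" for w
    using Wsm[OF _ that, of "\<ominus>\<^bsub>K\<^esub> \<one>\<^bsub>K\<^esub>"] that WV VS.smult_minus_1[of w] by auto
  have "subgroup W (add_monoid V)"
    using WV Wadd W0 Wneg VS.add.subgroupI[of W] by (auto simp: a_inv_def)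
  then have asub: "additive_subgroup W V" by (rule additive_subgroup.intro)
  interpret AS: abelian_subgroup W V
    by (rule abelian_subgroupI3) (use asub VS.abelian_group_axioms in auto)
  let ?Q = "quotient_module V W"
  have cos: "\<exists>v\<in>carrier V. X = W +>\<^bsub>V\<^esub> v" if "X \<in> carrier ?Q" for X
    using that by (auto simp: quotient_module_def A_RCOSETS_def')
  have cosI: "W +>\<^bsub>V\<^esub> v \<in> carrier ?Q" if "v \<in> carrier V" for v
    using that by (auto simp: quotient_module_def A_RCOSETS_def')
  have addQ: "(W +>\<^bsub>V\<^esub> v) \<oplus>\<^bsub>?Q\<^esub> (W +>\<^bsub>V\<^esub> w) = W +>\<^bsub>V\<^esub> (v \<oplus>\<^bsub>V\<^esub> w)"
    if "v \<in> carrier V" "w \<in> carrier V" for v w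
    using that by (simp add: quotient_module_def AS.a_rcos_sum)
  have coseq: "W +>\<^bsub>V\<^esub> v = W +>\<^bsub>V\<^esub> w" if "v \<in> W +>\<^bsub>V\<^esub> w" "w \<in> carrier V" for v w
    using AS.a_repr_independence'[OF that] by simp
  have smQ: "c \<odot>\<^bsub>?Q\<^esub> (W +>\<^bsub>V\<^esub> v) = W +>\<^bsub>V\<^esub> (c \<odot>\<^bsub>V\<^esub> v)"
    if c: "c \<in> carrier K" and v: "v \<in> carrier V" for c v
  proof -
    have "W +>\<^bsub>V\<^esub> (c \<odot>\<^bsub>V\<^esub> x) = W +>\<^bsub>V\<^esub> (c \<odot>\<^bsub>V\<^esub> v)" if x: "x \<in> W +>\<^bsub>V\<^esub> v" for x
    proof -
      obtain w where w: "w \<in> W" "x = w \<oplus>\<^bsub>V\<^esub> v" using x by (auto simp: a_r_coset_def')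
      have "c \<odot>\<^bsub>V\<^esub> x = (c \<odot>\<^bsub>V\<^esub> w) \<oplus>\<^bsub>V\<^esub> (c \<odot>\<^bsub>V\<^esub> v)"
        using w WV c v by (auto simp: VS.smult_r_distr)
      then have "c \<odot>\<^bsub>V\<^esub> x \<in> W +>\<^bsub>V\<^esub> (c \<odot>\<^bsub>V\<^esub> v)"
        using Wsm[OF c w(1)] by (auto simp: a_r_coset_def')
      then show ?thesis using coseq c v by auto
    qed
    moreover have "v \<in> W +>\<^bsub>V\<^esub> v"
      using W0 v by (auto simp: a_r_coset_def' intro!: bexI[of _ "\<zero>\<^bsub>V\<^esub>"])
    ultimately have "(\<Union>x\<in>W +>\<^bsub>V\<^esub> v. W +>\<^bsub>V\<^esub> (c \<odot>\<^bsub>V\<^esub> x)) = W +>\<^bsub>V\<^esub> (c \<odot>\<^bsub>V\<^esub> v)"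
      by blast
    then show ?thesis by (simp add: quotient_module_def)
  qed
  have zeroQ: "\<zero>\<^bsub>?Q\<^esub> = W +>\<^bsub>V\<^esub> \<zero>\<^bsub>V\<^esub>"
    using WV by (auto simp: quotient_module_def)
  have ag: "abelian_group ?Q"
  proof (rule abelian_groupI)
    show "X \<oplus>\<^bsub>?Q\<^esub> Y \<in> carrier ?Q" if "X \<in> carrier ?Q" "Y \<in> carrier ?Q" for X Y
      using cos[OF that(1)] cos[OF that(2)] addQ cosI by auto
    show "\<zero>\<^bsub>?Q\<^esub> \<in> carrier ?Q" using zeroQ cosI by auto
    show "X \<oplus>\<^bsub>?Q\<^esub> Y \<oplus>\<^bsub>?Q\<^esub> Z = X \<oplus>\<^bsub>?Q\<^esub> (Y \<oplus>\<^bsub>?Q\<^esub> Z)"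
      if "X \<in> carrier ?Q" "Y \<in> carrier ?Q" "Z \<in> carrier ?Q" for X Y Z
      using cos[OF that(1)] cos[OF that(2)] cos[OF that(3)] by (auto simp: addQ VS.a_assoc)
    show "X \<oplus>\<^bsub>?Q\<^esub> Y = Y \<oplus>\<^bsub>?Q\<^esub> X" if "X \<in> carrier ?Q" "Y \<in> carrier ?Q" for X Y
      using cos[OF that(1)] cos[OF that(2)] by (auto simp: addQ VS.a_comm)
    show "\<zero>\<^bsub>?Q\<^esub> \<oplus>\<^bsub>?Q\<^esub> X = X" if "X \<in> carrier ?Q" for X
      using cos[OF that] by (auto simp: addQ zeroQ)
    show "\<exists>Y\<in>carrier ?Q. Y \<oplus>\<^bsub>?Q\<^esub> X = \<zero>\<^bsub>?Q\<^esub>" if X: "X \<in> carrier ?Q" for X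
    proof -
      obtain v where v: "v \<in> carrier V" "X = W +>\<^bsub>V\<^esub> v" using cos[OF X] by auto
      show ?thesis
        using v cosI[of "\<ominus>\<^bsub>V\<^esub> v"] by (auto simp: addQ zeroQ VS.l_neg intro!: bexI[of _ "W +>\<^bsub>V\<^esub> (\<ominus>\<^bsub>V\<^esub> v)"])
    qed
  qed
  have "module K ?Q"
  proof (rule moduleI)
    show "cring K" by (rule VS.R.cring_axioms)
    show "abelian_group ?Q" by (rule ag)
  next
    fix c X assume "c \<in> carrier K" "X \<in> carrier ?Q"
    then show "c \<odot>\<^bsub>?Q\<^esub> X \<in> carrier ?Q" using cos[of X] smQ cosI by auto
  next
    fix a b X assume a: "a \<in> carrier K" "b \<in> carrier K" "X \<in> carrier ?Q"
    show "(a \<oplus>\<^bsub>K\<^esub> b) \<odot>\<^bsub>?Q\<^esub> X = a \<odot>\<^bsub>?Q\<^esub> X \<oplus>\<^bsub>?Q\<^esub> b \<odot>\<^bsub>?Q\<^esub> X"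
      using cos[OF a(3)] a(1,2) by (auto simp: smQ addQ VS.smult_l_distr)
    show "(a \<otimes>\<^bsub>K\<^esub> b) \<odot>\<^bsub>?Q\<^esub> X = a \<odot>\<^bsub>?Q\<^esub> (b \<odot>\<^bsub>?Q\<^esub> X)"
      using cos[OF a(3)] a(1,2) by (auto simp: smQ VS.smult_assoc1)
  next
    fix a X Y assume a: "a \<in> carrier K" "X \<in> carrier ?Q" "Y \<in> carrier ?Q"
    show "a \<odot>\<^bsub>?Q\<^esub> (X \<oplus>\<^bsub>?Q\<^esub> Y) = a \<odot>\<^bsub>?Q\<^esub> X \<oplus>\<^bsub>?Q\<^esub> a \<odot>\<^bsub>?Q\<^esub> Y"
      using cos[OF a(2)] cos[OF a(3)] a(1) by (auto simp: smQ addQ VS.smult_r_distr)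
  next
    fix X assume "X \<in> carrier ?Q"
    then show "\<one>\<^bsub>K\<^esub> \<odot>\<^bsub>?Q\<^esub> X = X" using cos[of X] by (auto simp: smQ)
  qed
  then show ?thesis by (simp add: vectorspace_def VS.field_axioms)
qed

text \<open>A set of \<open>n \<times> n\<close> matrices as a vector space with the operations of all such matrices.\<close>

definition mat_subspace :: "nat \<Rightarrow> complex mat set \<Rightarrow> (complex, complex mat) module" where
  "mat_subspace n U = (module_mat TYPE(complex) n n)\<lparr>carrier := U\<rparr>"


section \<open>Seaweeds and parabolics in type A\<close>

definition lie_bracket :: "complex mat \<Rightarrow> complex mat \<Rightarrow> complex mat" where
  "lie_bracket x y = x * y - y * x"

definition mat_trace :: "complex mat \<Rightarrow> complex" where
  "mat_trace x = (\<Sum>i<dim_row x. x $$ (i, i))"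

definition sl :: "nat \<Rightarrow> complex mat set" where
  "sl n = {x \<in> carrier_mat n n. mat_trace x = 0}"

definition composition :: "nat \<Rightarrow> nat list \<Rightarrow> bool" where
  "composition n c \<longleftrightarrow> (\<forall>a\<in>set c. a \<ge> 1) \<and> sum_list c = n"

text \<open>
  The index of the block containing \<open>i\<close>. Rows and columns of matrices are numbered from \<open>0\<close>, so
  block \<open>k\<close> of \<open>c\<close> consists of the \<open>i\<close> with
  \<open>sum_list (take k c) \<le> i < sum_list (take (Suc k) c)\<close>.
\<close>

definition block :: "nat list \<Rightarrow> nat \<Rightarrow> nat" where
  "block c i = (LEAST k. i < sum_list (take (Suc k) c))"

lemma sum_list_take_mono: "k \<le> l \<Longrightarrow> sum_list (take k c) \<le> sum_list (take l (c :: nat list))"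
  by (metis le_add1 min.absorb1 sum_list_append take_add take_take le_add_diff_inverse)

lemma block_eqI:
  assumes "sum_list (take k c) \<le> i" "i < sum_list (take (Suc k) c)"
  shows "block c i = k"
  unfolding block_def
proof (rule Least_equality)
  show "i < sum_list (take (Suc k) c)" by fact
  show "k \<le> l" if "i < sum_list (take (Suc l) c)" for l
  proof (rule ccontr)
    assume "\<not> k \<le> l"
    then have "sum_list (take (Suc l) c) \<le> sum_list (take k c)"
      by (intro sum_list_take_mono) auto
    then show False using that assms(1) by linarith
  qed
qed

lemma block_mono:
  assumes "i \<le> j" "j < sum_list c"
  shows "block c i \<le> block c j"
proof -
  have "j < sum_list (take (Suc (length c)) c)" using assms by simp
  then have "j < sum_list (take (Suc (block c j)) c)" unfolding block_def by (rule LeastI)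
  then have "i < sum_list (take (Suc (block c j)) c)" using assms by linarith
  then show ?thesis unfolding block_def[of c i] by (rule Least_le)
qed

text \<open>
  The sum of the trace-zero diagonal matrices and the lines spanned by the admissible matrix units
  is the set of trace-zero matrices whose off-diagonal nonzero entries are at admissible positions.
\<close>

definition seaweed :: "nat \<Rightarrow> nat list \<Rightarrow> nat list \<Rightarrow> complex mat set" where
  "seaweed n a b =
    {x \<in> sl n. \<forall>i<n. \<forall>j<n. x $$ (i, j) \<noteq> 0 \<longrightarrow>
       i = j \<or> (i > j \<and> block a i = block a j) \<or> (i < j \<and> block b i = block b j)}"

lemma seaweed_subspace:
  "subspace class_ring (seaweed n a b) (module_mat TYPE(complex) n n)"
proof -
  have V: "vectorspace class_ring (module_mat TYPE(complex) n n)" by (rule matrix_vs)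
  then have M: "module class_ring (module_mat TYPE(complex) n n)" by (simp add: vectorspace_def)
  have add: "x + y \<in> seaweed n a b" if "x \<in> seaweed n a b" "y \<in> seaweed n a b" for x y
  proof -
    have c: "x \<in> carrier_mat n n" "y \<in> carrier_mat n n"
      using that by (auto simp: seaweed_def sl_def)
    have "mat_trace (x + y) = mat_trace x + mat_trace y"
      using c by (auto simp: mat_trace_def sum.distrib)
    moreover have "(x + y) $$ (i, j) \<noteq> 0 \<Longrightarrow> x $$ (i, j) \<noteq> 0 \<or> y $$ (i, j) \<noteq> 0"
      if "i < n" "j < n" for i j using c that by auto
    moreover have "x + y \<in> carrier_mat n n" using c by simp
    ultimately show ?thesis using that unfolding seaweed_def sl_def mem_Collect_eq
      by (metis add.right_neutral)
  qed
  have smult: "c \<cdot>\<^sub>m x \<in> seaweed n a b" if "x \<in> seaweed n a b" for c x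
  proof -
    have "mat_trace (c \<cdot>\<^sub>m x) = c * mat_trace x"
      using that unfolding mat_trace_def sum_distrib_left
      by (intro sum.cong) (auto simp: seaweed_def sl_def)
    moreover have "(c \<cdot>\<^sub>m x) $$ (i, j) \<noteq> 0 \<Longrightarrow> x $$ (i, j) \<noteq> 0" if "i < n" "j < n" for i j
      using \<open>x \<in> seaweed n a b\<close> that by (auto simp: seaweed_def sl_def)
    moreover have "c \<cdot>\<^sub>m x \<in> carrier_mat n n" using that by (auto simp: seaweed_def sl_def)
    ultimately show ?thesis using that unfolding seaweed_def sl_def mem_Collect_eq
      by (metis mult_zero_right)
  qed
  have "submodule class_ring (seaweed n a b) (module_mat TYPE(complex) n n)"
  proof (rule submodule.intro)
    show "seaweed n a b \<subseteq> carrier (module_mat TYPE(complex) n n)"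
      by (auto simp: seaweed_def sl_def module_mat_simps)
    have "0\<^sub>m n n \<in> seaweed n a b" by (simp add: seaweed_def sl_def mat_trace_def)
    then show "\<zero>\<^bsub>module_mat TYPE(complex) n n\<^esub> \<in> seaweed n a b" by (simp add: module_mat_simps)
  qed (use M add smult in \<open>simp_all add: module_mat_simps\<close>)
  then show ?thesis
    using matrix_vs[of n n, where ?'a = complex] by (simp add: subspace_def)
qed

lemma lie_bracket_seaweed:
  assumes a: "composition n a" and b: "composition n b"
    and x: "x \<in> seaweed n a b" and y: "y \<in> seaweed n a b"
  shows "lie_bracket x y \<in> seaweed n a b"
proof -
  let ?ok = "\<lambda>i j. i = j \<or> (i > j \<and> block a i = block a j) \<or> (i < j \<and> block b i = block b j)"
  have c: "x \<in> carrier_mat n n" "y \<in> carrier_mat n n"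
    using x y by (auto simp: seaweed_def sl_def)
  have entry: "(u * v) $$ (i, j) = (\<Sum>k<n. u $$ (i, k) * v $$ (k, j))"
    if "u \<in> carrier_mat n n" "v \<in> carrier_mat n n" "i < n" "j < n" for u v :: "complex mat" and i j
    using that by (auto simp: scalar_prod_def atLeast0LessThan)
  have ok: "?ok i j" if "i < n" "j < n" "k < n" "?ok i k" "?ok k j" for i j k
  proof -
    have m: "\<And>p q. p \<le> q \<Longrightarrow> q < n \<Longrightarrow> block a p \<le> block a q \<and> block b p \<le> block b q"
      using a b block_mono by (auto simp: composition_def)
    show ?thesis
      using that m[of i j] m[of j i] m[of i k] m[of k i] m[of j k] m[of k j]
      by (cases i j rule: linorder_cases; cases i k rule: linorder_cases;
          cases j k rule: linorder_cases) auto
  qed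
  have supp: "(u * v) $$ (i, j) = 0"
    if "u \<in> seaweed n a b" "v \<in> seaweed n a b" "i < n" "j < n" "\<not> ?ok i j" for u v i j
  proof -
    have "u $$ (i, k) * v $$ (k, j) = 0" if "k < n" for k
      using ok[of i j k] \<open>k < n\<close> \<open>i < n\<close> \<open>j < n\<close> \<open>\<not> ?ok i j\<close>
        \<open>u \<in> seaweed n a b\<close> \<open>v \<in> seaweed n a b\<close>
      unfolding seaweed_def mult_eq_0_iff by blast
    then have "(\<Sum>k<n. u $$ (i, k) * v $$ (k, j)) = 0" by (intro sum.neutral) blast
    moreover have "u \<in> carrier_mat n n" "v \<in> carrier_mat n n"
      using that(1,2) by (auto simp: seaweed_def sl_def)
    ultimately show ?thesis using entry that(3,4) by presburger
  qed
  have "mat_trace (lie_bracket x y) = (\<Sum>i<n. (x * y) $$ (i, i)) - (\<Sum>i<n. (y * x) $$ (i, i))"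
    using c by (auto simp: mat_trace_def lie_bracket_def sum_subtractf)
  also have "(\<Sum>i<n. (x * y) $$ (i, i)) = (\<Sum>i<n. \<Sum>k<n. x $$ (i, k) * y $$ (k, i))"
    using c entry by (intro sum.cong refl) (auto simp del: index_mult_mat)
  also have "\<dots> = (\<Sum>k<n. \<Sum>i<n. x $$ (i, k) * y $$ (k, i))" by (rule sum.swap)
  also have "\<dots> = (\<Sum>i<n. (y * x) $$ (i, i))"
    using entry[OF c(2,1)] by (intro sum.cong refl) (auto simp: mult.commute simp del: index_mult_mat)
  finally have tr: "mat_trace (lie_bracket x y) = 0" by simp
  have car: "lie_bracket x y \<in> carrier_mat n n" using c by (auto simp: lie_bracket_def)
  have "?ok i j" if "i < n" "j < n" "lie_bracket x y $$ (i, j) \<noteq> 0" for i j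
  proof (rule ccontr)
    assume "\<not> ?ok i j"
    then have "(x * y) $$ (i, j) = 0" "(y * x) $$ (i, j) = 0"
      using supp[OF x y that(1,2)] supp[OF y x that(1,2)] by blast+
    then show False using that c by (simp add: lie_bracket_def)
  qed
  then show ?thesis using tr car unfolding seaweed_def sl_def by blast
qed

definition parabolic :: "nat \<Rightarrow> nat list \<Rightarrow> complex mat set" where
  "parabolic n b = seaweed n [n] b"


section \<open>Frobenius Lie algebras of matrices\<close>

text \<open>
  A functional on \<open>\<gg>\<close> is a function on all matrices of which only the values on \<open>\<gg>\<close> matter.
\<close>

definition linear_functional :: "complex mat set \<Rightarrow> (complex mat \<Rightarrow> complex) \<Rightarrow> bool" where
  "linear_functional \<gg> F \<longleftrightarrow>
    (\<forall>x\<in>\<gg>. \<forall>y\<in>\<gg>. F (x + y) = F x + F y) \<and> (\<forall>c. \<forall>x\<in>\<gg>. F (c \<cdot>\<^sub>m x) = c * F x)"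

definition kirillov_form ::
    "(complex mat \<Rightarrow> complex) \<Rightarrow> complex mat \<Rightarrow> complex mat \<Rightarrow> complex" where
  "kirillov_form F x y = F (lie_bracket x y)"

text \<open>The Kirillov form is alternating, so its left and right radicals coincide.\<close>

definition frobenius_functional ::
    "nat \<Rightarrow> complex mat set \<Rightarrow> (complex mat \<Rightarrow> complex) \<Rightarrow> bool" where
  "frobenius_functional n \<gg> F \<longleftrightarrow> linear_functional \<gg> F \<and>
    (\<forall>x\<in>\<gg>. (\<forall>y\<in>\<gg>. kirillov_form F x y = 0) \<longrightarrow> x = 0\<^sub>m n n)"

definition frobenius :: "nat \<Rightarrow> complex mat set \<Rightarrow> bool" where
  "frobenius n \<gg> \<longleftrightarrow> (\<exists>F. frobenius_functional n \<gg> F)"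

definition principal_element ::
    "complex mat set \<Rightarrow> (complex mat \<Rightarrow> complex) \<Rightarrow> complex mat" where
  "principal_element \<gg> F = (THE H. H \<in> \<gg> \<and> (\<forall>x\<in>\<gg>. F (lie_bracket H x) = F x))"

definition principal_part ::
    "complex mat set \<Rightarrow> (complex mat \<Rightarrow> complex) \<Rightarrow> int \<Rightarrow> complex mat set" where
  "principal_part \<gg> F j =
    {x \<in> \<gg>. lie_bracket (principal_element \<gg> F) x = of_int j \<cdot>\<^sub>m x}"

definition principal_mult ::
    "nat \<Rightarrow> complex mat set \<Rightarrow> (complex mat \<Rightarrow> complex) \<Rightarrow> int \<Rightarrow> nat" where
  "principal_mult n \<gg> F j = vectorspace.dim class_ring (mat_subspace n (principal_part \<gg> F j))"

text \<open>The dimension of the cokernel of \<open>ad e : \<gg>\<^sub>j \<rightarrow> \<gg>\<^sub>j\<^sub>+\<^sub>1\<close>, for \<open>e \<in> \<gg>\<^sub>1\<close>.\<close>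

definition ad_cokernel_dim ::
    "nat \<Rightarrow> complex mat set \<Rightarrow> (complex mat \<Rightarrow> complex) \<Rightarrow> complex mat \<Rightarrow> int \<Rightarrow> nat" where
  "ad_cokernel_dim n \<gg> F e j =
    vectorspace.dim class_ring
      (cokernel (mat_subspace n (principal_part \<gg> F j))
                (mat_subspace n (principal_part \<gg> F (j + 1)))
                (lie_bracket e))"

end

theory Submission
  imports "HOL-Complex_Analysis.Conformal_Mappings" Defs
begin

text \<open>Fix \<open>m = L + 5\<close> and \<open>N = m\<^sup>2\<close>. The parabolic lives in \<open>sl\<close> of size \<open>6 N\<close> and belongs to the
composition \<open>(m (m - 1), m - 1, 2, \<dots>, 2, 1, 2, \<dots>, 2, N)\<close> with \<open>N\<close> twos in each run. It is the
trace-zero part of an incidence algebra: the matrices supported on a reflexive and transitive relation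
\<open>S\<close> on the vertices \<open>0, \<dots>, 6 N - 1\<close>. The reflection \<open>p \<mapsto> 6 N - 1 - p\<close> exchanges a left and a right
half of the vertices. The first \<open>N\<close> vertices, the core, form an \<open>m \<times> m\<close> grid; the other \<open>2 N\<close> vertices
of the left half form a tail.

The functional is \<open>x \<mapsto> tr (g x)\<close> for the adjacency matrix \<open>g\<close> of a directed graph: vertical edges in the
grid, horizontal edges in its first row only, a zigzag along the tail, and an edge from every left vertex
to its mirror image. There is a height function \<open>\<mu>\<close> that grows by one along each edge, so \<open>diag \<mu>\<close>, shifted
to trace zero, is the principal element, and \<open>h\<^sub>j\<close> counts the pairs in \<open>S\<close> of height difference \<open>j\<close>.
Nondegeneracy (\<open>g_nondegenerate\<close>) is a computation with entries: the mirror edges identify the two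
diagonal quarters of a matrix in the kernel and remove part of its corner, and what remains is a system
for one quarter whose only solutions are scalar (\<open>scalar\<close>, resting on \<open>core_scalar\<close>).

The claim concerns every Frobenius functional, and its principal element is in general not diagonal.
Two nondegenerate functionals are joined by a complex line. The parameters where the functional
degenerates are the zeros of an entire determinant, so the others form a connected open set. On that
set the principal element \<open>H\<close> is holomorphic by Cramer's rule and satisfies a Lax equation \<open>H' = [H, Y]\<close>
(\<open>principal_lax\<close>). Hence a polynomial that annihilates \<open>H\<close> once annihilates it everywhere
(\<open>lax_solution_zero\<close>). So the spectrum is fixed, the spectral projections move holomorphically, and they
provide intertwiners between nearby values of \<open>H\<close>. The eigenspaces of \<open>ad H\<close> therefore keep their dimension
(\<open>eigendim_principal_eq\<close>).

The counts are in \<open>card_graded\<close>. Long sums cancel in differences, with the result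
\<open>2 (h\<^bsub>j+1\<^esub> - h\<^sub>j) = 8 m\<^sup>2 - 12 m j + 9 j\<^sup>2 + j - 2 = 4 m\<^sup>2 + (2 m - 3 j)\<^sup>2 + j - 2\<close>
for \<open>3 \<le> j \<le> m - 3\<close>. This exceeds \<open>4 m\<^sup>2\<close>, which gives the claimed step, and its sum over \<open>j\<close> is the claimed
rise. The bound for the cokernel is \<open>dim coker \<ge> h\<^bsub>j+1\<^esub> - h\<^sub>j\<close>.\<close>

section \<open>Dimensions of spaces of matrices\<close>

text \<open>A linearly independent subset of the subspace is independent in the whole space, so its size is bounded and a maximal one is a basis.\<close>

lemma subspace_fin_dim:
  assumes V: "vectorspace K V" and fd: "vectorspace.fin_dim K V" and W: "subspace K W V"
  shows "vectorspace.fin_dim K (V\<lparr>carrier := W\<rparr>)"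
    and "vectorspace.dim K (V\<lparr>carrier := W\<rparr>) \<le> vectorspace.dim K V"
proof -
  interpret V: vectorspace K V by (rule V)
  have "vectorspace K (V\<lparr>carrier := W\<rparr>)" by (rule V.subspace_is_vs[OF W])
  then interpret W: vectorspace K "V\<lparr>carrier := W\<rparr>" .
  have sub: "submodule K W V" using W by (simp add: subspace_def)
  have WV: "W \<subseteq> carrier V" using sub by (simp add: submodule_def)
  let ?P = "\<lambda>S. S \<subseteq> carrier (V\<lparr>carrier := W\<rparr>) \<and> W.lin_indpt S"
  have bound: "finite S \<and> card S \<le> V.dim" if "?P S" for S
  proof -
    have "S \<subseteq> W" using that by simp
    then have "V.lin_indpt S" "S \<subseteq> carrier V"
      using V.span_li_not_depend(2)[OF _ sub, of S] that WV by auto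
    then show ?thesis using V.li_le_dim[OF fd] by blast
  qed
  have "?P {}" by (auto simp: W.lin_dep_def)
  then obtain A where A: "finite A" "maximal A ?P"
    using maximal_exists[of ?P V.dim "{}"] bound by blast
  then have b: "W.basis A" by (intro W.max_li_is_basis)
  then show "W.fin_dim" using A(1) by (auto simp: W.fin_dim_def W.basis_def)
  have "W.dim = card A" using W.dim_basis[OF A(1) b] .
  then show "W.dim \<le> V.dim" using bound[of A] A(2) by (auto simp: maximal_def)
qed

lemma linear_inj_dim_le:
  assumes T: "linear_map K V W T" and inj: "inj_on T (carrier V)"
    and fdV: "vectorspace.fin_dim K V" and fdW: "vectorspace.fin_dim K W"
  shows "vectorspace.dim K V \<le> vectorspace.dim K W"
proof -
  interpret T: linear_map K V W T by (rule T)
  have "vectorspace.dim K V = vectorspace.dim K (W\<lparr>carrier := T.im\<rparr>)"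
    using T.rank_nullity[OF fdV] T.inj_imp_dim_ker0[OF inj] by simp
  also have "\<dots> \<le> vectorspace.dim K W"
    by (rule subspace_fin_dim(2)[OF T.W.vectorspace_axioms fdW T.imT_is_subspace])
  finally show ?thesis .
qed

text \<open>Rank and nullity for the projection onto the quotient, whose kernel is the image of \<open>T\<close>, and for \<open>T\<close> itself.\<close>

lemma cokernel_dim_ge:
  assumes T: "linear_map K U V T"
    and fdU: "vectorspace.fin_dim K U" and fdV: "vectorspace.fin_dim K V"
  shows "vectorspace.dim K V \<le> vectorspace.dim K (cokernel U V T) + vectorspace.dim K U"
proof -
  have "vectorspace K V" using T by (simp add: linear_map_def)
  then interpret VV: vectorspace K V .
  interpret T: linear_map K U V T by (rule T)
  let ?W = "T ` carrier U"
  let ?Q = "cokernel U V T"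
  have W: "subspace K ?W V" using T.imT_is_subspace by (simp add: T.im_def)
  have Q: "vectorspace K ?Q" unfolding cokernel_def by (rule quotient_module_vectorspace[OF W])
  have sub: "submodule K ?W V" using W by (simp add: subspace_def)
  have WV: "?W \<subseteq> carrier V" and W0: "\<zero>\<^bsub>V\<^esub> \<in> ?W"
    and Wadd: "\<And>v w. v \<in> ?W \<Longrightarrow> w \<in> ?W \<Longrightarrow> v \<oplus>\<^bsub>V\<^esub> w \<in> ?W"
    and Wsm: "\<And>c w. c \<in> carrier K \<Longrightarrow> w \<in> ?W \<Longrightarrow> c \<odot>\<^bsub>V\<^esub> w \<in> ?W"
    using sub unfolding submodule_def by blast+
  have Wneg: "\<ominus>\<^bsub>V\<^esub> w \<in> ?W" if "w \<in> ?W" for w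
  proof -
    have "(\<ominus>\<^bsub>K\<^esub> \<one>\<^bsub>K\<^esub>) \<odot>\<^bsub>V\<^esub> w = \<ominus>\<^bsub>V\<^esub> w"
      using that WV by (intro VV.smult_minus_1) blast
    then show ?thesis using Wsm[OF _ that, of "\<ominus>\<^bsub>K\<^esub> \<one>\<^bsub>K\<^esub>"] by simp
  qed
  have "subgroup ?W (add_monoid V)"
    using WV Wadd W0 Wneg VV.add.subgroupI[of ?W] by (auto simp: a_inv_def)
  then have asub: "additive_subgroup ?W V" by (rule additive_subgroup.intro)
  have "abelian_subgroup ?W V"
    by (rule abelian_subgroupI3[OF asub VV.abelian_group_axioms])
  then interpret AS: abelian_subgroup ?W V .
  let ?p = "\<lambda>v. ?W +>\<^bsub>V\<^esub> v"
  have smQ: "c \<odot>\<^bsub>?Q\<^esub> ?p v = ?p (c \<odot>\<^bsub>V\<^esub> v)"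
    if c: "c \<in> carrier K" and v: "v \<in> carrier V" for c v
  proof -
    have "?p (c \<odot>\<^bsub>V\<^esub> x) = ?p (c \<odot>\<^bsub>V\<^esub> v)" if x: "x \<in> ?p v" for x
    proof -
      obtain w where w: "w \<in> ?W" "x = w \<oplus>\<^bsub>V\<^esub> v" using x unfolding a_r_coset_def' by blast
      have "c \<odot>\<^bsub>V\<^esub> x = (c \<odot>\<^bsub>V\<^esub> w) \<oplus>\<^bsub>V\<^esub> (c \<odot>\<^bsub>V\<^esub> v)"
        using w WV c v by (auto simp: VV.smult_r_distr)
      then have "c \<odot>\<^bsub>V\<^esub> x \<in> ?p (c \<odot>\<^bsub>V\<^esub> v)"
        using Wsm[OF c w(1)] unfolding a_r_coset_def' by blast
      then show ?thesis using AS.a_repr_independence' c v by auto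
    qed
    moreover have "v \<in> ?p v"
      using W0 v VV.l_zero[of v] unfolding a_r_coset_def' by force
    ultimately have "(\<Union>x\<in>?p v. ?p (c \<odot>\<^bsub>V\<^esub> x)) = ?p (c \<odot>\<^bsub>V\<^esub> v)" by blast
    then show ?thesis by (simp add: cokernel_def quotient_module_def)
  qed
  have carQ: "carrier ?Q = ?p ` carrier V"
    unfolding cokernel_def quotient_module_def A_RCOSETS_def' by (simp only: partial_object.simps) blast
  have addQ: "X \<oplus>\<^bsub>?Q\<^esub> Y = X <+>\<^bsub>V\<^esub> Y" for X Y
    by (simp add: cokernel_def quotient_module_def)
  have mh: "?p \<in> LinearCombinations.module_hom K V ?Q"
    unfolding LinearCombinations.module_hom_def mem_Collect_eq Pi_iff carQ addQ
    using smQ AS.a_rcos_sum by (metis (no_types, lifting) imageI)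
  have "module K V" "module K ?Q"
    using Q VV.vectorspace_axioms by (simp_all add: vectorspace_def)
  then have "mod_hom K V ?Q ?p" using mh by (intro mod_hom.intro mod_hom_axioms.intro)
  then have "linear_map K V ?Q ?p" using Q VV.vectorspace_axioms by (intro linear_map.intro)
  then interpret p: linear_map K V ?Q ?p .
  have im: "p.im = carrier ?Q" unfolding p.im_def carQ ..
  have ker: "p.ker = ?W"
  proof -
    have "?p v = ?W \<longleftrightarrow> v \<in> ?W" if "v \<in> carrier V" for v
      using AS.a_rcos_const AS.a_rcos_self[OF that] by metis
    then have "{v \<in> carrier V. ?p v = ?W} = carrier V \<inter> ?W"
      unfolding Int_def by (intro Collect_cong conj_cong refl)
    moreover have "p.ker = {v \<in> carrier V. ?p v = ?W}"
      unfolding p.ker_def by (simp add: cokernel_def quotient_module_def)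
    ultimately show ?thesis using Int_absorb1[OF WV] by (simp only:)
  qed
  have "vectorspace.dim K ?Q + vectorspace.dim K (V\<lparr>carrier := ?W\<rparr>) = vectorspace.dim K V"
    using p.rank_nullity[OF fdV] by (simp add: im ker)
  moreover have "vectorspace.dim K (V\<lparr>carrier := ?W\<rparr>) \<le> vectorspace.dim K U"
    using T.rank_nullity[OF fdU] by (simp add: T.im_def)
  ultimately show ?thesis by linarith
qed

definition supported :: "nat \<Rightarrow> (nat \<times> nat) set \<Rightarrow> complex mat set" where
  "supported n P = {x \<in> carrier_mat n n. \<forall>i<n. \<forall>j<n. x $$ (i, j) \<noteq> 0 \<longrightarrow> (i, j) \<in> P}"

definition mat_unit :: "nat \<Rightarrow> nat \<times> nat \<Rightarrow> complex mat" where
  "mat_unit n ij = Matrix.mat n n (\<lambda>kl. if kl = ij then 1 else 0)"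

lemma mat_unit_carrier [simp]: "mat_unit n ij \<in> carrier_mat n n"
  by (simp add: mat_unit_def)

lemma mat_unit_dim [simp]: "dim_row (mat_unit n ij) = n" "dim_col (mat_unit n ij) = n"
  by (simp_all add: mat_unit_def)

lemma mat_unit_index [simp]:
  "i < n \<Longrightarrow> j < n \<Longrightarrow> mat_unit n kl $$ (i, j) = (if (i, j) = kl then 1 else 0)"
  by (simp add: mat_unit_def)

lemma subspace_matI:
  assumes "U \<subseteq> carrier_mat n n" "0\<^sub>m n n \<in> U"
    and "\<And>x y. x \<in> U \<Longrightarrow> y \<in> U \<Longrightarrow> x + y \<in> U" "\<And>c x. x \<in> U \<Longrightarrow> c \<cdot>\<^sub>m x \<in> U"
  shows "subspace class_ring U (module_mat TYPE(complex) n n)"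
proof -
  have V: "vectorspace class_ring (module_mat TYPE(complex) n n)" by (rule matrix_vs)
  then have M: "module class_ring (module_mat TYPE(complex) n n)" by (simp add: vectorspace_def)
  have "submodule class_ring U (module_mat TYPE(complex) n n)"
    by (rule submodule.intro) (use M assms in \<open>simp_all add: module_mat_simps\<close>)
  then show ?thesis using V by (simp add: subspace_def)
qed

lemma supportedI:
  "x \<in> carrier_mat n n \<Longrightarrow> (\<And>i j. i < n \<Longrightarrow> j < n \<Longrightarrow> (i, j) \<notin> P \<Longrightarrow> x $$ (i, j) = 0) \<Longrightarrow>
    x \<in> supported n P"
  by (auto simp: supported_def)

lemma supported_carrier: "x \<in> supported n P \<Longrightarrow> x \<in> carrier_mat n n"
  by (simp add: supported_def)

lemma supported_zero:
  "x \<in> supported n P \<Longrightarrow> i < n \<Longrightarrow> j < n \<Longrightarrow> (i, j) \<notin> P \<Longrightarrow> x $$ (i, j) = 0"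
  by (auto simp: supported_def)

lemma supported_add: "x \<in> supported n P \<Longrightarrow> y \<in> supported n P \<Longrightarrow> x + y \<in> supported n P"
  by (rule supportedI)
     (use supported_carrier[of x n P] supported_carrier[of y n P] in \<open>auto simp: supported_zero\<close>)

lemma supported_smult: "x \<in> supported n P \<Longrightarrow> c \<cdot>\<^sub>m x \<in> supported n P"
  by (rule supportedI) (use supported_carrier[of x n P] in \<open>auto simp: supported_zero\<close>)

lemma supported_0: "0\<^sub>m n n \<in> supported n P"
  by (rule supportedI) auto

lemma supported_subspace: "subspace class_ring (supported n P) (module_mat TYPE(complex) n n)"
  by (rule subspace_matI) (auto intro: supported_add supported_smult supported_0 dest: supported_carrier)

text \<open>The matrix units at the positions in \<open>P\<close> are a basis.\<close>

lemma supported_dim: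
  assumes P: "P \<subseteq> {..<n} \<times> {..<n}"
  shows "vectorspace.fin_dim class_ring (mat_subspace n (supported n P))"
    and "vectorspace.dim class_ring (mat_subspace n (supported n P)) = card P"
proof -
  interpret M: vectorspace class_ring "module_mat TYPE(complex) n n" by (rule matrix_vs)
  have "vectorspace class_ring (mat_subspace n (supported n P))"
    unfolding mat_subspace_def by (rule M.subspace_is_vs[OF supported_subspace])
  then interpret W: vectorspace class_ring "mat_subspace n (supported n P)" .
  let ?B = "mat_unit n ` P"
  have finP: "finite P" using finite_subset[OF P] by simp
  have inj: "inj_on (mat_unit n) P"
  proof (rule inj_onI)
    fix p q assume "p \<in> P" "q \<in> P" and e: "mat_unit n p = mat_unit n q"
    then have "mat_unit n p $$ p = mat_unit n q $$ p" by simp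
    then show "p = q" using \<open>p \<in> P\<close> P by (cases p) (auto split: if_splits)
  qed
  have BC: "?B \<subseteq> carrier (mat_subspace n (supported n P))"
    by (auto simp: mat_subspace_def supported_def split: if_splits)
  have lc: "W.lincomb a (mat_unit n ` Q) \<in> carrier_mat n n \<and>
     (\<forall>i<n. \<forall>j<n. W.lincomb a (mat_unit n ` Q) $$ (i,j) = (if (i,j) \<in> Q then a (mat_unit n (i,j)) else 0))"
    if "Q \<subseteq> P" for a Q
    using finite_subset[OF that finP] that
  proof (induction Q rule: finite_induct)
    case empty
    have "\<zero>\<^bsub>mat_subspace n (supported n P)\<^esub> = 0\<^sub>m n n"
      by (simp add: mat_subspace_def module_mat_simps)
    then show ?case by (simp add: W.lincomb_def)
  next
    case (insert q Q)
    have nin: "mat_unit n q \<notin> mat_unit n ` Q"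
      using insert.hyps insert.prems inj by (auto dest!: inj_onD)
    have c1: "mat_unit n q \<in> carrier (mat_subspace n (supported n P))"
      using BC insert.prems by auto
    have c2: "mat_unit n ` Q \<subseteq> carrier (mat_subspace n (supported n P))"
      using BC insert.prems by auto
    have "W.lincomb a (insert (mat_unit n q) (mat_unit n ` Q))
       = a (mat_unit n q) \<odot>\<^bsub>mat_subspace n (supported n P)\<^esub> mat_unit n q
         \<oplus>\<^bsub>mat_subspace n (supported n P)\<^esub> W.lincomb a (mat_unit n ` Q)"
      using nin c1 c2 insert.hyps by (intro W.lincomb_insert2) auto
    then have e: "W.lincomb a (mat_unit n ` insert q Q)
       = a (mat_unit n q) \<cdot>\<^sub>m mat_unit n q + W.lincomb a (mat_unit n ` Q)"
      by (simp add: mat_subspace_def module_mat_simps)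
    show ?case using insert.IH insert.prems insert.hyps unfolding e by auto
  qed
  have span: "W.span ?B = carrier (mat_subspace n (supported n P))"
  proof
    show "W.span ?B \<subseteq> carrier (mat_subspace n (supported n P))"
      by (rule W.span_is_subset2[OF BC])
    show "carrier (mat_subspace n (supported n P)) \<subseteq> W.span ?B"
    proof
      fix x assume "x \<in> carrier (mat_subspace n (supported n P))"
      then have x: "x \<in> supported n P" by (simp add: mat_subspace_def)
      define a where "a v = x $$ inv_into P (mat_unit n) v" for v
      have a: "a (mat_unit n p) = x $$ p" if "p \<in> P" for p
        by (simp only: a_def inv_into_f_f[OF inj that])
      have "W.lincomb a ?B = x"
      proof (rule eq_matI)
        fix i j assume "i < dim_row x" "j < dim_col x"
        then have ij: "i < n" "j < n" using x by (auto simp: supported_def)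
        have "(i, j) \<notin> P \<Longrightarrow> x $$ (i, j) = 0" using supported_zero[OF x ij] .
        then show "W.lincomb a ?B $$ (i, j) = x $$ (i, j)"
          using lc[OF subset_refl, of a] a[of "(i,j)"] ij by presburger
      next
        have "W.lincomb a ?B \<in> carrier_mat n n" "x \<in> carrier_mat n n"
          using lc[OF subset_refl, of a] supported_carrier[OF x] by simp_all
        then show "dim_row (W.lincomb a ?B) = dim_row x" "dim_col (W.lincomb a ?B) = dim_col x"
          by auto
      qed
      then show "x \<in> W.span ?B"
        unfolding W.finite_span[OF finite_imageI[OF finP] BC] by (auto intro!: exI[of _ a])
    qed
  qed
  have li: "W.lin_indpt ?B"
  proof (rule W.finite_lin_indpt2)
    fix a assume z: "W.lincomb a ?B = \<zero>\<^bsub>mat_subspace n (supported n P)\<^esub>"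
    have "a (mat_unit n p) = 0" if pP: "p \<in> P" for p
    proof -
      obtain i j where p: "p = (i, j)" "i < n" "j < n" using pP P by auto
      have "W.lincomb a ?B $$ (i, j) = 0"
        unfolding z using p by (simp add: mat_subspace_def module_mat_simps)
      then show ?thesis using lc[OF subset_refl, of a] p pP by simp
    qed
    then show "\<forall>v\<in>?B. a v = \<zero>\<^bsub>class_ring\<^esub>" by auto
  qed (use finP BC in auto)
  have "W.basis ?B" using li span BC by (simp add: W.basis_def)
  then have "W.dim = card ?B" by (rule W.dim_basis[OF finite_imageI[OF finP]])
  then show "W.dim = card P" using card_image[OF inj] by simp
  show "W.fin_dim" unfolding W.fin_dim_def
    by (intro exI[of _ ?B] conjI finite_imageI[OF finP] BC span)
qed

lemma mat_fin_dim: "vectorspace.fin_dim class_ring (module_mat TYPE(complex) n n)"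
proof -
  have "mat_subspace n (supported n ({..<n} \<times> {..<n})) = module_mat TYPE(complex) n n"
    by (simp add: mat_subspace_def supported_def module_mat_def)
  then show ?thesis using supported_dim(1)[of "{..<n} \<times> {..<n}" n] by simp
qed

lemma mat_subspace_fin_dim:
  assumes "subspace class_ring U (module_mat TYPE(complex) n n)"
  shows "vectorspace.fin_dim class_ring (mat_subspace n U)"
  unfolding mat_subspace_def by (rule subspace_fin_dim(1)[OF matrix_vs mat_fin_dim assms])

lemma mat_subspace_linear_map:
  assumes U: "subspace class_ring U (module_mat TYPE(complex) n n)"
    and W: "subspace class_ring W (module_mat TYPE(complex) n n)"
    and T: "T ` U \<subseteq> W"
    and add: "\<And>x y. x \<in> U \<Longrightarrow> y \<in> U \<Longrightarrow> T (x + y) = T x + T y"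
    and smult: "\<And>c x. x \<in> U \<Longrightarrow> T (c \<cdot>\<^sub>m x) = c \<cdot>\<^sub>m T x"
  shows "linear_map class_ring (mat_subspace n U) (mat_subspace n W) T"
proof -
  interpret M: vectorspace class_ring "module_mat TYPE(complex) n n" by (rule matrix_vs)
  have "vectorspace class_ring (mat_subspace n U)" "vectorspace class_ring (mat_subspace n W)"
    unfolding mat_subspace_def using M.subspace_is_vs U W by blast+
  moreover have "T \<in> LinearCombinations.module_hom class_ring (mat_subspace n U) (mat_subspace n W)"
    using T add smult by (auto simp: LinearCombinations.module_hom_def mat_subspace_def module_mat_simps)
  ultimately show ?thesis
    by (intro linear_map.intro mod_hom.intro mod_hom_axioms.intro) (auto simp: vectorspace_def)
qed

lemma mat_subspace_inj_dim_le:
  assumes U: "subspace class_ring U (module_mat TYPE(complex) n n)"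
    and W: "subspace class_ring W (module_mat TYPE(complex) n n)"
    and T: "T ` U \<subseteq> W" "inj_on T U"
    and lin: "\<And>x y. x \<in> U \<Longrightarrow> y \<in> U \<Longrightarrow> T (x + y) = T x + T y"
      "\<And>c x. x \<in> U \<Longrightarrow> T (c \<cdot>\<^sub>m x) = c \<cdot>\<^sub>m T x"
  shows "vectorspace.dim class_ring (mat_subspace n U) \<le> vectorspace.dim class_ring (mat_subspace n W)"
proof (rule linear_inj_dim_le)
  show "linear_map class_ring (mat_subspace n U) (mat_subspace n W) T"
    by (rule mat_subspace_linear_map) (use assms in auto)
  show "inj_on T (carrier (mat_subspace n U))" using T(2) by (simp add: mat_subspace_def)
qed (intro mat_subspace_fin_dim U W)+

section \<open>Traces and brackets of matrices\<close>

lemma index_mult_sum: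
  assumes "A \<in> carrier_mat n m" "B \<in> carrier_mat m k" "i < n" "j < k"
  shows "(A * B) $$ (i, j) = (\<Sum>l<m. A $$ (i, l) * B $$ (l, j))"
  using assms by (auto simp: scalar_prod_def atLeast0LessThan)

lemma mat_trace_carrier: "A \<in> carrier_mat n n \<Longrightarrow> mat_trace A = (\<Sum>i<n. A $$ (i, i))"
  by (auto simp: mat_trace_def)

lemma mat_trace_add:
  "A \<in> carrier_mat n n \<Longrightarrow> B \<in> carrier_mat n n \<Longrightarrow> mat_trace (A + B) = mat_trace A + mat_trace B"
  by (auto simp: mat_trace_def sum.distrib)

lemma mat_trace_minus:
  "A \<in> carrier_mat n n \<Longrightarrow> B \<in> carrier_mat n n \<Longrightarrow> mat_trace (A - B) = mat_trace A - mat_trace B"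
  by (auto simp: mat_trace_def sum_subtractf)

lemma mat_trace_smult: "A \<in> carrier_mat n n \<Longrightarrow> mat_trace (c \<cdot>\<^sub>m A) = c * mat_trace A"
  by (auto simp: mat_trace_def sum_distrib_left)

lemma mat_trace_mult:
  assumes "A \<in> carrier_mat n n" "B \<in> carrier_mat n n"
  shows "mat_trace (A * B) = (\<Sum>i<n. \<Sum>j<n. A $$ (i, j) * B $$ (j, i))"
  using assms by (auto simp: mat_trace_def index_mult_sum[where m = n and k = n and n = n]
      simp del: index_mult_mat(1) intro!: sum.cong)

lemma mat_trace_comm:
  assumes "A \<in> carrier_mat n n" "B \<in> carrier_mat n n"
  shows "mat_trace (A * B) = mat_trace (B * A)"
  unfolding mat_trace_mult[OF assms] mat_trace_mult[OF assms(2,1)]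
  by (subst sum.swap) (simp add: mult.commute)

lemma lie_bracket_carrier [simp]:
  "x \<in> carrier_mat n n \<Longrightarrow> y \<in> carrier_mat n n \<Longrightarrow> lie_bracket x y \<in> carrier_mat n n"
  by (simp add: lie_bracket_def minus_carrier_mat)

lemma mat_trace_lie_bracket:
  "x \<in> carrier_mat n n \<Longrightarrow> y \<in> carrier_mat n n \<Longrightarrow> mat_trace (lie_bracket x y) = 0"
  unfolding lie_bracket_def
  by (subst mat_trace_minus[of _ n]) (auto simp: mat_trace_comm[of x n y])

lemma lie_bracket_smult_one:
  assumes "x \<in> carrier_mat n n"
  shows "lie_bracket x (c \<cdot>\<^sub>m 1\<^sub>m n) = 0\<^sub>m n n" "lie_bracket (c \<cdot>\<^sub>m 1\<^sub>m n) x = 0\<^sub>m n n"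
  using assms by (simp_all add: lie_bracket_def mult_smult_distrib[of _ n n _ n] mult_smult_assoc_mat[of _ n n _ n])

lemma lie_bracket_add_right:
  assumes "x \<in> carrier_mat n n" "y \<in> carrier_mat n n" "z \<in> carrier_mat n n"
  shows "lie_bracket x (y + z) = lie_bracket x y + lie_bracket x z"
proof -
  have "x * y \<in> carrier_mat n n" "x * z \<in> carrier_mat n n" "y * x \<in> carrier_mat n n" "z * x \<in> carrier_mat n n"
    using assms by auto
  then show ?thesis unfolding lie_bracket_def mult_add_distrib_mat[OF assms] add_mult_distrib_mat[OF assms(2,3,1)]
    by (intro eq_matI) (auto simp del: index_mult_mat)
qed

lemma lie_bracket_smult_right:
  assumes "x \<in> carrier_mat n n" "y \<in> carrier_mat n n"
  shows "lie_bracket x (c \<cdot>\<^sub>m y) = c \<cdot>\<^sub>m lie_bracket x y"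
proof -
  have "x * y \<in> carrier_mat n n" "y * x \<in> carrier_mat n n" using assms by auto
  then show ?thesis unfolding lie_bracket_def mult_smult_distrib[OF assms] mult_smult_assoc_mat[OF assms(2,1)]
    by (intro eq_matI) (auto simp del: index_mult_mat simp: algebra_simps)
qed

lemma lie_bracket_swap:
  assumes "x \<in> carrier_mat n n" "y \<in> carrier_mat n n"
  shows "lie_bracket x y = - lie_bracket y x"
  unfolding lie_bracket_def by (intro eq_matI) (use assms in \<open>auto simp del: index_mult_mat(1)\<close>)

lemma mat_minus_mult:
  fixes A B C :: "complex mat"
  assumes "A \<in> carrier_mat n n" "B \<in> carrier_mat n n" "C \<in> carrier_mat n n"
  shows "(A - B) * C = A * C - B * C" "C * (A - B) = C * A - C * B"
  by (rule minus_mult_distrib_mat[OF assms], rule mult_minus_distrib_mat[OF assms(3,1,2)])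

lemma lie_jacobi:
  assumes "h \<in> carrier_mat n n" "y \<in> carrier_mat n n" "x \<in> carrier_mat n n"
  shows "lie_bracket h (lie_bracket y x) - lie_bracket y (lie_bracket h x) = lie_bracket (lie_bracket h y) x"
proof -
  have c: "a * b \<in> carrier_mat n n" if "a \<in> carrier_mat n n" "b \<in> carrier_mat n n" for a b :: "complex mat"
    using that by simp
  have m: "a * b * d = a * (b * d)"
    if "a \<in> carrier_mat n n" "b \<in> carrier_mat n n" "d \<in> carrier_mat n n" for a b d :: "complex mat"
    by (rule assoc_mult_mat[OF that])
  note cs = c[OF c[OF assms(1,2)] assms(3)] c[OF c[OF assms(1,3)] assms(2)] c[OF c[OF assms(2,1)] assms(3)]
    c[OF c[OF assms(2,3)] assms(1)] c[OF c[OF assms(3,1)] assms(2)] c[OF c[OF assms(3,2)] assms(1)]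
  show ?thesis unfolding lie_bracket_def
    apply (simp only: mat_minus_mult[of _ n] c assms m minus_carrier_mat)
    apply (rule eq_matI)
    using cs by (simp_all add: m assms del: index_mult_mat)
qed

section \<open>Polynomials in a matrix and incidence algebras\<close>

lemma lie_bracket_add_left:
  assumes "x \<in> carrier_mat n n" "y \<in> carrier_mat n n" "z \<in> carrier_mat n n"
  shows "lie_bracket (x + y) z = lie_bracket x z + lie_bracket y z"
proof -
  have "x * z \<in> carrier_mat n n" "y * z \<in> carrier_mat n n" "z * x \<in> carrier_mat n n" "z * y \<in> carrier_mat n n"
    using assms by auto
  then show ?thesis unfolding lie_bracket_def mult_add_distrib_mat[OF assms(3,1,2)] add_mult_distrib_mat[OF assms]
    by (intro eq_matI) (auto simp del: index_mult_mat)
qed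

text \<open>The bracket with a fixed matrix is a derivation of the matrix product.\<close>

lemma lie_bracket_mult_left:
  assumes "a \<in> carrier_mat n n" "b \<in> carrier_mat n n" "y \<in> carrier_mat n n"
  shows "lie_bracket (a * b) y = lie_bracket a y * b + a * lie_bracket b y"
proof -
  have c: "u * v \<in> carrier_mat n n" if "u \<in> carrier_mat n n" "v \<in> carrier_mat n n" for u v :: "complex mat"
    using that by simp
  have m: "u * v * w = u * (v * w)"
    if "u \<in> carrier_mat n n" "v \<in> carrier_mat n n" "w \<in> carrier_mat n n" for u v w :: "complex mat"
    by (rule assoc_mult_mat[OF that])
  note cs = c[OF c[OF assms(1,2)] assms(3)] c[OF c[OF assms(1,3)] assms(2)] c[OF c[OF assms(3,1)] assms(2)]
  show ?thesis unfolding lie_bracket_def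
    apply (simp only: mat_minus_mult[of _ n] c assms m minus_carrier_mat)
    apply (rule eq_matI)
    using cs by (simp_all add: m assms del: index_mult_mat)
qed

definition mat_poly :: "nat \<Rightarrow> complex poly \<Rightarrow> complex mat \<Rightarrow> complex mat" where
  "mat_poly n p X = fold_coeffs (\<lambda>a Y. a \<cdot>\<^sub>m 1\<^sub>m n + X * Y) p (0\<^sub>m n n)"

lemma mat_poly_0 [simp]: "mat_poly n 0 X = 0\<^sub>m n n"
  by (simp add: mat_poly_def)

lemma mat_poly_pCons:
  assumes "X \<in> carrier_mat n n"
  shows "mat_poly n (pCons a p) X = a \<cdot>\<^sub>m 1\<^sub>m n + X * mat_poly n p X"
proof (cases "a = 0 \<and> p = 0")
  case True
  have "0 \<cdot>\<^sub>m 1\<^sub>m n + X * 0\<^sub>m n n = 0\<^sub>m n n" using assms by (intro eq_matI) auto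
  then show ?thesis using True by simp
next
  case False
  then show ?thesis by (cases "p = 0") (auto simp: mat_poly_def)
qed

lemma mat_poly_carrier [simp]: "X \<in> carrier_mat n n \<Longrightarrow> mat_poly n p X \<in> carrier_mat n n"
  by (induction p) (auto simp: mat_poly_pCons)

lemma mat_poly_add:
  assumes X: "X \<in> carrier_mat n n"
  shows "mat_poly n (p + q) X = mat_poly n p X + mat_poly n q X"
proof (induction p q rule: poly_induct2)
  case (pCons a p b q)
  have c: "mat_poly n p X \<in> carrier_mat n n" "mat_poly n q X \<in> carrier_mat n n" using X by auto
  have "X * mat_poly n p X \<in> carrier_mat n n" "X * mat_poly n q X \<in> carrier_mat n n" using X c by auto
  then show ?case unfolding add_pCons mat_poly_pCons[OF X] pCons.IH mult_add_distrib_mat[OF X c]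
    by (intro eq_matI) (auto simp del: index_mult_mat simp: algebra_simps)
qed auto

lemma mat_poly_smult:
  assumes X: "X \<in> carrier_mat n n"
  shows "mat_poly n (Polynomial.smult c p) X = c \<cdot>\<^sub>m mat_poly n p X"
proof (induction p)
  case (pCons a p)
  have c: "mat_poly n p X \<in> carrier_mat n n" using X by auto
  have "X * mat_poly n p X \<in> carrier_mat n n" using X c by auto
  then show ?case unfolding smult_pCons mat_poly_pCons[OF X] pCons.IH mult_smult_distrib[OF X c]
    by (intro eq_matI) (auto simp del: index_mult_mat simp: algebra_simps)
qed auto

lemma mat_poly_mult:
  assumes X: "X \<in> carrier_mat n n"
  shows "mat_poly n (p * q) X = mat_poly n p X * mat_poly n q X"
proof (induction p)
  case 0
  show ?case using left_mult_zero_mat[OF mat_poly_carrier[OF X], of n q] by simp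
next
  case (pCons a p)
  have c: "mat_poly n p X \<in> carrier_mat n n" "mat_poly n q X \<in> carrier_mat n n" using X by auto
  have d: "X * mat_poly n p X \<in> carrier_mat n n" using X c by auto
  have "mat_poly n (pCons a p * q) X = a \<cdot>\<^sub>m mat_poly n q X + (0 \<cdot>\<^sub>m 1\<^sub>m n + X * mat_poly n (p * q) X)"
    unfolding mult_pCons_left mat_poly_add[OF X] mat_poly_smult[OF X] mat_poly_pCons[OF X] ..
  also have "0 \<cdot>\<^sub>m 1\<^sub>m n + X * mat_poly n (p * q) X = X * mat_poly n p X * mat_poly n q X"
  proof -
    have "X * (mat_poly n p X * mat_poly n q X) \<in> carrier_mat n n"
      by (intro mult_carrier_mat[OF X] mult_carrier_mat[OF c])
    then show ?thesis unfolding pCons.IH assoc_mult_mat[OF X c]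
      by (intro eq_matI) (auto simp del: index_mult_mat)
  qed
  also have "a \<cdot>\<^sub>m mat_poly n q X = (a \<cdot>\<^sub>m 1\<^sub>m n) * mat_poly n q X"
    using c by (simp add: mult_smult_assoc_mat[of _ n n _ n])
  finally show ?case unfolding mat_poly_pCons[OF X] add_mult_distrib_mat[OF smult_carrier_mat[OF one_carrier_mat] d c(2)] .
qed

lemma mat_poly_1:
  assumes "X \<in> carrier_mat n n"
  shows "mat_poly n 1 X = 1\<^sub>m n"
  unfolding one_pCons mat_poly_pCons[OF assms] using assms by (intro eq_matI) auto

lemma mat_poly_dvd_zero:
  assumes X: "X \<in> carrier_mat n n" and "p dvd q" "mat_poly n p X = 0\<^sub>m n n"
  shows "mat_poly n q X = 0\<^sub>m n n"
proof -
  obtain r where "q = p * r" using assms(2) by (elim dvdE)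
  then show ?thesis
    using left_mult_zero_mat[OF mat_poly_carrier[OF X], of n r] assms(3) by (simp add: mat_poly_mult[OF X])
qed

text \<open>A polynomial acts on a diagonal matrix entry by entry.\<close>

lemma mat_poly_diag_zero:
  assumes X: "X = Matrix.mat n n (\<lambda>(i, j). if i = j then d i else 0)"
    and "\<And>i. i < n \<Longrightarrow> poly p (d i) = 0"
  shows "mat_poly n p X = 0\<^sub>m n n"
proof -
  have Xc: "X \<in> carrier_mat n n" by (simp add: X)
  have "mat_poly n p X = Matrix.mat n n (\<lambda>(i, j). if i = j then poly p (d i) else 0)"
  proof (induction p)
    case 0
    show ?case by (intro eq_matI) auto
  next
    case (pCons a p)
    have "X * mat_poly n p X = Matrix.mat n n (\<lambda>(i, j). if i = j then d i * poly p (d i) else 0)"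
    proof (rule eq_matI)
      fix i j assume "i < dim_row (Matrix.mat n n (\<lambda>(i, j). if i = j then d i * poly p (d i) else 0))"
        "j < dim_col (Matrix.mat n n (\<lambda>(i, j). if i = j then d i * poly p (d i) else 0))"
      then have ij: "i < n" "j < n" by auto
      have "(X * mat_poly n p X) $$ (i, j) = (\<Sum>l<n. X $$ (i, l) * mat_poly n p X $$ (l, j))"
        by (rule index_mult_sum[OF Xc _ ij]) (use Xc in simp)
      also have "\<dots> = (\<Sum>l<n. if l = i then (if i = j then d i * poly p (d i) else 0) else 0)"
        by (rule sum.cong) (use ij pCons.IH X in auto)
      finally show "(X * mat_poly n p X) $$ (i, j) =
          Matrix.mat n n (\<lambda>(i, j). if i = j then d i * poly p (d i) else 0) $$ (i, j)"
        using ij by simp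
    qed (use carrier_matD[OF mat_poly_carrier[OF Xc, of p]] carrier_matD[OF Xc] in simp_all)
    then show ?case unfolding mat_poly_pCons[OF Xc] by (intro eq_matI) auto
  qed
  then show ?thesis using assms(2) by (intro eq_matI) auto
qed

text \<open>Transitivity of \<open>S\<close> makes the matrices supported on \<open>S\<close> an algebra. Both the parabolic and all polynomials
in its elements live there, which the trace-zero part alone would not allow.\<close>

locale incidence_algebra =
  fixes n :: nat and S :: "(nat \<times> nat) set"
  assumes S_sub: "S \<subseteq> {..<n} \<times> {..<n}"
    and S_refl: "\<And>i. i < n \<Longrightarrow> (i, i) \<in> S"
    and S_trans: "\<And>i j k. (i, j) \<in> S \<Longrightarrow> (j, k) \<in> S \<Longrightarrow> (i, k) \<in> S"
begin

abbreviation Alg :: "complex mat set" where "Alg \<equiv> supported n S"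

lemma Alg_mult:
  assumes "x \<in> Alg" "y \<in> Alg"
  shows "x * y \<in> Alg"
proof (rule supportedI)
  have c: "x \<in> carrier_mat n n" "y \<in> carrier_mat n n" using assms by (simp_all add: supported_carrier)
  then show "x * y \<in> carrier_mat n n" by simp
  fix i j assume ij: "i < n" "j < n" "(i, j) \<notin> S"
  have "x $$ (i, l) * y $$ (l, j) = 0" if "l < n" for l
  proof (cases "(i, l) \<in> S")
    case True
    then have "(l, j) \<notin> S" using ij(3) S_trans by metis
    then show ?thesis using supported_zero[OF assms(2) that ij(2)] by simp
  next
    case False
    then show ?thesis using supported_zero[OF assms(1) ij(1) that] by simp
  qed
  then show "(x * y) $$ (i, j) = 0" unfolding index_mult_sum[OF c ij(1,2)] by (simp add: sum.neutral)
qed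

lemma Alg_one: "1\<^sub>m n \<in> Alg"
  by (rule supportedI) (use S_refl in auto)

lemma Alg_minus:
  assumes "x \<in> Alg" "y \<in> Alg"
  shows "x - y \<in> Alg"
  by (rule supportedI) (use supported_carrier[OF assms(1)] supported_carrier[OF assms(2)]
    supported_zero[OF assms(1)] supported_zero[OF assms(2)] in \<open>auto intro: minus_carrier_mat\<close>)

lemma Alg_lie_bracket: "x \<in> Alg \<Longrightarrow> y \<in> Alg \<Longrightarrow> lie_bracket x y \<in> Alg"
  unfolding lie_bracket_def by (intro Alg_minus Alg_mult)

lemma Alg_mat_poly:
  assumes "x \<in> Alg"
  shows "mat_poly n p x \<in> Alg"
proof (induction p)
  case 0
  show ?case by (simp add: supported_0)
next
  case (pCons a p)
  show ?case unfolding mat_poly_pCons[OF supported_carrier[OF assms]]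
    by (intro supported_add supported_smult Alg_one Alg_mult assms pCons.IH)
qed

end

section \<open>Lax equations\<close>

lemma index_add_carrier:
  "B \<in> carrier_mat n m \<Longrightarrow> i < n \<Longrightarrow> j < m \<Longrightarrow> (A + B) $$ (i, j) = A $$ (i, j) + B $$ (i, j)"
  by (auto simp: index_add_mat(1))

lemma index_minus_carrier:
  "B \<in> carrier_mat n m \<Longrightarrow> i < n \<Longrightarrow> j < m \<Longrightarrow> (A - B) $$ (i, j) = A $$ (i, j) - B $$ (i, j)"
  by (auto simp: index_minus_mat(1))

definition has_mat_deriv :: "nat \<Rightarrow> (complex \<Rightarrow> complex mat) \<Rightarrow> complex mat \<Rightarrow> complex \<Rightarrow> bool" where
  "has_mat_deriv n M D t \<longleftrightarrow>
    (\<forall>i<n. \<forall>j<n. ((\<lambda>s. M s $$ (i, j)) has_field_derivative D $$ (i, j)) (at t))"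

definition mat_holomorphic :: "nat \<Rightarrow> (complex \<Rightarrow> complex mat) \<Rightarrow> complex set \<Rightarrow> bool" where
  "mat_holomorphic n M U \<longleftrightarrow> (\<forall>i<n. \<forall>j<n. (\<lambda>s. M s $$ (i, j)) holomorphic_on U)"

lemma has_mat_deriv_mult:
  assumes M: "\<And>s. M s \<in> carrier_mat n n" and N: "\<And>s. N s \<in> carrier_mat n n"
    and D: "D \<in> carrier_mat n n" and E: "E \<in> carrier_mat n n"
    and "has_mat_deriv n M D t" "has_mat_deriv n N E t"
  shows "has_mat_deriv n (\<lambda>s. M s * N s) (D * N t + M t * E) t"
  unfolding has_mat_deriv_def
proof (intro allI impI)
  fix i j assume ij: "i < n" "j < n"
  have e: "(M s * N s) $$ (i, j) = (\<Sum>l<n. M s $$ (i, l) * N s $$ (l, j))" for s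
    by (rule index_mult_sum[OF M N ij])
  have "((\<lambda>s. \<Sum>l<n. M s $$ (i, l) * N s $$ (l, j)) has_field_derivative
      (\<Sum>l<n. D $$ (i, l) * N t $$ (l, j) + E $$ (l, j) * M t $$ (i, l))) (at t)"
    by (rule DERIV_sum, rule DERIV_mult) (use assms(5,6) ij in \<open>auto simp: has_mat_deriv_def\<close>)
  also have "(\<Sum>l<n. D $$ (i, l) * N t $$ (l, j) + E $$ (l, j) * M t $$ (i, l)) = (D * N t + M t * E) $$ (i, j)"
    unfolding index_add_carrier[OF mult_carrier_mat[OF M E] ij] index_mult_sum[OF D N ij] index_mult_sum[OF M E ij]
    by (simp add: sum.distrib mult.commute)
  finally show "((\<lambda>s. (M s * N s) $$ (i, j)) has_field_derivative (D * N t + M t * E) $$ (i, j)) (at t)"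
    unfolding e .
qed

text \<open>A Lax equation for \<open>H\<close> passes to every polynomial in \<open>H\<close>, because the bracket with a
  fixed matrix is a derivation.\<close>

lemma mat_poly_lax_deriv:
  assumes H: "\<And>s. H s \<in> carrier_mat n n" and y: "y \<in> carrier_mat n n"
    and d: "has_mat_deriv n H (lie_bracket (H t) y) t"
  shows "has_mat_deriv n (\<lambda>s. mat_poly n p (H s)) (lie_bracket (mat_poly n p (H t)) y) t"
proof (induction p)
  case 0
  have "lie_bracket (0\<^sub>m n n) y = 0\<^sub>m n n"
    using left_mult_zero_mat[OF y] right_mult_zero_mat[OF y] by (auto simp: lie_bracket_def)
  then show ?case by (simp add: has_mat_deriv_def)
next
  case (pCons a p)
  let ?P = "\<lambda>s. mat_poly n p (H s)"
  have P: "?P s \<in> carrier_mat n n" for s by (rule mat_poly_carrier[OF H])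
  have c: "a \<cdot>\<^sub>m 1\<^sub>m n \<in> carrier_mat n n" by simp
  have "has_mat_deriv n (\<lambda>s. H s * ?P s) (lie_bracket (H t) y * ?P t + H t * lie_bracket (?P t) y) t"
    by (rule has_mat_deriv_mult[OF H P]) (intro lie_bracket_carrier H P y d pCons.IH)+
  then have 1: "has_mat_deriv n (\<lambda>s. H s * ?P s) (lie_bracket (H t * ?P t) y) t"
    unfolding lie_bracket_mult_left[OF H P y] .
  have 2: "lie_bracket (mat_poly n (pCons a p) (H t)) y = lie_bracket (H t * ?P t) y"
  proof -
    have "lie_bracket (H t * ?P t) y \<in> carrier_mat n n"
      by (intro lie_bracket_carrier mult_carrier_mat[OF H P] y)
    then show ?thesis
      unfolding mat_poly_pCons[OF H] lie_bracket_add_left[OF c mult_carrier_mat[OF H P] y]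
        lie_bracket_smult_one(2)[OF y] by (rule left_add_zero_mat)
  qed
  have e: "mat_poly n (pCons a p) (H s) $$ (i, j) = a * (if i = j then 1 else 0) + (H s * ?P s) $$ (i, j)"
    if "i < n" "j < n" for i j s
    unfolding mat_poly_pCons[OF H] index_add_carrier[OF mult_carrier_mat[OF H P] that] using that by simp
  show ?case unfolding 2 has_mat_deriv_def
  proof (intro allI impI)
    fix i j assume ij: "i < n" "j < n"
    have "((\<lambda>s. (H s * ?P s) $$ (i, j)) has_field_derivative lie_bracket (H t * ?P t) y $$ (i, j)) (at t)"
      using 1 ij by (simp add: has_mat_deriv_def)
    then show "((\<lambda>s. mat_poly n (pCons a p) (H s) $$ (i, j)) has_field_derivative
        lie_bracket (H t * ?P t) y $$ (i, j)) (at t)"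
      unfolding e[OF ij] by (auto intro!: derivative_eq_intros)
  qed
qed

lemma higher_deriv_sum:
  assumes "finite I" "open U" "z \<in> U" "\<And>i. i \<in> I \<Longrightarrow> f i holomorphic_on U"
  shows "(deriv ^^ k) (\<lambda>w. \<Sum>i\<in>I. f i w) z = (\<Sum>i\<in>I. (deriv ^^ k) (f i) z)"
  using assms(1,4)
proof (induction I rule: finite_induct)
  case empty
  show ?case by simp
next
  case (insert i I)
  have "(\<lambda>w. \<Sum>i\<in>I. f i w) holomorphic_on U" by (intro holomorphic_on_sum insert.prems) simp
  then have "(deriv ^^ k) (\<lambda>w. f i w + (\<Sum>i\<in>I. f i w)) z
      = (deriv ^^ k) (f i) z + (deriv ^^ k) (\<lambda>w. \<Sum>i\<in>I. f i w) z"
    by (intro higher_deriv_add[where S = U]) (use assms insert.prems in auto)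
  then show ?case using insert by simp
qed

text \<open>A zero of the solution of a linear equation \<open>M' = [M, y]\<close> spreads: all derivatives of \<open>M\<close> at \<open>z\<close> vanish by
induction on the order and the Leibniz rule, and the identity theorem does the rest on the connected set.\<close>

lemma lax_solution_zero:
  assumes U: "open U" "connected U" and z: "z \<in> U" and t: "t \<in> U"
    and M: "\<And>s. M s \<in> carrier_mat n n" and y: "\<And>s. y s \<in> carrier_mat n n"
    and holM: "mat_holomorphic n M U" and holy: "mat_holomorphic n y U"
    and lax: "\<And>s. s \<in> U \<Longrightarrow> has_mat_deriv n M (lie_bracket (M s) (y s)) s"
    and zero: "M z = 0\<^sub>m n n"
  shows "M t = 0\<^sub>m n n"
proof -
  have hM: "(\<lambda>s. M s $$ (i, j)) holomorphic_on U" and hy: "(\<lambda>s. y s $$ (i, j)) holomorphic_on U"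
    if "i < n" "j < n" for i j
    using holM holy that by (simp_all add: mat_holomorphic_def)
  have vanish: "\<forall>i<n. \<forall>j<n. (deriv ^^ k) (\<lambda>s. M s $$ (i, j)) z = 0" for k
  proof (induction k rule: less_induct)
    case (less k)
    show ?case
    proof (cases k)
      case 0
      then show ?thesis by (simp add: zero)
    next
      case (Suc l)
      show ?thesis
      proof (intro allI impI)
        fix i j assume ij: "i < n" "j < n"
        define g where "g s = (\<Sum>a<n. M s $$ (i, a) * y s $$ (a, j)) - (\<Sum>a<n. y s $$ (i, a) * M s $$ (a, j))" for s
        have dg: "deriv (\<lambda>s. M s $$ (i, j)) s = g s" if "s \<in> U" for s
        proof -
          have e: "lie_bracket (M s) (y s) $$ (i, j) = g s"
            unfolding lie_bracket_def g_def index_minus_carrier[OF mult_carrier_mat[OF y M] ij]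
              index_mult_sum[OF M y ij] index_mult_sum[OF y M ij] ..
          have "((\<lambda>s. M s $$ (i, j)) has_field_derivative g s) (at s)"
            using lax[OF that] ij unfolding has_mat_deriv_def e[symmetric] by blast
          then show ?thesis by (rule DERIV_imp_deriv)
        qed
        have h1: "(\<lambda>s. \<Sum>a<n. M s $$ (i, a) * y s $$ (a, j)) holomorphic_on U"
          and h2: "(\<lambda>s. \<Sum>a<n. y s $$ (i, a) * M s $$ (a, j)) holomorphic_on U"
          by (intro holomorphic_on_sum holomorphic_on_mult hM hy; use ij in simp)+
        have hg: "g holomorphic_on U" unfolding g_def by (intro holomorphic_on_diff h1 h2)
        have p: "(deriv ^^ l) (\<lambda>s. f s * M s $$ (a, b)) z = 0"
          if "f holomorphic_on U" "a < n" "b < n" for f a b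
        proof -
          have "(deriv ^^ l) (\<lambda>s. f s * M s $$ (a, b)) z = (\<Sum>r = 0..l. of_nat (l choose r) *
              (deriv ^^ r) f z * (deriv ^^ (l - r)) (\<lambda>s. M s $$ (a, b)) z)"
            by (rule higher_deriv_mult[OF that(1) hM[OF that(2,3)] U(1) z])
          also have "\<dots> = 0"
            using less.IH that(2,3) Suc by (intro sum.neutral) (auto simp: less_Suc_eq_le)
          finally show ?thesis .
        qed
        have "(deriv ^^ k) (\<lambda>s. M s $$ (i, j)) z = (deriv ^^ l) (deriv (\<lambda>s. M s $$ (i, j))) z"
          by (simp add: Suc funpow_swap1)
        also have "\<dots> = (deriv ^^ l) g z"
          by (rule higher_deriv_transform_within_open[OF _ hg U(1) z dg])
             (rule holomorphic_deriv[OF hM[OF ij] U(1)])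
        also have "\<dots> = (deriv ^^ l) (\<lambda>s. \<Sum>a<n. M s $$ (i, a) * y s $$ (a, j)) z
            - (deriv ^^ l) (\<lambda>s. \<Sum>a<n. y s $$ (i, a) * M s $$ (a, j)) z"
          unfolding g_def by (rule higher_deriv_diff[OF h1 h2 U(1) z])
        also have "(deriv ^^ l) (\<lambda>s. \<Sum>a<n. y s $$ (i, a) * M s $$ (a, j)) z
            = (\<Sum>a<n. (deriv ^^ l) (\<lambda>s. y s $$ (i, a) * M s $$ (a, j)) z)"
          by (rule higher_deriv_sum[OF _ U(1) z]) (use ij in \<open>auto intro!: holomorphic_on_mult hM hy\<close>)
        also have "\<dots> = 0" by (intro sum.neutral ballI p hy) (use ij in auto)
        also have "(deriv ^^ l) (\<lambda>s. \<Sum>a<n. M s $$ (i, a) * y s $$ (a, j)) z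
            = (\<Sum>a<n. (deriv ^^ l) (\<lambda>s. M s $$ (i, a) * y s $$ (a, j)) z)"
          by (rule higher_deriv_sum[OF _ U(1) z]) (use ij in \<open>auto intro!: holomorphic_on_mult hM hy\<close>)
        also have "\<dots> = (\<Sum>a<n. (deriv ^^ l) (\<lambda>s. y s $$ (a, j) * M s $$ (i, a)) z)"
          by (simp add: mult.commute)
        also have "\<dots> = 0" by (intro sum.neutral ballI p hy) (use ij in auto)
        finally show "(deriv ^^ k) (\<lambda>s. M s $$ (i, j)) z = 0" by simp
      qed
    qed
  qed
  have "M t $$ (i, j) = 0" if "i < n" "j < n" for i j
    by (rule holomorphic_fun_eq_0_on_connected[OF hM[OF that] U _ z t]) (use vanish that in blast)
  then show ?thesis using M[of t] by (intro eq_matI) auto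
qed

section \<open>Linear systems with holomorphic coefficients\<close>

lemma det_holomorphic:
  assumes M: "\<And>s. M s \<in> carrier_mat N N" and h: "mat_holomorphic N M U"
  shows "(\<lambda>s. Determinant.det (M s)) holomorphic_on U"
proof -
  have "(\<lambda>s. \<Sum>p | p permutes {0..<N}. signof p * (\<Prod>i = 0..<N. M s $$ (i, p i))) holomorphic_on U"
  proof (intro holomorphic_on_sum holomorphic_on_mult holomorphic_on_const holomorphic_on_prod)
    fix p i assume "p \<in> {p. p permutes {0..<N}}" "i \<in> {0..<N}"
    then have "i < N" "p i < N" using permutes_in_image[of p "{0..<N}" i] by auto
    then show "(\<lambda>s. M s $$ (i, p i)) holomorphic_on U" using h by (simp add: mat_holomorphic_def)
  qed
  then show ?thesis by (simp add: det_def'[OF M])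
qed

lemma adj_mat_holomorphic:
  assumes M: "\<And>s. M s \<in> carrier_mat N N" and h: "mat_holomorphic N M U"
  shows "mat_holomorphic N (\<lambda>s. adj_mat (M s)) U"
  unfolding mat_holomorphic_def
proof (intro allI impI)
  fix i j assume ij: "i < N" "j < N"
  have "(\<lambda>s. Determinant.det (mat_delete (M s) j i)) holomorphic_on U"
  proof (rule det_holomorphic)
    show "mat_delete (M s) j i \<in> carrier_mat (N - 1) (N - 1)" for s by (rule mat_delete_carrier[OF M])
    show "mat_holomorphic (N - 1) (\<lambda>s. mat_delete (M s) j i) U"
      unfolding mat_holomorphic_def
    proof (intro allI impI)
      fix a b assume "a < N - 1" "b < N - 1"
      then have "mat_delete (M s) j i $$ (a, b) = M s $$ (if a < j then a else Suc a, if b < i then b else Suc b)" for s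
        using M[of s] by (auto simp: mat_delete_def)
      moreover have "(if a < j then a else Suc a) < N" "(if b < i then b else Suc b) < N"
        using \<open>a < N - 1\<close> \<open>b < N - 1\<close> by auto
      ultimately show "(\<lambda>s. mat_delete (M s) j i $$ (a, b)) holomorphic_on U"
        using h by (simp add: mat_holomorphic_def)
    qed
  qed
  then have "(\<lambda>s. (-1) ^ (j + i) * Determinant.det (mat_delete (M s) j i)) holomorphic_on U"
    by (intro holomorphic_on_mult holomorphic_on_const)
  moreover have "adj_mat (M s) $$ (i, j) = (-1) ^ (j + i) * Determinant.det (mat_delete (M s) j i)" for s
    using M[of s] ij by (simp add: adj_mat_def cofactor_def)
  ultimately show "(\<lambda>s. adj_mat (M s) $$ (i, j)) holomorphic_on U" by simp
qed

text \<open>The solution given by the adjugate matrix depends holomorphically on the parameter.\<close>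

lemma cramer_holomorphic:
  assumes M: "\<And>s. M s \<in> carrier_mat N N" and h: "mat_holomorphic N M U"
    and l: "\<And>a. a < N \<Longrightarrow> l a holomorphic_on U"
    and nz: "\<And>s. s \<in> U \<Longrightarrow> Determinant.det (M s) \<noteq> 0"
  shows "\<exists>c. (\<forall>b<N. c b holomorphic_on U) \<and>
    (\<forall>s\<in>U. \<forall>a<N. (\<Sum>b<N. M s $$ (a, b) * c b s) = l a s)"
proof (intro exI conjI ballI allI impI)
  define c where "c b s = (\<Sum>a<N. adj_mat (M s) $$ (b, a) * l a s) / Determinant.det (M s)" for b s
  show "c b holomorphic_on U" if "b < N" for b
    unfolding c_def using adj_mat_holomorphic[OF M h] that
    by (intro holomorphic_on_divide holomorphic_on_sum holomorphic_on_mult det_holomorphic[OF M h] l nz)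
       (auto simp: mat_holomorphic_def)
  show "(\<Sum>b<N. M s $$ (a, b) * c b s) = l a s" if s: "s \<in> U" and a: "a < N" for s a
  proof -
    have adj: "adj_mat (M s) \<in> carrier_mat N N" "M s * adj_mat (M s) = Determinant.det (M s) \<cdot>\<^sub>m 1\<^sub>m N"
      using adj_mat[OF M[of s]] by blast+
    have "(\<Sum>b<N. M s $$ (a, b) * c b s)
        = (\<Sum>b<N. \<Sum>k<N. M s $$ (a, b) * adj_mat (M s) $$ (b, k) * l k s) / Determinant.det (M s)"
      by (simp add: c_def sum_divide_distrib sum_distrib_left mult.assoc)
    also have "(\<Sum>b<N. \<Sum>k<N. M s $$ (a, b) * adj_mat (M s) $$ (b, k) * l k s)
        = (\<Sum>k<N. (M s * adj_mat (M s)) $$ (a, k) * l k s)"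
      by (subst sum.swap) (simp add: index_mult_sum[OF M adj(1) a] sum_distrib_right del: index_mult_mat(1))
    also have "\<dots> = (\<Sum>k<N. if k = a then Determinant.det (M s) * l k s else 0)"
      unfolding adj(2) using a by (intro sum.cong) auto
    also have "\<dots> = Determinant.det (M s) * l a s" using a by simp
    finally show ?thesis using nz[OF s] by simp
  qed
qed

text \<open>The zeros of an entire function that is not identically zero are countable, and removing a countable set leaves
the plane connected. This is where the ground field has to be \<open>\<complex>\<close>: a real line may be disconnected by one zero.\<close>

lemma nonzero_set_connected:
  assumes f: "f holomorphic_on (UNIV :: complex set)" and z: "f z \<noteq> 0"
  shows "open {t. f t \<noteq> 0}" "connected {t. f t \<noteq> 0}"
proof -
  have cont: "continuous_on UNIV f" using f by (rule holomorphic_on_imp_continuous_on)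
  have "open (f -` (- {0}) \<inter> UNIV)"
    using continuous_open_preimage[OF cont open_UNIV open_Compl[OF closed_singleton]] by (simp add: Int_commute)
  moreover have eq: "{t. f t \<noteq> 0} = f -` (- {0})" by auto
  ultimately show "open {t. f t \<noteq> 0}" by simp
  show "connected {t. f t \<noteq> 0}"
  proof (cases "f constant_on UNIV")
    case True
    then obtain c where "\<And>x. f x = c" by (auto simp: constant_on_def)
    then have "{t. f t \<noteq> 0} = UNIV" using z by auto
    then show ?thesis using convex_connected[OF convex_UNIV] by metis
  next
    case False
    have "fsigma (UNIV :: complex set)" using fsigma.intros[of "\<lambda>_. UNIV"] by simp
    then have "countable {t \<in> UNIV. f t = 0}"
      by (rule holomorphic_countable_zeros[OF f open_UNIV convex_connected[OF convex_UNIV] _ False])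
    then have "connected (UNIV - {t \<in> UNIV. f t = 0})"
      by (intro connected_open_diff_countable open_UNIV convex_connected[OF convex_UNIV]) simp
    moreover have "UNIV - {t \<in> UNIV. f t = 0} = {t. f t \<noteq> 0}" by auto
    ultimately show ?thesis by simp
  qed
qed

context incidence_algebra
begin

lemma finite_S: "finite S"
  by (rule finite_subset[OF S_sub]) simp

text \<open>The trace form is invariant, so the Kirillov form of \<open>x \<mapsto> tr (g x)\<close> is described by the matrix \<open>[g, x]\<close>,
of which only the entries transposed to \<open>S\<close> matter.\<close>

lemma trace_lie_pairing:
  assumes g: "g \<in> carrier_mat n n" and x: "x \<in> carrier_mat n n" and y: "y \<in> carrier_mat n n"
  shows "mat_trace (g * lie_bracket x y) = mat_trace (lie_bracket g x * y)"
proof -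
  have c: "u * v \<in> carrier_mat n n" if "u \<in> carrier_mat n n" "v \<in> carrier_mat n n" for u v :: "complex mat"
    using that by simp
  have "mat_trace (g * lie_bracket x y) = mat_trace (g * (x * y)) - mat_trace (g * (y * x))"
    unfolding lie_bracket_def mat_minus_mult(2)[OF c[OF x y] c[OF y x] g]
    by (rule mat_trace_minus[OF c[OF g c[OF x y]] c[OF g c[OF y x]]])
  also have "mat_trace (g * (y * x)) = mat_trace (x * (g * y))"
    using mat_trace_comm[OF c[OF g y] x] assoc_mult_mat[OF g y x] by simp
  also have "mat_trace (g * (x * y)) - mat_trace (x * (g * y)) = mat_trace (g * x * y) - mat_trace (x * g * y)"
    by (simp only: assoc_mult_mat[OF g x y] assoc_mult_mat[OF x g y])
  also have "\<dots> = mat_trace (lie_bracket g x * y)"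
    unfolding lie_bracket_def mat_minus_mult(1)[OF c[OF g x] c[OF x g] y]
    by (rule mat_trace_minus[OF c[OF c[OF g x] y] c[OF c[OF x g] y], symmetric])
  finally show ?thesis .
qed

lemma trace_Alg_sum:
  assumes w: "w \<in> carrier_mat n n" and y: "y \<in> Alg"
  shows "mat_trace (w * y) = (\<Sum>(p, q)\<in>S. w $$ (q, p) * y $$ (p, q))"
proof -
  have "mat_trace (w * y) = (\<Sum>q<n. \<Sum>p<n. w $$ (q, p) * y $$ (p, q))"
    by (rule mat_trace_mult[OF w supported_carrier[OF y]])
  also have "\<dots> = (\<Sum>(p, q)\<in>{..<n} \<times> {..<n}. w $$ (q, p) * y $$ (p, q))"
    by (subst sum.swap) (simp add: sum.cartesian_product)
  also have "\<dots> = (\<Sum>(p, q)\<in>S. w $$ (q, p) * y $$ (p, q))"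
    by (rule sum.mono_neutral_right) (use S_sub supported_zero[OF y] in auto)
  finally show ?thesis .
qed

lemma trace_mat_unit:
  assumes w: "w \<in> carrier_mat n n" and pq: "(p, q) \<in> S"
  shows "mat_trace (w * mat_unit n (p, q)) = w $$ (q, p)"
proof -
  have u: "mat_unit n (p, q) \<in> Alg"
    by (rule supportedI) (use pq in auto)
  have "mat_trace (w * mat_unit n (p, q)) = (\<Sum>r\<in>S. if r = (p, q) then w $$ (q, p) else 0)"
    unfolding trace_Alg_sum[OF w u]
  proof (rule sum.cong[OF refl])
    fix r assume "r \<in> S"
    moreover obtain a b where r: "r = (a, b)" by fastforce
    ultimately have "a < n" "b < n" using S_sub by auto
    then show "(case r of (a, b) \<Rightarrow> w $$ (b, a) * mat_unit n (p, q) $$ (a, b))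
        = (if r = (p, q) then w $$ (q, p) else 0)"
      by (auto simp: r)
  qed
  then show ?thesis using pq finite_S by simp
qed

text \<open>Nondegeneracy of the Kirillov form of \<open>x \<mapsto> tr (g x)\<close> on the trace-zero part, in terms of matrix entries.\<close>

definition nondegenerate :: "complex mat \<Rightarrow> bool" where
  "nondegenerate g \<longleftrightarrow> (\<forall>x\<in>Alg. mat_trace x = 0 \<longrightarrow>
     (\<forall>(p, q)\<in>S. lie_bracket g x $$ (q, p) = 0) \<longrightarrow> x = 0\<^sub>m n n)"

lemma dual_eq_iff:
  assumes "v \<in> carrier_mat n n" "w \<in> carrier_mat n n"
  shows "(\<forall>(p, q)\<in>S. v $$ (q, p) = w $$ (q, p)) \<longleftrightarrow> (\<forall>y\<in>Alg. mat_trace (v * y) = mat_trace (w * y))"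
proof
  assume "\<forall>(p, q)\<in>S. v $$ (q, p) = w $$ (q, p)"
  then show "\<forall>y\<in>Alg. mat_trace (v * y) = mat_trace (w * y)"
    using assms by (auto simp: trace_Alg_sum intro!: sum.cong)
next
  assume *: "\<forall>y\<in>Alg. mat_trace (v * y) = mat_trace (w * y)"
  have "v $$ (q, p) = w $$ (q, p)" if "(p, q) \<in> S" for p q
  proof -
    have "mat_unit n (p, q) \<in> Alg" by (rule supportedI) (use that in auto)
    then show ?thesis using * trace_mat_unit[OF assms(1) that] trace_mat_unit[OF assms(2) that] by simp
  qed
  then show "\<forall>(p, q)\<in>S. v $$ (q, p) = w $$ (q, p)" by auto
qed

text \<open>The coefficient of \<open>x\<^sub>i\<^sub>j\<close> in the \<open>(q, p)\<close>-entry of \<open>[g, x]\<close>, corrected by the trace of \<open>x\<close> on the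
  diagonal in order to remove the scalar matrices from the kernel.\<close>

definition form_coeff :: "complex mat \<Rightarrow> nat \<times> nat \<Rightarrow> nat \<times> nat \<Rightarrow> complex" where
  "form_coeff g = (\<lambda>(p, q) (i, j). (if j = p then g $$ (q, i) else 0) - (if i = q then g $$ (j, p) else 0)
     + (if p = q \<and> i = j then 1 else 0))"

lemma form_coeff_sum:
  assumes g: "g \<in> carrier_mat n n" and x: "x \<in> Alg" and pq: "p < n" "q < n"
  shows "(\<Sum>s\<in>S. form_coeff g (p, q) s * x $$ s) = lie_bracket g x $$ (q, p) + (if p = q then mat_trace x else 0)"
proof -
  have xc: "x \<in> carrier_mat n n" by (rule supported_carrier[OF x])
  have "(\<Sum>s\<in>S. form_coeff g (p, q) s * x $$ s) = (\<Sum>s\<in>{..<n} \<times> {..<n}. form_coeff g (p, q) s * x $$ s)"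
    by (rule sum.mono_neutral_left) (use S_sub supported_zero[OF x] in auto)
  also have "\<dots> = (\<Sum>i<n. \<Sum>j<n. form_coeff g (p, q) (i, j) * x $$ (i, j))"
    by (simp add: sum.cartesian_product split_def)
  also have "\<dots> = (\<Sum>i<n. \<Sum>j<n. (if j = p then g $$ (q, i) * x $$ (i, p) else 0))
      - (\<Sum>i<n. \<Sum>j<n. (if i = q then x $$ (q, j) * g $$ (j, p) else 0))
      + (\<Sum>i<n. \<Sum>j<n. (if j = i then (if p = q then x $$ (i, i) else 0) else 0))"
    unfolding sum_subtractf[symmetric] sum.distrib[symmetric]
    by (intro sum.cong refl) (auto simp: form_coeff_def algebra_simps)
  also have "(\<Sum>i<n. \<Sum>j<n. (if i = q then x $$ (q, j) * g $$ (j, p) else 0)) = (\<Sum>j<n. x $$ (q, j) * g $$ (j, p))"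
    using pq by (subst sum.swap) simp
  also have "(\<Sum>i<n. \<Sum>j<n. (if j = p then g $$ (q, i) * x $$ (i, p) else 0)) = (\<Sum>i<n. g $$ (q, i) * x $$ (i, p))"
    using pq by simp
  also have "(\<Sum>i<n. \<Sum>j<n. (if j = i then (if p = q then x $$ (i, i) else 0) else 0)) = (if p = q then mat_trace x else 0)"
    by (simp add: mat_trace_carrier[OF xc])
  finally show ?thesis
    unfolding lie_bracket_def index_minus_carrier[OF mult_carrier_mat[OF xc g] pq(2,1)]
      index_mult_sum[OF g xc pq(2,1)] index_mult_sum[OF xc g pq(2,1)] .
qed

end

section \<open>Pencils of functionals\<close>

context incidence_algebra
begin

lemma enumeration: obtains e where "bij_betw e {..<card S} S"
  using ex_bij_betw_nat_finite[OF finite_S] by (auto simp: atLeast0LessThan)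

lemma enumeration_in: "bij_betw e {..<card S} S \<Longrightarrow> a < card S \<Longrightarrow> e a \<in> S"
  using bij_betwE by blast

lemma enumeration_surj:
  assumes "bij_betw e {..<card S} S" "s \<in> S"
  obtains a where "a < card S" "e a = s"
proof -
  have "s \<in> e ` {..<card S}" using assms by (simp add: bij_betw_imp_surj_on)
  then show ?thesis using that by auto
qed

lemma trace_lie_diag:
  assumes "g \<in> carrier_mat n n" "x \<in> carrier_mat n n"
  shows "(\<Sum>p<n. lie_bracket g x $$ (p, p)) = 0"
  using mat_trace_lie_bracket[OF assms] mat_trace_carrier[OF lie_bracket_carrier[OF assms]] by simp

text \<open>The matrix of the corrected system in the coordinates given by an enumeration \<open>e\<close> of \<open>S\<close>.\<close>

definition gram :: "(nat \<Rightarrow> nat \<times> nat) \<Rightarrow> complex mat \<Rightarrow> complex mat" where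
  "gram e g = Matrix.mat (card S) (card S) (\<lambda>(a, b). form_coeff g (e a) (e b))"

lemma gram_carrier [simp]: "gram e g \<in> carrier_mat (card S) (card S)"
  by (simp add: gram_def)

definition mat_of_coords :: "(nat \<Rightarrow> nat \<times> nat) \<Rightarrow> (nat \<Rightarrow> complex) \<Rightarrow> complex mat" where
  "mat_of_coords e c = Matrix.mat n n (\<lambda>s. if s \<in> S then c (inv_into {..<card S} e s) else 0)"

lemma mat_of_coords_Alg: "mat_of_coords e c \<in> Alg"
  by (rule supportedI) (auto simp: mat_of_coords_def)

lemma mat_of_coords_index:
  assumes e: "bij_betw e {..<card S} S" and "b < card S"
  shows "mat_of_coords e c $$ e b = c b"
proof -
  obtain i j where ij: "e b = (i, j)" by fastforce
  have "e b \<in> S" by (rule enumeration_in[OF assms])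
  then have "i < n" "j < n" using S_sub ij by auto
  moreover have "inv_into {..<card S} e (e b) = b"
    using assms by (intro inv_into_f_f) (auto simp: bij_betw_def)
  ultimately show ?thesis using \<open>e b \<in> S\<close> ij by (auto simp: mat_of_coords_def)
qed

lemma gram_sum:
  assumes e: "bij_betw e {..<card S} S" and g: "g \<in> carrier_mat n n" and x: "x \<in> Alg"
    and a: "a < card S" and ea: "e a = (p, q)"
  shows "(\<Sum>b<card S. gram e g $$ (a, b) * x $$ e b)
    = lie_bracket g x $$ (q, p) + (if p = q then mat_trace x else 0)"
proof -
  have "(p, q) \<in> S" using enumeration_in[OF e a] ea by simp
  then have pq: "p < n" "q < n" using S_sub by auto
  have "(\<Sum>b<card S. gram e g $$ (a, b) * x $$ e b) = (\<Sum>b<card S. form_coeff g (p, q) (e b) * x $$ e b)"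
    using a by (intro sum.cong) (auto simp: gram_def ea)
  also have "\<dots> = (\<Sum>s\<in>S. form_coeff g (p, q) s * x $$ s)"
    by (rule sum.reindex_bij_betw[OF e])
  finally show ?thesis using form_coeff_sum[OF g x pq] by simp
qed

text \<open>Summing the diagonal equations kills the commutator, so a solution of the corrected system has trace zero
and the correction has no effect on it.\<close>

lemma corrected_bracket_trace:
  assumes g: "g \<in> carrier_mat n n" and x: "x \<in> carrier_mat n n" and n: "n > 0"
    and eq: "\<And>p. p < n \<Longrightarrow> lie_bracket g x $$ (p, p) + mat_trace x = w p" and w: "(\<Sum>p<n. w p) = 0"
  shows "mat_trace x = 0"
proof -
  have "(\<Sum>p<n. lie_bracket g x $$ (p, p) + mat_trace x) = 0"
    using w by (simp add: eq)
  then have "of_nat n * mat_trace x = 0"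
    by (simp add: sum.distrib trace_lie_diag[OF g x])
  then show ?thesis using n by simp
qed

text \<open>The correction by the trace makes the system square on the whole algebra; without it the scalar matrices
would make the determinant vanish identically.\<close>

lemma nondegenerate_iff_gram_det:
  assumes e: "bij_betw e {..<card S} S" and g: "g \<in> carrier_mat n n" and n: "n > 0"
  shows "nondegenerate g \<longleftrightarrow> Determinant.det (gram e g) \<noteq> 0"
proof
  assume nd: "nondegenerate g"
  show "Determinant.det (gram e g) \<noteq> 0"
  proof
    assume "Determinant.det (gram e g) = 0"
    then obtain v where v: "v \<in> carrier_vec (card S)" "v \<noteq> 0\<^sub>v (card S)"
        "gram e g *\<^sub>v v = 0\<^sub>v (card S)"
      using det_0_iff_vec_prod_zero[OF gram_carrier] by blast
    define x where "x = mat_of_coords e (vec_index v)"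
    have x: "x \<in> Alg" unfolding x_def by (rule mat_of_coords_Alg)
    have eq: "lie_bracket g x $$ (q, p) + (if p = q then mat_trace x else 0) = 0" if pq: "(p, q) \<in> S" for p q
    proof -
      obtain a where a: "a < card S" "e a = (p, q)" by (rule enumeration_surj[OF e pq])
      have "(\<Sum>b<card S. gram e g $$ (a, b) * x $$ e b) = (\<Sum>b<card S. gram e g $$ (a, b) * vec_index v b)"
        by (intro sum.cong) (auto simp: x_def mat_of_coords_index[OF e])
      also have "\<dots> = vec_index (gram e g *\<^sub>v v) a"
        using a(1) v(1) by (auto simp: scalar_prod_def atLeast0LessThan gram_def)
      also have "\<dots> = 0" using v(3) a(1) by simp
      finally show ?thesis using gram_sum[OF e g x a] by simp
    qed
    have tr: "mat_trace x = 0"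
      by (rule corrected_bracket_trace[OF g supported_carrier[OF x] n, of "\<lambda>_. 0"])
         (use eq S_refl in \<open>force+\<close>)
    have "\<forall>(p, q)\<in>S. lie_bracket g x $$ (q, p) = 0"
    proof clarify
      fix p q assume "(p, q) \<in> S"
      from eq[OF this, unfolded tr if_cancel add_0_right] show "lie_bracket g x $$ (q, p) = 0" .
    qed
    with nd x tr have "x = 0\<^sub>m n n" unfolding nondegenerate_def by simp
    moreover have "vec_index v b = x $$ e b" if "b < card S" for b
      using that by (simp add: x_def mat_of_coords_index[OF e])
    moreover have "(0\<^sub>m n n :: complex mat) $$ e b = 0" if "b < card S" for b
    proof -
      have "e b \<in> {..<n} \<times> {..<n}" using enumeration_in[OF e that] S_sub by blast
      then show ?thesis by auto
    qed
    ultimately have "v = 0\<^sub>v (card S)" using v(1) by (intro eq_vecI) auto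
    then show False using v(2) by simp
  qed
next
  assume det: "Determinant.det (gram e g) \<noteq> 0"
  show "nondegenerate g" unfolding nondegenerate_def
  proof (intro ballI impI)
    fix x assume x: "x \<in> Alg" and tr: "mat_trace x = 0" and z: "\<forall>(p, q)\<in>S. lie_bracket g x $$ (q, p) = 0"
    define v where "v = Matrix.vec (card S) (\<lambda>b. x $$ e b)"
    have "gram e g *\<^sub>v v = 0\<^sub>v (card S)"
    proof (rule eq_vecI)
      fix a assume "a < dim_vec (0\<^sub>v (card S) :: complex vec)"
      then have a: "a < card S" by simp
      obtain p q where pq: "e a = (p, q)" by fastforce
      have "(p, q) \<in> S" using enumeration_in[OF e a] pq by simp
      then have "(\<Sum>b<card S. gram e g $$ (a, b) * x $$ e b) = 0"
        using gram_sum[OF e g x a pq] z tr by auto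
      then show "vec_index (gram e g *\<^sub>v v) a = vec_index (0\<^sub>v (card S)) a"
        using a by (auto simp: scalar_prod_def atLeast0LessThan gram_def v_def)
    qed (simp add: gram_def)
    moreover have "v \<in> carrier_vec (card S)" by (simp add: v_def)
    ultimately have v0: "v = 0\<^sub>v (card S)"
      using det det_0_iff_vec_prod_zero[OF gram_carrier] by metis
    show "x = 0\<^sub>m n n"
    proof (rule eq_matI)
      fix i j assume "i < dim_row (0\<^sub>m n n :: complex mat)" "j < dim_col (0\<^sub>m n n :: complex mat)"
      then have ij: "i < n" "j < n" by auto
      have "x $$ (i, j) = 0"
      proof (cases "(i, j) \<in> S")
        case True
        obtain a where a: "a < card S" "e a = (i, j)" by (rule enumeration_surj[OF e True])
        then have "x $$ (i, j) = vec_index v a" by (simp add: v_def)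
        then show ?thesis using a(1) by (simp add: v0)
      qed (rule supported_zero[OF x ij])
      then show "x $$ (i, j) = 0\<^sub>m n n $$ (i, j)" using ij by simp
    qed (use supported_carrier[OF x] in auto)
  qed
qed

abbreviation pencil :: "complex mat \<Rightarrow> complex mat \<Rightarrow> complex \<Rightarrow> complex mat" where
  "pencil g d t \<equiv> g + t \<cdot>\<^sub>m d"

lemma gram_pencil_holomorphic:
  assumes e: "bij_betw e {..<card S} S" and g: "g \<in> carrier_mat n n" and d: "d \<in> carrier_mat n n"
  shows "mat_holomorphic (card S) (\<lambda>t. gram e (pencil g d t)) U"
  unfolding mat_holomorphic_def
proof (intro allI impI)
  fix a b assume ab: "a < card S" "b < card S"
  obtain p q i j where e': "e a = (p, q)" "e b = (i, j)" by fastforce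
  have "e a \<in> S" "e b \<in> S" using enumeration_in[OF e] ab by blast+
  then have lt: "p < n" "q < n" "i < n" "j < n" using S_sub e' by auto
  have "gram e (pencil g d t) $$ (a, b) = (if j = p then g $$ (q, i) + t * d $$ (q, i) else 0)
     - (if i = q then g $$ (j, p) + t * d $$ (j, p) else 0) + (if p = q \<and> i = j then 1 else 0)" for t
    using ab lt g d by (simp add: gram_def form_coeff_def e')
  then show "(\<lambda>t. gram e (pencil g d t) $$ (a, b)) holomorphic_on U"
    by (cases "j = p"; cases "i = q"; cases "p = q \<and> i = j") (auto intro!: holomorphic_intros)
qed

lemma nondegenerate_pencil_connected:
  assumes g: "g \<in> carrier_mat n n" and d: "d \<in> carrier_mat n n" and n: "n > 0" and nd: "nondegenerate g"
  shows "open {t. nondegenerate (pencil g d t)}" "connected {t. nondegenerate (pencil g d t)}"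
proof -
  obtain e where e: "bij_betw e {..<card S} S" by (rule enumeration)
  have p: "pencil g d t \<in> carrier_mat n n" for t using g d by simp
  have p0: "pencil g d 0 = g" using g d by (intro eq_matI) auto
  have "(\<lambda>t. Determinant.det (gram e (pencil g d t))) holomorphic_on UNIV"
    by (rule det_holomorphic[OF gram_carrier gram_pencil_holomorphic[OF e g d]])
  from nonzero_set_connected[OF this, of 0]
  show "open {t. nondegenerate (pencil g d t)}" "connected {t. nondegenerate (pencil g d t)}"
    using nd unfolding nondegenerate_iff_gram_det[OF e p n] nondegenerate_iff_gram_det[OF e g n] p0 by simp_all
qed

text \<open>Representing a functional \<open>L\<close>, varying with \<open>t\<close>, by the Kirillov form of the pencil. Both the principal element
(\<open>L\<close> is the pencil itself) and its generator \<open>Y\<close> (\<open>L\<close> is the direction of the pencil) arise this way.\<close>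

lemma pencil_solution:
  assumes g: "g \<in> carrier_mat n n" and d: "d \<in> carrier_mat n n" and n: "n > 0"
    and L: "\<And>t. L t \<in> carrier_mat n n" "mat_holomorphic n L UNIV" "\<And>t. mat_trace (L t) = 0"
  obtains X where "\<And>t. X t \<in> Alg" "mat_holomorphic n X {t. nondegenerate (pencil g d t)}"
    "\<And>t. nondegenerate (pencil g d t) \<Longrightarrow> mat_trace (X t) = 0"
    "\<And>t p q. nondegenerate (pencil g d t) \<Longrightarrow> (p, q) \<in> S \<Longrightarrow>
       lie_bracket (pencil g d t) (X t) $$ (q, p) = L t $$ (q, p)"
proof -
  let ?U = "{t. nondegenerate (pencil g d t)}"
  obtain e where e: "bij_betw e {..<card S} S" by (rule enumeration)
  have p: "pencil g d t \<in> carrier_mat n n" for t using g d by simp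
  have eS: "e b \<in> S" if "b < card S" for b by (rule enumeration_in[OF e that])
  have l: "(\<lambda>t. L t $$ (snd (e a), fst (e a))) holomorphic_on ?U" if "a < card S" for a
  proof -
    have "fst (e a) < n" "snd (e a) < n" using eS[OF that] S_sub by auto
    then have "(\<lambda>t. L t $$ (snd (e a), fst (e a))) holomorphic_on UNIV"
      using L(2) by (simp add: mat_holomorphic_def)
    then show ?thesis by (rule holomorphic_on_subset) simp
  qed
  have nz: "Determinant.det (gram e (pencil g d t)) \<noteq> 0" if "t \<in> ?U" for t
    using that nondegenerate_iff_gram_det[OF e p n] by simp
  obtain c where c: "\<And>b. b < card S \<Longrightarrow> c b holomorphic_on ?U"
    "\<And>t a. t \<in> ?U \<Longrightarrow> a < card S \<Longrightarrow>
       (\<Sum>b<card S. gram e (pencil g d t) $$ (a, b) * c b t) = L t $$ (snd (e a), fst (e a))"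
    using cramer_holomorphic[where l = "\<lambda>a t. L t $$ (snd (e a), fst (e a))" and U = ?U,
        OF gram_carrier gram_pencil_holomorphic[OF e g d] l nz] by auto
  define X where "X t = mat_of_coords e (\<lambda>b. c b t)" for t
  have X: "X t \<in> Alg" for t unfolding X_def by (rule mat_of_coords_Alg)
  have holX: "mat_holomorphic n X ?U" unfolding mat_holomorphic_def
  proof (intro allI impI)
    fix i j assume ij: "i < n" "j < n"
    show "(\<lambda>t. X t $$ (i, j)) holomorphic_on ?U"
    proof (cases "(i, j) \<in> S")
      case True
      then have "inv_into {..<card S} e (i, j) < card S"
        using e inv_into_into[of "(i, j)" e "{..<card S}"] by (auto simp: bij_betw_def)
      then show ?thesis using True ij c(1) by (simp add: X_def mat_of_coords_def)
    qed (use ij in \<open>simp add: X_def mat_of_coords_def\<close>)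
  qed
  have eq: "lie_bracket (pencil g d t) (X t) $$ (q, p) + (if p = q then mat_trace (X t) else 0) = L t $$ (q, p)"
    if t: "nondegenerate (pencil g d t)" and pq: "(p, q) \<in> S" for t p q
  proof -
    obtain a where a: "a < card S" "e a = (p, q)" by (rule enumeration_surj[OF e pq])
    have "(\<Sum>b<card S. gram e (pencil g d t) $$ (a, b) * X t $$ e b)
        = (\<Sum>b<card S. gram e (pencil g d t) $$ (a, b) * c b t)"
      by (intro sum.cong) (auto simp: X_def mat_of_coords_index[OF e])
    then show ?thesis using gram_sum[OF e p X a] c(2)[of t a] t a by simp
  qed
  have tr: "mat_trace (X t) = 0" if t: "nondegenerate (pencil g d t)" for t
    by (rule corrected_bracket_trace[OF p supported_carrier[OF X] n, of t t "\<lambda>p. L t $$ (p, p)"])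
       (use eq[OF t S_refl] L(3)[of t] mat_trace_carrier[OF L(1), of t] in auto)
  show ?thesis
  proof (rule that[OF X holX tr])
    fix t p q assume "nondegenerate (pencil g d t)" "(p, q) \<in> S"
    then show "lie_bracket (pencil g d t) (X t) $$ (q, p) = L t $$ (q, p)"
      using eq[of t p q] tr[of t] by (simp split: if_splits)
  qed
qed

end

section \<open>Interpolation at the eigenvalues\<close>

definition mat_sum :: "nat \<Rightarrow> 'a set \<Rightarrow> ('a \<Rightarrow> complex mat) \<Rightarrow> complex mat" where
  "mat_sum n E F = Matrix.mat n n (\<lambda>(i, j). \<Sum>e\<in>E. F e $$ (i, j))"

lemma mat_sum_carrier [simp]: "mat_sum n E F \<in> carrier_mat n n"
  by (simp add: mat_sum_def)

lemma mat_sum_index: "i < n \<Longrightarrow> j < n \<Longrightarrow> mat_sum n E F $$ (i, j) = (\<Sum>e\<in>E. F e $$ (i, j))"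
  by (simp add: mat_sum_def)

lemma mat_sum_mult:
  assumes C: "C \<in> carrier_mat n n" and F: "\<And>e. e \<in> E \<Longrightarrow> F e \<in> carrier_mat n n"
  shows "C * mat_sum n E F = mat_sum n E (\<lambda>e. C * F e)" "mat_sum n E F * C = mat_sum n E (\<lambda>e. F e * C)"
proof -
  have d: "dim_row (C * mat_sum n E F) = n" "dim_col (C * mat_sum n E F) = n"
      "dim_row (mat_sum n E F * C) = n" "dim_col (mat_sum n E F * C) = n"
    using C by (auto simp: mat_sum_def)
  show "C * mat_sum n E F = mat_sum n E (\<lambda>e. C * F e)"
  proof (rule eq_matI)
    fix i j assume "i < dim_row (mat_sum n E (\<lambda>e. C * F e))" "j < dim_col (mat_sum n E (\<lambda>e. C * F e))"
    then have ij: "i < n" "j < n" by (auto simp: mat_sum_def)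
    have "(C * mat_sum n E F) $$ (i, j) = (\<Sum>l<n. \<Sum>e\<in>E. C $$ (i, l) * F e $$ (l, j))"
      unfolding index_mult_sum[OF C mat_sum_carrier ij] using ij by (simp add: mat_sum_index sum_distrib_left)
    also have "\<dots> = (\<Sum>e\<in>E. (C * F e) $$ (i, j))"
      by (subst sum.swap) (simp add: index_mult_sum[OF C F ij] del: index_mult_mat(1))
    finally show "(C * mat_sum n E F) $$ (i, j) = mat_sum n E (\<lambda>e. C * F e) $$ (i, j)"
      using ij by (simp add: mat_sum_index)
  qed (use d in \<open>simp_all add: mat_sum_def\<close>)
  show "mat_sum n E F * C = mat_sum n E (\<lambda>e. F e * C)"
  proof (rule eq_matI)
    fix i j assume "i < dim_row (mat_sum n E (\<lambda>e. F e * C))" "j < dim_col (mat_sum n E (\<lambda>e. F e * C))"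
    then have ij: "i < n" "j < n" by (auto simp: mat_sum_def)
    have "(mat_sum n E F * C) $$ (i, j) = (\<Sum>l<n. \<Sum>e\<in>E. F e $$ (i, l) * C $$ (l, j))"
      unfolding index_mult_sum[OF mat_sum_carrier C ij] using ij by (simp add: mat_sum_index sum_distrib_right)
    also have "\<dots> = (\<Sum>e\<in>E. (F e * C) $$ (i, j))"
      by (subst sum.swap) (simp add: index_mult_sum[OF F C ij] del: index_mult_mat(1))
    finally show "(mat_sum n E F * C) $$ (i, j) = mat_sum n E (\<lambda>e. F e * C) $$ (i, j)"
      using ij by (simp add: mat_sum_index)
  qed (use d in \<open>simp_all add: mat_sum_def\<close>)
qed

lemma mat_poly_sum:
  assumes X: "X \<in> carrier_mat n n" and "finite E"
  shows "mat_poly n (\<Sum>e\<in>E. p e) X = mat_sum n E (\<lambda>e. mat_poly n (p e) X)"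
  using assms(2)
proof (induction E rule: finite_induct)
  case empty
  show ?case by (intro eq_matI) (auto simp: mat_sum_def)
next
  case (insert e E)
  have "mat_poly n (p e) X \<in> carrier_mat n n" "mat_sum n E (\<lambda>e. mat_poly n (p e) X) \<in> carrier_mat n n"
    using X by simp_all
  then show ?case unfolding sum.insert[OF insert.hyps] mat_poly_add[OF X] insert.IH
    using insert.hyps by (intro eq_matI) (auto simp: mat_sum_def)
qed

lemma prod_linear_dvd:
  assumes "finite E" "\<And>e. e \<in> E \<Longrightarrow> poly q e = 0"
  shows "(\<Prod>e\<in>E. [:-e, 1:]) dvd (q :: complex poly)"
  using assms
proof (induction E arbitrary: q rule: finite_induct)
  case empty
  show ?case by simp
next
  case (insert e E)
  then have "[:-e, 1:] dvd q" by (simp add: poly_eq_0_iff_dvd)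
  then obtain r where r: "q = [:-e, 1:] * r" by (elim dvdE)
  have "poly r f = 0" if "f \<in> E" for f
  proof -
    have "(f - e) * poly r f = 0" using insert.prems[of f] that by (simp add: r algebra_simps)
    moreover have "f \<noteq> e" using insert.hyps that by auto
    ultimately show ?thesis by simp
  qed
  then have "(\<Prod>e\<in>E. [:-e, 1:]) dvd r" by (rule insert.IH)
  then show ?case unfolding r prod.insert[OF insert.hyps] by (rule mult_dvd_mono[OF dvd_refl])
qed

text \<open>For \<open>X\<close> annihilated by the product of the factors \<open>t - e\<close>, the value \<open>lagrange E e\<close> at \<open>X\<close> is the projection onto
the eigenspace of \<open>e\<close>.\<close>

definition lagrange :: "complex set \<Rightarrow> complex \<Rightarrow> complex poly" where
  "lagrange E e = (\<Prod>f\<in>E - {e}. Polynomial.smult (1 / (e - f)) [:-f, 1:])"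

lemma poly_lagrange:
  assumes "finite E" "e \<in> E" "f \<in> E"
  shows "poly (lagrange E e) f = (if f = e then 1 else 0)"
proof (cases "f = e")
  case True
  have "poly (lagrange E e) e = (\<Prod>f\<in>E - {e}. 1)"
    unfolding lagrange_def poly_prod
    by (rule prod.cong[OF refl]) (auto simp: field_simps)
  then show ?thesis using True by simp
next
  case False
  then have "poly (lagrange E e) f = 0"
    unfolding lagrange_def poly_prod using assms by (intro prod_zero) (auto intro!: bexI[of _ f])
  then show ?thesis using False by simp
qed

lemma mat_poly_lagrange:
  assumes X: "X \<in> carrier_mat n n" and E: "finite E" "e \<in> E"
    and z: "mat_poly n (\<Prod>e\<in>E. [:-e, 1:]) X = 0\<^sub>m n n"
  shows "X * mat_poly n (lagrange E e) X = e \<cdot>\<^sub>m mat_poly n (lagrange E e) X"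
    "mat_poly n (lagrange E e) X * X = e \<cdot>\<^sub>m mat_poly n (lagrange E e) X"
proof -
  let ?L = "mat_poly n (lagrange E e) X"
  have L: "?L \<in> carrier_mat n n" using X by simp
  have x: "mat_poly n [:0, 1:] X = X"
    by (simp add: mat_poly_pCons[OF X]) (intro eq_matI, use X in auto)
  have "(\<Prod>e\<in>E. [:-e, 1:]) dvd [:0, 1:] * lagrange E e - Polynomial.smult e (lagrange E e)"
    by (rule prod_linear_dvd[OF E(1)]) (simp add: poly_lagrange[OF E])
  then obtain r where "[:0, 1:] * lagrange E e - Polynomial.smult e (lagrange E e) = (\<Prod>e\<in>E. [:-e, 1:]) * r"
    by (elim dvdE)
  then have p: "[:0, 1:] * lagrange E e = Polynomial.smult e (lagrange E e) + (\<Prod>e\<in>E. [:-e, 1:]) * r"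
    by (simp add: algebra_simps)
  have zr: "mat_poly n ((\<Prod>e\<in>E. [:-e, 1:]) * r) X = 0\<^sub>m n n"
    by (rule mat_poly_dvd_zero[OF X _ z]) simp
  have "mat_poly n ([:0, 1:] * lagrange E e) X = e \<cdot>\<^sub>m ?L"
    unfolding p mat_poly_add[OF X] mat_poly_smult[OF X] zr using L by simp
  then show "X * ?L = e \<cdot>\<^sub>m ?L" by (simp only: mat_poly_mult[OF X] x)
  have "mat_poly n (lagrange E e * [:0, 1:]) X = e \<cdot>\<^sub>m ?L"
    using \<open>mat_poly n ([:0, 1:] * lagrange E e) X = e \<cdot>\<^sub>m ?L\<close> by (simp only: mult.commute)
  then show "?L * X = e \<cdot>\<^sub>m ?L" by (simp only: mat_poly_mult[OF X] x)
qed

text \<open>The squares are used instead of the projections because the intertwiner below is a sum of products of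
two projections, and this is its value on the diagonal.\<close>

lemma lagrange_resolution:
  assumes X: "X \<in> carrier_mat n n" and E: "finite E"
    and z: "mat_poly n (\<Prod>e\<in>E. [:-e, 1:]) X = 0\<^sub>m n n"
  shows "mat_sum n E (\<lambda>e. mat_poly n (lagrange E e) X * mat_poly n (lagrange E e) X) = 1\<^sub>m n"
proof -
  have "(\<Prod>e\<in>E. [:-e, 1:]) dvd (\<Sum>e\<in>E. lagrange E e * lagrange E e) - 1"
  proof (rule prod_linear_dvd[OF E])
    fix f assume f: "f \<in> E"
    have "(\<Sum>e\<in>E. poly (lagrange E e) f * poly (lagrange E e) f) = (\<Sum>e\<in>E. if e = f then 1 else 0)"
      by (rule sum.cong[OF refl]) (simp add: poly_lagrange[OF E _ f])
    then show "poly ((\<Sum>e\<in>E. lagrange E e * lagrange E e) - 1) f = 0"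
      using f E by (simp add: poly_sum)
  qed
  then obtain r where "(\<Sum>e\<in>E. lagrange E e * lagrange E e) - 1 = (\<Prod>e\<in>E. [:-e, 1:]) * r" by (elim dvdE)
  then have p: "(\<Sum>e\<in>E. lagrange E e * lagrange E e) = 1 + (\<Prod>e\<in>E. [:-e, 1:]) * r"
    by (simp add: algebra_simps)
  have zr: "mat_poly n ((\<Prod>e\<in>E. [:-e, 1:]) * r) X = 0\<^sub>m n n"
    by (rule mat_poly_dvd_zero[OF X _ z]) simp
  have "mat_poly n (\<Sum>e\<in>E. lagrange E e * lagrange E e) X = 1\<^sub>m n"
    unfolding p mat_poly_add[OF X] mat_poly_1[OF X] zr by simp
  then show ?thesis by (simp only: mat_poly_sum[OF X E] mat_poly_mult[OF X])
qed

lemma det_nonzero_left_right_inverse: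
  assumes a: "a \<in> carrier_mat n n" and d: "Determinant.det a \<noteq> (0 :: complex)"
  obtains a' where "a' \<in> carrier_mat n n" "a' * a = 1\<^sub>m n" "a * a' = 1\<^sub>m n"
proof
  let ?b = "(1 / Determinant.det a) \<cdot>\<^sub>m adj_mat a"
  have adj: "adj_mat a \<in> carrier_mat n n" "a * adj_mat a = Determinant.det a \<cdot>\<^sub>m 1\<^sub>m n"
      "adj_mat a * a = Determinant.det a \<cdot>\<^sub>m 1\<^sub>m n"
    using adj_mat[OF a] by simp_all
  show "?b \<in> carrier_mat n n" using adj by simp
  show "?b * a = 1\<^sub>m n"
    unfolding mult_smult_assoc_mat[OF adj(1) a] adj(3) using d by (intro eq_matI) auto
  show "a * ?b = 1\<^sub>m n"
    unfolding mult_smult_distrib[OF a adj(1)] adj(2) using d by (intro eq_matI) auto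
qed

context incidence_algebra
begin

definition eigenspace :: "complex mat \<Rightarrow> complex \<Rightarrow> complex mat set" where
  "eigenspace H c = {x \<in> Alg. lie_bracket H x = c \<cdot>\<^sub>m x}"

lemma eigenspace_subspace:
  assumes H: "H \<in> carrier_mat n n"
  shows "subspace class_ring (eigenspace H c) (module_mat TYPE(complex) n n)"
proof (rule subspace_matI)
  show "eigenspace H c \<subseteq> carrier_mat n n" by (auto simp: eigenspace_def supported_carrier)
  have "lie_bracket H (0\<^sub>m n n) = c \<cdot>\<^sub>m 0\<^sub>m n n"
    using H by (simp add: lie_bracket_def)
  then show "0\<^sub>m n n \<in> eigenspace H c" by (simp add: eigenspace_def supported_0)
  fix x y assume xy: "x \<in> eigenspace H c" "y \<in> eigenspace H c"
  then have c: "x \<in> carrier_mat n n" "y \<in> carrier_mat n n" by (auto simp: eigenspace_def supported_carrier)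
  have "c \<cdot>\<^sub>m x + c \<cdot>\<^sub>m y = c \<cdot>\<^sub>m (x + y)" using c by (intro eq_matI) (auto simp: algebra_simps)
  then show "x + y \<in> eigenspace H c"
    using xy by (auto simp: eigenspace_def lie_bracket_add_right[OF H c] intro: supported_add)
next
  fix k x assume x: "x \<in> eigenspace H c"
  then have xc: "x \<in> carrier_mat n n" by (auto simp: eigenspace_def supported_carrier)
  have "k \<cdot>\<^sub>m (c \<cdot>\<^sub>m x) = c \<cdot>\<^sub>m (k \<cdot>\<^sub>m x)" using xc by (intro eq_matI) (auto simp: algebra_simps)
  then show "k \<cdot>\<^sub>m x \<in> eigenspace H c"
    using x by (auto simp: eigenspace_def lie_bracket_smult_right[OF H xc] intro: supported_smult)
qed

abbreviation eigendim :: "complex mat \<Rightarrow> complex \<Rightarrow> nat" where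
  "eigendim H c \<equiv> vectorspace.dim class_ring (mat_subspace n (eigenspace H c))"

text \<open>The map \<open>x \<mapsto> a x b\<close> sends eigenvectors of \<open>ad B\<close> to eigenvectors of \<open>ad A\<close> for the same eigenvalue. It uses two
intertwiners, because an inverse of \<open>a\<close> is not known to lie in the algebra.\<close>

lemma intertwined_eigendim_le:
  assumes A: "A \<in> carrier_mat n n" and B: "B \<in> carrier_mat n n" and a: "a \<in> Alg" and b: "b \<in> Alg"
    and Aa: "A * a = a * B" and bA: "b * A = B * b"
    and da: "Determinant.det a \<noteq> 0" and db: "Determinant.det b \<noteq> 0"
  shows "eigendim B c \<le> eigendim A c"
proof (rule mat_subspace_inj_dim_le[OF eigenspace_subspace[OF B] eigenspace_subspace[OF A]])
  have ac: "a \<in> carrier_mat n n" and bc: "b \<in> carrier_mat n n" using a b by (simp_all add: supported_carrier)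
  have m: "u * v * w = u * (v * w)"
    if "u \<in> carrier_mat n n" "v \<in> carrier_mat n n" "w \<in> carrier_mat n n" for u v w :: "complex mat"
    by (rule assoc_mult_mat[OF that])
  have mc: "u * v \<in> carrier_mat n n" if "u \<in> carrier_mat n n" "v \<in> carrier_mat n n" for u v :: "complex mat"
    using that by simp
  have eigc: "x \<in> carrier_mat n n" if "x \<in> eigenspace B c" for x
    using that by (auto simp: eigenspace_def supported_carrier)
  let ?T = "\<lambda>x. a * (x * b)"
  show "?T ` eigenspace B c \<subseteq> eigenspace A c"
  proof
    fix y assume "y \<in> ?T ` eigenspace B c"
    then obtain x where x: "x \<in> eigenspace B c" and y: "y = a * (x * b)" by auto
    have xc: "x \<in> carrier_mat n n" by (rule eigc[OF x])
    have 1: "A * (a * (x * b)) = a * (B * x * b)"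
      unfolding m[OF A ac mc[OF xc bc], symmetric] Aa m[OF ac B mc[OF xc bc]] m[OF B xc bc] ..
    have 2: "a * (x * b) * A = a * (x * B * b)"
      unfolding m[OF ac mc[OF xc bc] A] m[OF xc bc A] bA m[OF xc B bc] ..
    have "lie_bracket A (a * (x * b)) = a * (lie_bracket B x * b)"
      unfolding lie_bracket_def 1 2 mat_minus_mult(1)[OF mc[OF B xc] mc[OF xc B] bc]
        mat_minus_mult(2)[OF mc[OF mc[OF B xc] bc] mc[OF mc[OF xc B] bc] ac] ..
    also have "lie_bracket B x = c \<cdot>\<^sub>m x" using x by (simp add: eigenspace_def)
    also have "a * ((c \<cdot>\<^sub>m x) * b) = c \<cdot>\<^sub>m (a * (x * b))"
      unfolding mult_smult_assoc_mat[OF xc bc] mult_smult_distrib[OF ac mc[OF xc bc]] ..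
    finally show "y \<in> eigenspace A c"
      using x by (simp add: eigenspace_def y Alg_mult a b)
  qed
  obtain a' where a': "a' \<in> carrier_mat n n" "a' * a = 1\<^sub>m n"
    using det_nonzero_left_right_inverse[OF ac da] by metis
  obtain b' where b': "b' \<in> carrier_mat n n" "b * b' = 1\<^sub>m n"
    using det_nonzero_left_right_inverse[OF bc db] by metis
  show "inj_on ?T (eigenspace B c)"
  proof (rule inj_on_inverseI)
    fix x assume "x \<in> eigenspace B c"
    then have xc: "x \<in> carrier_mat n n" by (rule eigc)
    have "a' * (a * (x * b)) = x * b"
      unfolding m[OF a'(1) ac mc[OF xc bc], symmetric] a'(2) by (rule left_mult_one_mat[OF mc[OF xc bc]])
    then show "a' * (a * (x * b)) * b' = x"
      by (simp only: m[OF xc bc b'(1)] b'(2) right_mult_one_mat[OF xc])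
  qed
  show "a * ((x + y) * b) = a * (x * b) + a * (y * b)" if "x \<in> eigenspace B c" "y \<in> eigenspace B c" for x y
    unfolding add_mult_distrib_mat[OF eigc[OF that(1)] eigc[OF that(2)] bc]
    by (rule mult_add_distrib_mat[OF ac mc[OF eigc[OF that(1)] bc] mc[OF eigc[OF that(2)] bc]])
  show "a * ((k \<cdot>\<^sub>m x) * b) = k \<cdot>\<^sub>m (a * (x * b))" if "x \<in> eigenspace B c" for k x
    unfolding mult_smult_assoc_mat[OF eigc[OF that] bc] mult_smult_distrib[OF ac mc[OF eigc[OF that] bc]] ..
qed

end

section \<open>Independence of the Frobenius functional\<close>

lemma lie_bracket_minus_right:
  assumes "x \<in> carrier_mat n n" "y \<in> carrier_mat n n" "z \<in> carrier_mat n n"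
  shows "lie_bracket x (y - z) = lie_bracket x y - lie_bracket x z"
proof -
  have "x * y \<in> carrier_mat n n" "x * z \<in> carrier_mat n n" "y * x \<in> carrier_mat n n" "z * x \<in> carrier_mat n n"
    using assms by auto
  then show ?thesis unfolding lie_bracket_def mat_minus_mult(2)[OF assms(2,3,1)] mat_minus_mult(1)[OF assms(2,3,1)]
    by (intro eq_matI) (auto simp del: index_mult_mat)
qed

context incidence_algebra
begin

text \<open>The defining equation of the principal element of \<open>x \<mapsto> tr (g x)\<close>, in terms of matrix entries.\<close>

definition principal :: "complex mat \<Rightarrow> complex mat \<Rightarrow> bool" where
  "principal g H \<longleftrightarrow> H \<in> Alg \<and> mat_trace H = 0 \<and> (\<forall>(p, q)\<in>S. lie_bracket g H $$ (q, p) = g $$ (q, p))"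

lemma principal_unique:
  assumes g: "g \<in> carrier_mat n n" and nd: "nondegenerate g" and "principal g H" "principal g H'"
  shows "H = H'"
proof -
  have H: "H \<in> Alg" "H' \<in> Alg" "mat_trace H = 0" "mat_trace H' = 0"
    using assms(3,4) by (simp_all add: principal_def)
  have c: "H \<in> carrier_mat n n" "H' \<in> carrier_mat n n" using H by (simp_all add: supported_carrier)
  note e = lie_bracket_minus_right[OF g c]
  have z: "\<forall>(p, q)\<in>S. lie_bracket g (H - H') $$ (q, p) = 0"
  proof clarify
    fix p q assume pq: "(p, q) \<in> S"
    then have "p < n" "q < n" using S_sub by auto
    moreover have "lie_bracket g H $$ (q, p) = g $$ (q, p)" "lie_bracket g H' $$ (q, p) = g $$ (q, p)"
      using assms(3,4) pq by (auto simp: principal_def)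
    ultimately show "lie_bracket g (H - H') $$ (q, p) = 0"
      unfolding e using index_minus_carrier[OF lie_bracket_carrier[OF g c(2)]] by simp
  qed
  have "H - H' = 0\<^sub>m n n"
    using nd z Alg_minus[OF H(1,2)] mat_trace_minus[OF c] H(3,4) unfolding nondegenerate_def by simp
  then have "(H - H') $$ (i, j) = 0" if "i < n" "j < n" for i j using that by simp
  then have "H $$ (i, j) = H' $$ (i, j)" if "i < n" "j < n" for i j
    using index_minus_carrier[OF c(2) that, of H] that by simp
  then show ?thesis using c by (intro eq_matI) auto
qed

text \<open>Differentiate \<open>\<langle>g\<^sub>t, [X\<^sub>t, y]\<rangle> = \<langle>g\<^sub>t, y\<rangle>\<close> and rewrite the derivative of the functional as \<open>\<langle>g\<^sub>t, [Y\<^sub>t, y]\<rangle>\<close>: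
  by the Jacobi identity the derivative of \<open>X\<close> and \<open>[X\<^sub>t, Y\<^sub>t]\<close> solve the same nondegenerate system.\<close>

lemma principal_lax:
  assumes g: "g \<in> carrier_mat n n" and d: "d \<in> carrier_mat n n"
    and U: "U = {t. nondegenerate (pencil g d t)}" "open U" and t: "t \<in> U"
    and X: "\<And>s. X s \<in> Alg" "mat_holomorphic n X U" "\<And>s. s \<in> U \<Longrightarrow> principal (pencil g d s) (X s)"
    and Y: "Y \<in> Alg" "\<And>p q. (p, q) \<in> S \<Longrightarrow> lie_bracket (pencil g d t) Y $$ (q, p) = d $$ (q, p)"
  shows "has_mat_deriv n X (lie_bracket (X t) Y) t"
proof -
  define D where "D = Matrix.mat n n (\<lambda>(i, j). deriv (\<lambda>s. X s $$ (i, j)) t)"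
  have Xc: "X s \<in> carrier_mat n n" for s by (rule supported_carrier[OF X(1)])
  have Yc: "Y \<in> carrier_mat n n" by (rule supported_carrier[OF Y(1)])
  have Dc: "D \<in> carrier_mat n n" by (simp add: D_def)
  have p: "pencil g d s \<in> carrier_mat n n" for s using g d by simp
  have dX: "has_mat_deriv n X D t" unfolding has_mat_deriv_def
  proof (intro allI impI)
    fix i j assume ij: "i < n" "j < n"
    have "(\<lambda>s. X s $$ (i, j)) holomorphic_on U" using X(2) ij by (simp add: mat_holomorphic_def)
    from holomorphic_derivI[OF this U(2) t]
    show "((\<lambda>s. X s $$ (i, j)) has_field_derivative D $$ (i, j)) (at t)" using ij by (simp add: D_def)
  qed
  have D: "D \<in> Alg"
  proof (rule supportedI[OF Dc])
    fix i j assume ij: "i < n" "j < n" "(i, j) \<notin> S"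
    then have "X s $$ (i, j) = 0" for s by (intro supported_zero[OF X(1)])
    then show "D $$ (i, j) = 0" using ij by (simp add: D_def)
  qed
  have trD: "mat_trace D = 0"
  proof -
    have "((\<lambda>s. \<Sum>i<n. X s $$ (i, i)) has_field_derivative (\<Sum>i<n. D $$ (i, i))) (at t)"
      using dX by (intro DERIV_sum) (auto simp: has_mat_deriv_def)
    moreover have "((\<lambda>s. \<Sum>i<n. X s $$ (i, i)) has_field_derivative 0) (at t)"
    proof (rule has_field_derivative_transform_within_open[OF _ U(2) t])
      show "((\<lambda>s. 0) has_field_derivative 0) (at t)" by simp
      show "0 = (\<Sum>i<n. X s $$ (i, i))" if "s \<in> U" for s
        using X(3)[OF that] mat_trace_carrier[OF Xc, of s] by (simp add: principal_def)
    qed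
    ultimately have "(\<Sum>i<n. D $$ (i, i)) = 0" by (rule DERIV_unique)
    then show ?thesis by (simp add: mat_trace_carrier[OF Dc])
  qed
  have dp: "has_mat_deriv n (pencil g d) d t" unfolding has_mat_deriv_def
  proof (intro allI impI)
    fix i j assume ij: "i < n" "j < n"
    have e: "pencil g d s $$ (i, j) = g $$ (i, j) + s * d $$ (i, j)" for s using ij g d by simp
    show "((\<lambda>s. pencil g d s $$ (i, j)) has_field_derivative d $$ (i, j)) (at t)"
      unfolding e by (auto intro!: derivative_eq_intros)
  qed
  have diff: "lie_bracket d (X t) $$ (q, r) + lie_bracket (pencil g d t) D $$ (q, r) = d $$ (q, r)"
    if rq: "(r, q) \<in> S" for q r
  proof -
    have lt: "q < n" "r < n" using rq S_sub by auto
    have "((\<lambda>s. (pencil g d s * X s) $$ (q, r) - (X s * pencil g d s) $$ (q, r)) has_field_derivative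
        (d * X t + pencil g d t * D) $$ (q, r) - (D * pencil g d t + X t * d) $$ (q, r)) (at t)"
      using has_mat_deriv_mult[OF p Xc d Dc dp dX] has_mat_deriv_mult[OF Xc p Dc d dX dp] lt
      unfolding has_mat_deriv_def by (intro DERIV_diff) blast+
    moreover have "((\<lambda>s. (pencil g d s * X s) $$ (q, r) - (X s * pencil g d s) $$ (q, r)) has_field_derivative
        d $$ (q, r)) (at t)"
    proof (rule has_field_derivative_transform_within_open[OF _ U(2) t])
      show "((\<lambda>s. pencil g d s $$ (q, r)) has_field_derivative d $$ (q, r)) (at t)"
        using dp lt by (simp add: has_mat_deriv_def)
      fix s assume "s \<in> U"
      then have "lie_bracket (pencil g d s) (X s) $$ (q, r) = pencil g d s $$ (q, r)"
        using X(3) rq by (auto simp: principal_def)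
      then show "pencil g d s $$ (q, r) = (pencil g d s * X s) $$ (q, r) - (X s * pencil g d s) $$ (q, r)"
        unfolding lie_bracket_def index_minus_carrier[OF mult_carrier_mat[OF Xc p] lt] by simp
    qed
    ultimately have "(d * X t + pencil g d t * D) $$ (q, r) - (D * pencil g d t + X t * d) $$ (q, r) = d $$ (q, r)"
      by (rule DERIV_unique)
    moreover have "(a - d') + (b - c) = e" if "a + b - (c + d') = e" for a b c d' e :: complex
      using that by (simp add: algebra_simps)
    ultimately show ?thesis
      unfolding lie_bracket_def index_minus_carrier[OF mult_carrier_mat[OF Xc d] lt]
        index_minus_carrier[OF mult_carrier_mat[OF Dc p] lt]
        index_add_carrier[OF mult_carrier_mat[OF p Dc] lt] index_add_carrier[OF mult_carrier_mat[OF Xc d] lt]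
      by blast
  qed
  let ?p = "pencil g d t"
  let ?W = "lie_bracket (X t) Y"
  have W: "?W \<in> Alg" by (rule Alg_lie_bracket[OF X(1) Y(1)])
  have Wc: "?W \<in> carrier_mat n n" by (rule supported_carrier[OF W])
  have Xeq: "mat_trace (lie_bracket ?p (X t) * y) = mat_trace (?p * y)" if "y \<in> Alg" for y
  proof -
    have "\<forall>(a, b)\<in>S. lie_bracket ?p (X t) $$ (b, a) = ?p $$ (b, a)" using X(3)[OF t] by (simp add: principal_def)
    then show ?thesis using dual_eq_iff[OF lie_bracket_carrier[OF p Xc] p] that by blast
  qed
  have Yeq: "mat_trace (lie_bracket ?p Y * y) = mat_trace (d * y)" if "y \<in> Alg" for y
    using dual_eq_iff[OF lie_bracket_carrier[OF p Yc] d] Y(2) that by auto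
  have key: "mat_trace (lie_bracket ?p D * y) = mat_trace (lie_bracket ?p ?W * y)" if y: "y \<in> Alg" for y
  proof -
    have yc: "y \<in> carrier_mat n n" by (rule supported_carrier[OF y])
    have Yy: "lie_bracket Y y \<in> Alg" "lie_bracket Y y \<in> carrier_mat n n"
      and Xy: "lie_bracket (X t) y \<in> Alg" "lie_bracket (X t) y \<in> carrier_mat n n"
      by (simp_all add: Alg_lie_bracket X(1) Y(1) y Xc Yc yc)
    have "\<forall>(a, b)\<in>S. (lie_bracket d (X t) + lie_bracket ?p D) $$ (b, a) = d $$ (b, a)"
    proof clarify
      fix a b assume ab: "(a, b) \<in> S"
      then have lt: "b < n" "a < n" using S_sub by auto
      show "(lie_bracket d (X t) + lie_bracket ?p D) $$ (b, a) = d $$ (b, a)"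
        unfolding index_add_carrier[OF lie_bracket_carrier[OF p Dc] lt] by (rule diff[OF ab])
    qed
    then have "mat_trace ((lie_bracket d (X t) + lie_bracket ?p D) * y) = mat_trace (d * y)"
      using dual_eq_iff[OF _ d] y add_carrier_mat[OF lie_bracket_carrier[OF p Dc]] by blast
    then have 1: "mat_trace (lie_bracket d (X t) * y) + mat_trace (lie_bracket ?p D * y) = mat_trace (d * y)"
      unfolding add_mult_distrib_mat[OF lie_bracket_carrier[OF d Xc] lie_bracket_carrier[OF p Dc] yc]
      by (simp add: mat_trace_add[OF mult_carrier_mat[OF lie_bracket_carrier[OF d Xc] yc]
            mult_carrier_mat[OF lie_bracket_carrier[OF p Dc] yc]])
    have "mat_trace (d * y) = mat_trace (?p * lie_bracket Y y)"
      using Yeq[OF y] trace_lie_pairing[OF p Yc yc] by simp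
    also have "\<dots> = mat_trace (?p * lie_bracket (X t) (lie_bracket Y y))"
      using Xeq[OF Yy(1)] trace_lie_pairing[OF p Xc Yy(2)] by simp
    finally have 2: "mat_trace (d * y) = mat_trace (?p * lie_bracket (X t) (lie_bracket Y y))" .
    have "mat_trace (lie_bracket d (X t) * y) = mat_trace (d * lie_bracket (X t) y)"
      using trace_lie_pairing[OF d Xc yc] by simp
    also have "\<dots> = mat_trace (?p * lie_bracket Y (lie_bracket (X t) y))"
      using Yeq[OF Xy(1)] trace_lie_pairing[OF p Yc Xy(2)] by simp
    finally have 3: "mat_trace (lie_bracket d (X t) * y) = mat_trace (?p * lie_bracket Y (lie_bracket (X t) y))" .
    have "mat_trace (lie_bracket ?p D * y)
        = mat_trace (?p * lie_bracket (X t) (lie_bracket Y y)) - mat_trace (?p * lie_bracket Y (lie_bracket (X t) y))"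
      using 1[unfolded 2 3] by (metis add_diff_cancel_left')
    also have "\<dots> = mat_trace (?p * lie_bracket ?W y)"
      unfolding lie_jacobi[OF Xc Yc yc, symmetric]
        mat_minus_mult(2)[OF lie_bracket_carrier[OF Xc Yy(2)] lie_bracket_carrier[OF Yc Xy(2)] p]
      by (rule mat_trace_minus[symmetric, OF mult_carrier_mat[OF p lie_bracket_carrier[OF Xc Yy(2)]]
            mult_carrier_mat[OF p lie_bracket_carrier[OF Yc Xy(2)]]])
    also have "\<dots> = mat_trace (lie_bracket ?p ?W * y)" by (rule trace_lie_pairing[OF p Wc yc])
    finally show ?thesis .
  qed
  have DW: "\<forall>(a, b)\<in>S. lie_bracket ?p D $$ (b, a) = lie_bracket ?p ?W $$ (b, a)"
    using key dual_eq_iff[OF lie_bracket_carrier[OF p Dc] lie_bracket_carrier[OF p Wc]] by blast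
  note e = lie_bracket_minus_right[OF p Dc Wc]
  have z: "\<forall>(a, b)\<in>S. lie_bracket ?p (D - ?W) $$ (b, a) = 0"
  proof clarify
    fix a b assume ab: "(a, b) \<in> S"
    then have "b < n" "a < n" using S_sub by auto
    then show "lie_bracket ?p (D - ?W) $$ (b, a) = 0"
      unfolding e using index_minus_carrier[OF lie_bracket_carrier[OF p Wc]] DW ab by auto
  qed
  have "nondegenerate ?p" using t U(1) by simp
  moreover have "mat_trace (D - ?W) = 0"
    using mat_trace_minus[OF Dc Wc] trD mat_trace_lie_bracket[OF Xc Yc] by simp
  ultimately have "D - ?W = 0\<^sub>m n n"
    using z Alg_minus[OF D W] unfolding nondegenerate_def by simp
  then have "(D - ?W) $$ (i, j) = 0" if "i < n" "j < n" for i j using that by simp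
  then have "D $$ (i, j) = ?W $$ (i, j)" if "i < n" "j < n" for i j
    using index_minus_carrier[OF Wc that, of D] that by simp
  then show ?thesis using dX by (simp add: has_mat_deriv_def)
qed

lemma has_mat_deriv_holomorphic:
  assumes "open U" "\<And>t. t \<in> U \<Longrightarrow> has_mat_deriv n M (D t) t"
  shows "mat_holomorphic n M U"
  using assms unfolding mat_holomorphic_def has_mat_deriv_def
  by (metis (no_types, lifting) holomorphic_on_open)

text \<open>With \<open>P\<^sub>e\<close> the spectral projections, \<open>a\<^sub>t = \<Sum>\<^sub>e P\<^sub>e(X\<^sub>t) P\<^sub>e(X\<^sub>s)\<close> intertwines \<open>X\<^sub>t\<close> and \<open>X\<^sub>s\<close>. It is the identity
at \<open>t = s\<close>, hence invertible nearby, and the same holds for the product in the other order.\<close>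

lemma eigendim_locally_constant:
  assumes X: "\<And>t. X t \<in> Alg" "mat_holomorphic n X U" and U: "open U" "s \<in> U" and E: "finite E"
    and z: "\<And>t. t \<in> U \<Longrightarrow> mat_poly n (\<Prod>e\<in>E. [:-e, 1:]) (X t) = 0\<^sub>m n n"
    and hol: "\<And>p. mat_holomorphic n (\<lambda>t. mat_poly n p (X t)) U"
  shows "\<exists>T. open T \<and> s \<in> T \<and> (\<forall>t\<in>T \<inter> U. eigendim (X t) c = eigendim (X s) c)"
proof -
  have Xc: "X t \<in> carrier_mat n n" for t by (rule supported_carrier[OF X(1)])
  let ?L = "\<lambda>e t. mat_poly n (lagrange E e) (X t)"
  have Lc: "?L e t \<in> carrier_mat n n" for e t by (rule mat_poly_carrier[OF Xc])
  have LA: "?L e t \<in> Alg" for e t by (rule Alg_mat_poly[OF X(1)])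
  define a where "a t = mat_sum n E (\<lambda>e. ?L e t * ?L e s)" for t
  define b where "b t = mat_sum n E (\<lambda>e. ?L e s * ?L e t)" for t
  have sumA: "mat_sum n E F \<in> Alg" if "\<And>e. F e \<in> Alg" for F
  proof (rule supportedI[OF mat_sum_carrier])
    fix i j assume "i < n" "j < n" "(i, j) \<notin> S"
    then show "mat_sum n E F $$ (i, j) = 0"
      using supported_zero[OF that] by (simp add: mat_sum_index)
  qed
  have aA: "a t \<in> Alg" and bA: "b t \<in> Alg" for t
    unfolding a_def b_def by (intro sumA Alg_mult LA)+
  have ac: "a t \<in> carrier_mat n n" and bc: "b t \<in> carrier_mat n n" for t
    by (simp_all add: a_def b_def)
  have sum_cong: "mat_sum n E F = mat_sum n E F'" if "\<And>e. e \<in> E \<Longrightarrow> F e = F' e" for F F'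
    unfolding mat_sum_def using that by (intro cong_mat) (auto intro!: sum.cong)
  have inter: "X u * mat_sum n E (\<lambda>e. ?L e u * ?L e v) = mat_sum n E (\<lambda>e. ?L e u * ?L e v) * X v"
    if u: "u \<in> U" and v: "v \<in> U" for u v
  proof -
    have "X u * (?L e u * ?L e v) = ?L e u * ?L e v * X v" if e: "e \<in> E" for e
    proof -
      have "X u * (?L e u * ?L e v) = e \<cdot>\<^sub>m (?L e u * ?L e v)"
        unfolding assoc_mult_mat[OF Xc Lc Lc, symmetric] mat_poly_lagrange(1)[OF Xc E e z[OF u]]
        by (rule mult_smult_assoc_mat[OF Lc Lc])
      also have "\<dots> = ?L e u * ?L e v * X v"
        unfolding assoc_mult_mat[OF Lc Lc Xc] mat_poly_lagrange(2)[OF Xc E e z[OF v]]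
        by (rule mult_smult_distrib[OF Lc Lc, symmetric])
      finally show ?thesis .
    qed
    then show ?thesis
      unfolding mat_sum_mult[OF Xc mult_carrier_mat[OF Lc Lc]] by (rule sum_cong)
  qed
  have one: "a s = 1\<^sub>m n" "b s = 1\<^sub>m n"
    unfolding a_def b_def by (rule lagrange_resolution[OF Xc E z[OF U(2)]])+
  have holL: "(\<lambda>t. ?L e t $$ (i, j)) holomorphic_on U" if "i < n" "j < n" for e i j
    using hol[of "lagrange E e"] that by (simp add: mat_holomorphic_def)
  have ha: "mat_holomorphic n a U" unfolding mat_holomorphic_def
  proof (intro allI impI)
    fix i j assume ij: "i < n" "j < n"
    have e: "a t $$ (i, j) = (\<Sum>e\<in>E. \<Sum>l<n. ?L e t $$ (i, l) * ?L e s $$ (l, j))" for t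
      unfolding a_def mat_sum_index[OF ij] by (simp only: index_mult_sum[OF Lc Lc ij])
    show "(\<lambda>t. a t $$ (i, j)) holomorphic_on U"
      unfolding e by (intro holomorphic_on_sum holomorphic_on_mult holomorphic_on_const holL) (use ij in auto)
  qed
  have hb: "mat_holomorphic n b U" unfolding mat_holomorphic_def
  proof (intro allI impI)
    fix i j assume ij: "i < n" "j < n"
    have e: "b t $$ (i, j) = (\<Sum>e\<in>E. \<Sum>l<n. ?L e s $$ (i, l) * ?L e t $$ (l, j))" for t
      unfolding b_def mat_sum_index[OF ij] by (simp only: index_mult_sum[OF Lc Lc ij])
    show "(\<lambda>t. b t $$ (i, j)) holomorphic_on U"
      unfolding e by (intro holomorphic_on_sum holomorphic_on_mult holomorphic_on_const holL) (use ij in auto)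
  qed
  have op: "open (U \<inter> f -` (- {0}))" if "f holomorphic_on U" for f :: "complex \<Rightarrow> complex"
    by (rule continuous_open_preimage[OF holomorphic_on_imp_continuous_on[OF that] U(1) open_Compl[OF closed_singleton]])
  define T where "T = (U \<inter> (\<lambda>t. Determinant.det (a t)) -` (- {0})) \<inter> (U \<inter> (\<lambda>t. Determinant.det (b t)) -` (- {0}))"
  have "open T" unfolding T_def
    by (intro open_Int op det_holomorphic[OF ac ha] det_holomorphic[OF bc hb])
  moreover have "s \<in> T" using U(2) one by (simp add: T_def)
  moreover have "eigendim (X t) c = eigendim (X s) c" if "t \<in> T" for t
  proof (rule antisym)
    have t: "t \<in> U" "Determinant.det (a t) \<noteq> 0" "Determinant.det (b t) \<noteq> 0" using that by (auto simp: T_def)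
    have 1: "X t * a t = a t * X s" unfolding a_def by (rule inter[OF t(1) U(2)])
    have 2: "X s * b t = b t * X t" unfolding b_def by (rule inter[OF U(2) t(1)])
    show "eigendim (X s) c \<le> eigendim (X t) c"
      by (rule intertwined_eigendim_le[OF Xc Xc aA bA 1 2[symmetric] t(2,3)])
    show "eigendim (X t) c \<le> eigendim (X s) c"
      by (rule intertwined_eigendim_le[OF Xc Xc bA aA 2 1[symmetric] t(3,2)])
  qed
  ultimately show ?thesis by blast
qed

text \<open>The set of good parameters is connected and contains \<open>0\<close> and \<open>1\<close>, so a locally constant function takes the
same value there. Semisimplicity is assumed at one end only and transported by the Lax equation.\<close>

theorem eigendim_principal_eq:
  assumes n: "n > 0" and g: "g \<in> carrier_mat n n" "mat_trace g = 0" "nondegenerate g"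
    and g': "g' \<in> carrier_mat n n" "mat_trace g' = 0" "nondegenerate g'"
    and H: "principal g H" and H': "principal g' H'"
    and E: "finite E" and zH: "mat_poly n (\<Prod>e\<in>E. [:-e, 1:]) H = 0\<^sub>m n n"
  shows "eigendim H' c = eigendim H c"
proof -
  define d where "d = g' - g"
  have d: "d \<in> carrier_mat n n" using g(1) by (simp add: d_def minus_carrier_mat)
  have trd: "mat_trace d = 0" using mat_trace_minus[OF g'(1) g(1)] g(2) g'(2) by (simp add: d_def)
  have p: "pencil g d t \<in> carrier_mat n n" for t using g d by simp
  have trp: "mat_trace (pencil g d t) = 0" for t
    using mat_trace_add[OF g(1) smult_carrier_mat[OF d]] mat_trace_smult[OF d] g(2) trd by simp
  have p0: "pencil g d 0 = g" using g d by (intro eq_matI) auto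
  have p1: "pencil g d 1 = g'" using g(1) g'(1) by (intro eq_matI) (auto simp: d_def)
  let ?U = "{t. nondegenerate (pencil g d t)}"
  have U: "open ?U" "connected ?U" by (rule nondegenerate_pencil_connected[OF g(1) d n g(3)])+
  have in01: "0 \<in> ?U" "1 \<in> ?U" using g(3) g'(3) p0 p1 by simp_all
  have hold: "mat_holomorphic n (\<lambda>t. d) V" for V by (simp add: mat_holomorphic_def)
  have holp: "mat_holomorphic n (pencil g d) UNIV" unfolding mat_holomorphic_def
  proof (intro allI impI)
    fix i j assume ij: "i < n" "j < n"
    have e: "pencil g d s $$ (i, j) = g $$ (i, j) + s * d $$ (i, j)" for s using ij g(1) d by simp
    show "(\<lambda>s. pencil g d s $$ (i, j)) holomorphic_on UNIV"
      unfolding e by (intro holomorphic_intros)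
  qed
  obtain X where X: "\<And>t. X t \<in> Alg" "mat_holomorphic n X ?U"
    "\<And>t. nondegenerate (pencil g d t) \<Longrightarrow> mat_trace (X t) = 0"
    "\<And>t p q. nondegenerate (pencil g d t) \<Longrightarrow> (p, q) \<in> S \<Longrightarrow>
       lie_bracket (pencil g d t) (X t) $$ (q, p) = pencil g d t $$ (q, p)"
    by (rule pencil_solution[OF g(1) d n p holp trp]) (rule that, assumption+)
  obtain Y where Y: "\<And>t. Y t \<in> Alg" "mat_holomorphic n Y ?U"
    "\<And>t. nondegenerate (pencil g d t) \<Longrightarrow> mat_trace (Y t) = 0"
    "\<And>t p q. nondegenerate (pencil g d t) \<Longrightarrow> (p, q) \<in> S \<Longrightarrow>
       lie_bracket (pencil g d t) (Y t) $$ (q, p) = d $$ (q, p)"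
    by (rule pencil_solution[OF g(1) d n d hold trd]) (rule that, assumption+)
  have Xc: "X t \<in> carrier_mat n n" and Yc: "Y t \<in> carrier_mat n n" for t
    by (rule supported_carrier[OF X(1)], rule supported_carrier[OF Y(1)])
  have prin: "principal (pencil g d t) (X t)" if "t \<in> ?U" for t
    unfolding principal_def using X that by auto
  have X0: "X 0 = H" using principal_unique[OF g(1,3) _ H] prin[OF in01(1)] p0 by simp
  have X1: "X 1 = H'" using principal_unique[OF g'(1,3) _ H'] prin[OF in01(2)] p1 by simp
  have lax: "has_mat_deriv n X (lie_bracket (X t) (Y t)) t" if t: "t \<in> ?U" for t
    by (rule principal_lax[OF g(1) d refl U(1) t X(1,2) prin Y(1)]) (use Y(4) t in auto)
  have laxp: "has_mat_deriv n (\<lambda>s. mat_poly n q (X s)) (lie_bracket (mat_poly n q (X t)) (Y t)) t"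
    if "t \<in> ?U" for q t
    by (rule mat_poly_lax_deriv[OF Xc Yc lax[OF that]])
  have hol: "mat_holomorphic n (\<lambda>t. mat_poly n q (X t)) ?U" for q
    by (rule has_mat_deriv_holomorphic[OF U(1) laxp])
  let ?P = "\<Prod>e\<in>E. [:-e, 1:]"
  have z: "mat_poly n ?P (X t) = 0\<^sub>m n n" if t: "t \<in> ?U" for t
  proof (rule lax_solution_zero[OF U in01(1) t mat_poly_carrier[OF Xc] Yc hol Y(2) laxp])
    show "mat_poly n ?P (X 0) = 0\<^sub>m n n" unfolding X0 by (rule zH)
  qed
  have "(\<lambda>t. eigendim (X t) c) constant_on ?U"
  proof (rule locally_constant_imp_constant[OF U(2)])
    fix s assume s: "s \<in> ?U"
    obtain T where T: "open T" "s \<in> T" "\<forall>t\<in>T \<inter> ?U. eigendim (X t) c = eigendim (X s) c"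
      using eigendim_locally_constant[OF X(1,2) U(1) s E z hol] by blast
    show "\<exists>T. openin (top_of_set ?U) T \<and> s \<in> T \<and> (\<forall>x\<in>T. eigendim (X x) c = eigendim (X s) c)"
    proof (intro exI[of _ "?U \<inter> T"] conjI ballI)
      show "openin (top_of_set ?U) (?U \<inter> T)" by (rule openin_open_Int[OF T(1)])
      show "s \<in> ?U \<inter> T" using s T(2) by (rule IntI)
      fix x assume "x \<in> ?U \<inter> T"
      then have "x \<in> T \<inter> ?U" by (simp only: Int_commute)
      then show "eigendim (X x) c = eigendim (X s) c" by (rule bspec[OF T(3)])
    qed
  qed
  then obtain k where k: "\<forall>t\<in>?U. eigendim (X t) c = k" unfolding constant_on_def ..
  show ?thesis using bspec[OF k in01(1)] bspec[OF k in01(2)] unfolding X0 X1 by (rule trans[OF _ sym, rotated])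
qed

end

section \<open>Frobenius functionals of an incidence algebra\<close>

lemma diag_lie_bracket_index:
  assumes x: "x \<in> carrier_mat n n" and ij: "i < n" "j < n"
  shows "lie_bracket (Matrix.mat n n (\<lambda>(i, j). if i = j then d i else 0)) x $$ (i, j) = (d i - d j) * x $$ (i, j)"
proof -
  let ?H = "Matrix.mat n n (\<lambda>(i, j). if i = j then d i else 0)"
  have H: "?H \<in> carrier_mat n n" by simp
  have "(\<Sum>l<n. ?H $$ (i, l) * x $$ (l, j)) = (\<Sum>l<n. if l = i then d i * x $$ (i, j) else 0)"
    using ij by (intro sum.cong) auto
  moreover have "(\<Sum>l<n. x $$ (i, l) * ?H $$ (l, j)) = (\<Sum>l<n. if l = j then x $$ (i, j) * d j else 0)"
    using ij by (intro sum.cong) auto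
  ultimately show ?thesis
    unfolding lie_bracket_def index_minus_carrier[OF mult_carrier_mat[OF x H] ij]
      index_mult_sum[OF H x ij] index_mult_sum[OF x H ij]
    using ij by (simp add: algebra_simps)
qed

context incidence_algebra
begin

definition Lie :: "complex mat set" where
  "Lie = {x \<in> Alg. mat_trace x = 0}"

lemma LieD: "x \<in> Lie \<Longrightarrow> x \<in> Alg" "x \<in> Lie \<Longrightarrow> mat_trace x = 0" "x \<in> Lie \<Longrightarrow> x \<in> carrier_mat n n"
  by (auto simp: Lie_def supported_carrier)

lemma lie_bracket_Lie: "x \<in> Alg \<Longrightarrow> y \<in> Alg \<Longrightarrow> lie_bracket x y \<in> Lie"
  unfolding Lie_def using Alg_lie_bracket mat_trace_lie_bracket[of x n y] by (simp add: supported_carrier)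

text \<open>Linear forms on the trace-zero part are extended to the whole algebra by zero on scalars.\<close>

definition traceless :: "complex mat \<Rightarrow> complex mat" where
  "traceless x = x + (- mat_trace x / of_nat n) \<cdot>\<^sub>m 1\<^sub>m n"

lemma traceless_Lie:
  assumes "n > 0" "x \<in> Alg"
  shows "traceless x \<in> Lie"
proof -
  have xc: "x \<in> carrier_mat n n" by (rule supported_carrier[OF assms(2)])
  have t1: "mat_trace (1\<^sub>m n) = of_nat n" by (simp add: mat_trace_def)
  have "mat_trace (traceless x) = 0"
    unfolding traceless_def mat_trace_add[OF xc smult_carrier_mat[OF one_carrier_mat]]
      mat_trace_smult[OF one_carrier_mat] t1 using assms(1) by simp
  moreover have "traceless x \<in> Alg" unfolding traceless_def
    by (intro supported_add assms(2) supported_smult Alg_one)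
  ultimately show ?thesis by (simp add: Lie_def)
qed

lemma traceless_id: "x \<in> Lie \<Longrightarrow> traceless x = x"
  unfolding traceless_def by (intro eq_matI) (use LieD(2,3)[of x] in auto)

lemma linear_expansion:
  fixes G :: "complex mat \<Rightarrow> complex"
  assumes add: "\<And>x y. x \<in> Alg \<Longrightarrow> y \<in> Alg \<Longrightarrow> G (x + y) = G x + G y"
    and smult: "\<And>c x. x \<in> Alg \<Longrightarrow> G (c \<cdot>\<^sub>m x) = c * G x" and x: "x \<in> Alg"
  shows "G x = (\<Sum>s\<in>S. x $$ s * G (mat_unit n s))"
proof -
  define r where "r P = Matrix.mat n n (\<lambda>s. if s \<in> P then x $$ s else 0)" for P
  have unit: "mat_unit n s \<in> Alg" if "s \<in> S" for s
    by (rule supportedI) (use that in auto)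
  have rA: "r P \<in> Alg" if "P \<subseteq> S" for P
    by (rule supportedI) (use that in \<open>auto simp: r_def\<close>)
  have "G (r P) = (\<Sum>s\<in>P. x $$ s * G (mat_unit n s))" if "P \<subseteq> S" for P
    using finite_subset[OF that finite_S] that
  proof (induction P rule: finite_induct)
    case empty
    have "r {} = 0 \<cdot>\<^sub>m 1\<^sub>m n" by (intro eq_matI) (auto simp: r_def)
    then show ?case using smult[OF Alg_one, of 0] by simp
  next
    case (insert s P)
    have sS: "s \<in> S" and PS: "P \<subseteq> S" using insert.prems by simp_all
    have "r (insert s P) = x $$ s \<cdot>\<^sub>m mat_unit n s + r P"
      using insert.hyps by (intro eq_matI) (auto simp: r_def)
    then show ?case
      using add[OF supported_smult[OF unit[OF sS]] rA[OF PS]] smult[OF unit[OF sS]] insert.IH[OF PS] insert.hyps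
      by simp
  qed
  then have "G (r S) = (\<Sum>s\<in>S. x $$ s * G (mat_unit n s))" by simp
  moreover have "r S = x"
  proof (rule eq_matI)
    fix i j assume "i < dim_row x" "j < dim_col x"
    then have "i < n" "j < n" using supported_carrier[OF x] by auto
    then show "r S $$ (i, j) = x $$ (i, j)" using supported_zero[OF x] by (auto simp: r_def)
  qed (use supported_carrier[OF x] in \<open>auto simp: r_def\<close>)
  ultimately show ?thesis by simp
qed

text \<open>Every functional is \<open>x \<mapsto> tr (g x)\<close> for a matrix \<open>g\<close>, and the extension by zero on scalars gives \<open>g\<close> trace zero.\<close>

lemma linear_functional_matrix:
  assumes n: "n > 0" and F: "linear_functional Lie F"
  obtains g where "g \<in> carrier_mat n n" "mat_trace g = 0" "\<And>x. x \<in> Lie \<Longrightarrow> F x = mat_trace (g * x)"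
proof -
  define G where "G x = F (traceless x)" for x
  have Fadd: "F (x + y) = F x + F y" if "x \<in> Lie" "y \<in> Lie" for x y
    using F that by (simp add: linear_functional_def)
  have Fsm: "F (c \<cdot>\<^sub>m x) = c * F x" if "x \<in> Lie" for c x
    using F that by (simp add: linear_functional_def)
  have add: "G (x + y) = G x + G y" if "x \<in> Alg" "y \<in> Alg" for x y
  proof -
    have c: "x \<in> carrier_mat n n" "y \<in> carrier_mat n n" using that by (simp_all add: supported_carrier)
    have "traceless (x + y) = traceless x + traceless y"
      unfolding traceless_def mat_trace_add[OF c]
      by (intro eq_matI) (use c in \<open>auto simp: field_simps\<close>)
    then show ?thesis unfolding G_def by (simp add: Fadd traceless_Lie n that)
  qed
  have sm: "G (c \<cdot>\<^sub>m x) = c * G x" if "x \<in> Alg" for c x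
  proof -
    have xc: "x \<in> carrier_mat n n" using that by (simp add: supported_carrier)
    have "traceless (c \<cdot>\<^sub>m x) = c \<cdot>\<^sub>m traceless x"
      unfolding traceless_def mat_trace_smult[OF xc]
      by (intro eq_matI) (use xc in \<open>auto simp: field_simps\<close>)
    then show ?thesis unfolding G_def by (simp add: Fsm traceless_Lie n that)
  qed
  define g where "g = Matrix.mat n n (\<lambda>(q, p). if (p, q) \<in> S then G (mat_unit n (p, q)) else 0)"
  have g: "g \<in> carrier_mat n n" by (simp add: g_def)
  have eq: "G x = mat_trace (g * x)" if x: "x \<in> Alg" for x
  proof -
    have "G x = (\<Sum>s\<in>S. x $$ s * G (mat_unit n s))"
      by (rule linear_expansion) (rule add sm x; assumption)+
    also have "\<dots> = mat_trace (g * x)"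
      unfolding trace_Alg_sum[OF g x]
    proof (rule sum.cong[OF refl])
      fix s assume s: "s \<in> S"
      obtain p q where pq: "s = (p, q)" by fastforce
      then have "p < n" "q < n" using s S_sub by auto
      then show "x $$ s * G (mat_unit n s) = (case s of (p, q) \<Rightarrow> g $$ (q, p) * x $$ (p, q))"
        using s by (simp add: pq g_def)
    qed
    finally show ?thesis .
  qed
  have "traceless (1\<^sub>m n) = 0 \<cdot>\<^sub>m 0\<^sub>m n n"
    unfolding traceless_def using n by (intro eq_matI) (auto simp: mat_trace_def)
  moreover have "0\<^sub>m n n \<in> Lie" by (simp add: Lie_def supported_0 mat_trace_def)
  ultimately have "G (1\<^sub>m n) = 0" unfolding G_def using Fsm[of "0\<^sub>m n n" 0] by simp
  then have "mat_trace g = 0" using eq[OF Alg_one] g by simp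
  moreover have "F x = mat_trace (g * x)" if "x \<in> Lie" for x
    using eq[OF LieD(1)[OF that]] traceless_id[OF that] by (simp add: G_def)
  ultimately show ?thesis by (intro that[OF g])
qed

lemma trace_dual_extend:
  assumes n: "n > 0" and v: "v \<in> carrier_mat n n" "w \<in> carrier_mat n n"
    and tr: "mat_trace v = mat_trace w" and eq: "\<And>y. y \<in> Lie \<Longrightarrow> mat_trace (v * y) = mat_trace (w * y)"
  shows "\<forall>(p, q)\<in>S. v $$ (q, p) = w $$ (q, p)"
  unfolding dual_eq_iff[OF v]
proof
  fix y assume y: "y \<in> Alg"
  have yc: "y \<in> carrier_mat n n" by (rule supported_carrier[OF y])
  have *: "mat_trace (u * traceless y) = mat_trace (u * y) + (- mat_trace y / of_nat n) * mat_trace u"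
    if u: "u \<in> carrier_mat n n" for u
  proof -
    have "u * ((- mat_trace y / of_nat n) \<cdot>\<^sub>m 1\<^sub>m n) = (- mat_trace y / of_nat n) \<cdot>\<^sub>m u"
      using mult_smult_distrib[OF u one_carrier_mat] right_mult_one_mat[OF u] by simp
    then show ?thesis
      unfolding traceless_def mult_add_distrib_mat[OF u yc smult_carrier_mat[OF one_carrier_mat]]
      by (simp add: mat_trace_add[OF mult_carrier_mat[OF u yc] smult_carrier_mat[OF u]] mat_trace_smult[OF u])
  qed
  show "mat_trace (v * y) = mat_trace (w * y)"
    using eq[OF traceless_Lie[OF n y]] *[OF v(1)] *[OF v(2)] tr by simp
qed

lemma trace_linear_functional:
  assumes g: "g \<in> carrier_mat n n"
  shows "linear_functional Lie (\<lambda>x. mat_trace (g * x))"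
  unfolding linear_functional_def
proof (intro conjI ballI allI)
  fix x y assume x: "x \<in> Lie" and y: "y \<in> Lie"
  show "mat_trace (g * (x + y)) = mat_trace (g * x) + mat_trace (g * y)"
    unfolding mult_add_distrib_mat[OF g LieD(3)[OF x] LieD(3)[OF y]]
    by (rule mat_trace_add[OF mult_carrier_mat[OF g LieD(3)[OF x]] mult_carrier_mat[OF g LieD(3)[OF y]]])
next
  fix c x assume x: "x \<in> Lie"
  show "mat_trace (g * (c \<cdot>\<^sub>m x)) = c * mat_trace (g * x)"
    unfolding mult_smult_distrib[OF g LieD(3)[OF x]]
    by (rule mat_trace_smult[OF mult_carrier_mat[OF g LieD(3)[OF x]]])
qed

lemma frobenius_functional_iff:
  assumes n: "n > 0" and g: "g \<in> carrier_mat n n"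
    and F: "linear_functional Lie F" "\<And>x. x \<in> Lie \<Longrightarrow> F x = mat_trace (g * x)"
  shows "frobenius_functional n Lie F \<longleftrightarrow> nondegenerate g"
proof -
  have "(\<forall>y\<in>Lie. kirillov_form F x y = 0) \<longleftrightarrow> (\<forall>(p, q)\<in>S. lie_bracket g x $$ (q, p) = 0)" if x: "x \<in> Lie" for x
  proof -
    have xc: "x \<in> carrier_mat n n" by (rule LieD(3)[OF x])
    have bc: "lie_bracket g x \<in> carrier_mat n n" by (rule lie_bracket_carrier[OF g xc])
    have k: "kirillov_form F x y = mat_trace (lie_bracket g x * y)" if "y \<in> Lie" for y
      unfolding kirillov_form_def trace_lie_pairing[OF g xc LieD(3)[OF that], symmetric]
      by (rule F(2)[OF lie_bracket_Lie[OF LieD(1)[OF x] LieD(1)[OF that]]])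
    have z0: "mat_trace (0\<^sub>m n n * y) = 0" if "y \<in> carrier_mat n n" for y
      using left_mult_zero_mat[OF that] by (simp add: mat_trace_def)
    have zi: "(\<forall>(p, q)\<in>S. lie_bracket g x $$ (q, p) = 0)
        \<longleftrightarrow> (\<forall>(p, q)\<in>S. lie_bracket g x $$ (q, p) = (0\<^sub>m n n :: complex mat) $$ (q, p))"
      using S_sub by (intro ball_cong) auto
    show ?thesis
    proof
      assume "\<forall>y\<in>Lie. kirillov_form F x y = 0"
      then have "mat_trace (lie_bracket g x * y) = mat_trace (0\<^sub>m n n * y)" if "y \<in> Lie" for y
        using k[OF that] z0[OF LieD(3)[OF that]] that by simp
      moreover have "mat_trace (lie_bracket g x) = mat_trace (0\<^sub>m n n)"
        using mat_trace_lie_bracket[OF g xc] by (simp add: mat_trace_def)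
      ultimately show "\<forall>(p, q)\<in>S. lie_bracket g x $$ (q, p) = 0"
        unfolding zi by (intro trace_dual_extend[OF n bc zero_carrier_mat]) simp_all
    next
      assume "\<forall>(p, q)\<in>S. lie_bracket g x $$ (q, p) = 0"
      then have "\<forall>y\<in>Alg. mat_trace (lie_bracket g x * y) = mat_trace (0\<^sub>m n n * y)"
        unfolding zi dual_eq_iff[OF bc zero_carrier_mat] .
      then show "\<forall>y\<in>Lie. kirillov_form F x y = 0"
        using k z0 LieD by simp
    qed
  qed
  then show ?thesis using F(1)
    by (auto simp: frobenius_functional_def nondegenerate_def Lie_def)
qed

lemma principal_exists:
  assumes n: "n > 0" and g: "g \<in> carrier_mat n n" "mat_trace g = 0" "nondegenerate g"
  obtains H where "principal g H"
proof -
  have p0: "pencil g (0\<^sub>m n n) t = g" for t using g(1) by (intro eq_matI) auto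
  have hol: "mat_holomorphic n (\<lambda>t. g) UNIV" by (simp add: mat_holomorphic_def)
  obtain X where X: "\<And>t. X t \<in> Alg"
    "\<And>t. nondegenerate (pencil g (0\<^sub>m n n) t) \<Longrightarrow> mat_trace (X t) = 0"
    "\<And>t p q. nondegenerate (pencil g (0\<^sub>m n n) t) \<Longrightarrow> (p, q) \<in> S \<Longrightarrow>
       lie_bracket (pencil g (0\<^sub>m n n) t) (X t) $$ (q, p) = g $$ (q, p)"
    by (rule pencil_solution[OF g(1) zero_carrier_mat n g(1) hol g(2)]) (rule that, assumption+)
  have "principal g (X (0 :: complex))"
    using X[of 0] g(3) unfolding p0 principal_def by auto
  then show ?thesis by (rule that)
qed

lemma principal_element_eq:
  assumes n: "n > 0" and g: "g \<in> carrier_mat n n" "mat_trace g = 0" "nondegenerate g"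
    and F: "\<And>x. x \<in> Lie \<Longrightarrow> F x = mat_trace (g * x)" and H: "principal g H"
  shows "principal_element Lie F = H"
  unfolding principal_element_def
proof (rule the_equality)
  have iff: "(\<forall>x\<in>Lie. F (lie_bracket K x) = F x) \<longleftrightarrow> principal g K" if K: "K \<in> Lie" for K
  proof -
    have Kc: "K \<in> carrier_mat n n" by (rule LieD(3)[OF K])
    have bc: "lie_bracket g K \<in> carrier_mat n n" by (rule lie_bracket_carrier[OF g(1) Kc])
    have e: "F (lie_bracket K x) = mat_trace (lie_bracket g K * x)" if "x \<in> Lie" for x
      unfolding trace_lie_pairing[OF g(1) Kc LieD(3)[OF that], symmetric]
      by (rule F[OF lie_bracket_Lie[OF LieD(1)[OF K] LieD(1)[OF that]]])
    show ?thesis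
    proof
      assume *: "\<forall>x\<in>Lie. F (lie_bracket K x) = F x"
      have "\<forall>(p, q)\<in>S. lie_bracket g K $$ (q, p) = g $$ (q, p)"
        by (rule trace_dual_extend[OF n bc g(1)])
           (use * e F g(2) mat_trace_lie_bracket[OF g(1) Kc] in simp_all)
      then show "principal g K" using K by (simp add: principal_def Lie_def)
    next
      assume "principal g K"
      then have "\<forall>y\<in>Alg. mat_trace (lie_bracket g K * y) = mat_trace (g * y)"
        unfolding principal_def dual_eq_iff[OF bc g(1), symmetric] by simp
      then show "\<forall>x\<in>Lie. F (lie_bracket K x) = F x" using e F LieD(1) by simp
    qed
  qed
  have HL: "H \<in> Lie" using H by (simp add: principal_def Lie_def)
  show "H \<in> Lie \<and> (\<forall>x\<in>Lie. F (lie_bracket H x) = F x)" using HL H iff[OF HL] by simp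
  show "K = H" if "K \<in> Lie \<and> (\<forall>x\<in>Lie. F (lie_bracket K x) = F x)" for K
  proof (rule principal_unique[OF g(1,3) _ H])
    show "principal g K" using that iff[of K] by simp
  qed
qed

lemma principal_part_eigenspace:
  assumes "principal_element Lie F = H" "H \<in> carrier_mat n n" "j \<noteq> 0"
  shows "principal_part Lie F j = eigenspace H (of_int j)"
proof -
  have "mat_trace x = 0" if x: "x \<in> Alg" and e: "lie_bracket H x = of_int j \<cdot>\<^sub>m x" for x
  proof -
    have xc: "x \<in> carrier_mat n n" by (rule supported_carrier[OF x])
    have "of_int j * mat_trace x = 0"
      using mat_trace_lie_bracket[OF assms(2) xc] unfolding e mat_trace_smult[OF xc] .
    then show ?thesis using assms(3) by simp
  qed
  then have "x \<in> Lie \<and> lie_bracket H x = of_int j \<cdot>\<^sub>m x \<longleftrightarrow> x \<in> Alg \<and> lie_bracket H x = of_int j \<cdot>\<^sub>m x" for x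
    by (auto simp: Lie_def)
  then show ?thesis unfolding principal_part_def assms(1) eigenspace_def by simp
qed

lemma eigenspace_diag:
  "eigenspace (Matrix.mat n n (\<lambda>(i, j). if i = j then d i else 0)) c = supported n {(i, j) \<in> S. d i - d j = c}"
proof -
  let ?H = "Matrix.mat n n (\<lambda>(i, j). if i = j then d i else 0)"
  have H: "?H \<in> carrier_mat n n" by simp
  show ?thesis
  proof (rule subset_antisym; rule subsetI)
    fix x assume x: "x \<in> eigenspace ?H c"
    then have xA: "x \<in> Alg" and e: "lie_bracket ?H x = c \<cdot>\<^sub>m x" by (simp_all add: eigenspace_def)
    have xc: "x \<in> carrier_mat n n" by (rule supported_carrier[OF xA])
    show "x \<in> supported n {(i, j) \<in> S. d i - d j = c}"
    proof (rule supportedI[OF xc])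
      fix i j assume ij: "i < n" "j < n" "(i, j) \<notin> {(i, j) \<in> S. d i - d j = c}"
      have "(c \<cdot>\<^sub>m x) $$ (i, j) = (d i - d j) * x $$ (i, j)"
        by (rule diag_lie_bracket_index[OF xc ij(1,2), of d, unfolded e])
      then have "c * x $$ (i, j) = (d i - d j) * x $$ (i, j)" using ij xc by auto
      then have "x $$ (i, j) = 0 \<or> d i - d j = c" by (metis mult_right_cancel)
      then show "x $$ (i, j) = 0" using ij(3) supported_zero[OF xA ij(1,2)] by blast
    qed
  next
    fix x assume x: "x \<in> supported n {(i, j) \<in> S. d i - d j = c}"
    have xc: "x \<in> carrier_mat n n" by (rule supported_carrier[OF x])
    have "x \<in> Alg" by (rule supportedI[OF xc]) (use supported_zero[OF x] in auto)
    moreover have "lie_bracket ?H x = c \<cdot>\<^sub>m x"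
    proof (rule eq_matI)
      fix i j assume "i < dim_row (c \<cdot>\<^sub>m x)" "j < dim_col (c \<cdot>\<^sub>m x)"
      then have ij: "i < n" "j < n" using xc by auto
      have "d i - d j = c \<or> x $$ (i, j) = 0" using supported_zero[OF x ij] by auto
      then show "lie_bracket ?H x $$ (i, j) = (c \<cdot>\<^sub>m x) $$ (i, j)"
        unfolding diag_lie_bracket_index[OF xc ij] using ij xc by auto
    qed (use carrier_matD[OF lie_bracket_carrier[OF H xc]] carrier_matD[OF xc] in simp_all)
    ultimately show "x \<in> eigenspace ?H c" by (simp add: eigenspace_def)
  qed
qed

text \<open>The combination of both ingredients: if one Frobenius functional has a diagonal principal element,
  then its weights count the principal multiplicities of every Frobenius functional.\<close>

context
  fixes g d
  assumes n: "n > 0" and g: "g \<in> carrier_mat n n" "mat_trace g = 0" "nondegenerate g"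
    and H: "principal g (Matrix.mat n n (\<lambda>(i, j). if i = j then d i else 0))"
begin

lemma frobenius_Lie: "frobenius n Lie"
  unfolding frobenius_def
  using frobenius_functional_iff[OF n g(1) trace_linear_functional[OF g(1)] refl] g(3) by blast

lemma principal_mult_eq_card:
  assumes F: "frobenius_functional n Lie F"
  shows "principal_element Lie F \<in> Alg"
    and "j \<noteq> 0 \<Longrightarrow> principal_mult n Lie F j = card {(i, k) \<in> S. d i - d k = of_int j}"
proof -
  have lin: "linear_functional Lie F" using F by (simp add: frobenius_functional_def)
  obtain f where f: "f \<in> carrier_mat n n" "mat_trace f = 0" "\<And>x. x \<in> Lie \<Longrightarrow> F x = mat_trace (f * x)"
    by (rule linear_functional_matrix[OF n lin]) (rule that, assumption+)
  have nd: "nondegenerate f" using F frobenius_functional_iff[OF n f(1) lin f(3)] by simp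
  obtain K where K: "principal f K" by (rule principal_exists[OF n f(1,2) nd])
  have KA: "K \<in> Alg" using K by (simp add: principal_def)
  have pe: "principal_element Lie F = K" by (rule principal_element_eq[OF n f(1,2) nd f(3) K])
  show "principal_element Lie F \<in> Alg" using KA pe by simp
  assume j: "j \<noteq> 0"
  have pp: "principal_part Lie F j = eigenspace K (of_int j)"
    by (rule principal_part_eigenspace[OF pe supported_carrier[OF KA] j])
  let ?H = "Matrix.mat n n (\<lambda>(i, j). if i = j then d i else 0)"
  have "mat_poly n (\<Prod>e\<in>d ` {..<n}. [:-e, 1:]) ?H = 0\<^sub>m n n"
  proof (rule mat_poly_diag_zero[OF refl])
    fix i assume "i < n"
    then show "poly (\<Prod>e\<in>d ` {..<n}. [:-e, 1:]) (d i) = 0"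
      unfolding poly_prod by (intro prod_zero) (auto intro!: bexI[of _ "d i"])
  qed
  then have "eigendim K (of_int j) = eigendim ?H (of_int j)"
    by (intro eigendim_principal_eq[OF n g f(1,2) nd H K]) simp_all
  also have "\<dots> = card {(i, k) \<in> S. d i - d k = of_int j}"
    unfolding eigenspace_diag by (rule supported_dim) (use S_sub in auto)
  finally show "principal_mult n Lie F j = card {(i, k) \<in> S. d i - d k = of_int j}"
    by (simp add: principal_mult_def pp)
qed

lemma ad_principal_part:
  assumes F: "frobenius_functional n Lie F" and j: "j > 0" and e: "e \<in> principal_part Lie F 1"
  shows "lie_bracket e ` principal_part Lie F j \<subseteq> principal_part Lie F (j + 1)"
    "principal_mult n Lie F (j + 1) \<le> ad_cokernel_dim n Lie F e j + principal_mult n Lie F j"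
proof -
  define K where "K = principal_element Lie F"
  have K: "K \<in> Alg" "principal_element Lie F = K"
    unfolding K_def by (rule principal_mult_eq_card(1)[OF F], rule refl)
  have Kc: "K \<in> carrier_mat n n" by (rule supported_carrier[OF K(1)])
  have pp: "principal_part Lie F i = eigenspace K (of_int i)" if "i \<noteq> 0" for i
    by (rule principal_part_eigenspace[OF K(2) Kc that])
  have eE: "e \<in> eigenspace K 1" using e pp[of 1] by simp
  then have eA: "e \<in> Alg" and eK: "lie_bracket K e = 1 \<cdot>\<^sub>m e" by (simp_all add: eigenspace_def)
  have ec: "e \<in> carrier_mat n n" by (rule supported_carrier[OF eA])
  have one: "1 \<cdot>\<^sub>m e = e" using ec by (intro eq_matI) auto
  have xc: "x \<in> carrier_mat n n" if "x \<in> eigenspace K c" for x c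
    using that by (auto simp: eigenspace_def dest: supported_carrier)
  have sub: "lie_bracket e ` eigenspace K (of_int j) \<subseteq> eigenspace K (of_int (j + 1))"
  proof (rule image_subsetI)
    fix x assume x: "x \<in> eigenspace K (of_int j)"
    have b: "lie_bracket e x \<in> carrier_mat n n" by (rule lie_bracket_carrier[OF ec xc[OF x]])
    have "lie_bracket K (lie_bracket e x) - lie_bracket e (lie_bracket K x) = lie_bracket (lie_bracket K e) x"
      by (rule lie_jacobi[OF Kc ec xc[OF x]])
    moreover have "lie_bracket K x = of_int j \<cdot>\<^sub>m x" using x by (simp add: eigenspace_def)
    ultimately have "lie_bracket K (lie_bracket e x) - of_int j \<cdot>\<^sub>m lie_bracket e x = lie_bracket e x"
      by (simp add: eK one lie_bracket_smult_right[OF ec xc[OF x]])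
    then have i: "(lie_bracket K (lie_bracket e x) - of_int j \<cdot>\<^sub>m lie_bracket e x) $$ (a, c) = lie_bracket e x $$ (a, c)" for a c
      by simp
    have "lie_bracket K (lie_bracket e x) = of_int (j + 1) \<cdot>\<^sub>m lie_bracket e x"
    proof (rule eq_matI)
      fix a c assume "a < dim_row (of_int (j + 1) \<cdot>\<^sub>m lie_bracket e x)" "c < dim_col (of_int (j + 1) \<cdot>\<^sub>m lie_bracket e x)"
      then have ac: "a < n" "c < n" using b by auto
      have "lie_bracket K (lie_bracket e x) $$ (a, c) - of_int j * lie_bracket e x $$ (a, c) = lie_bracket e x $$ (a, c)"
        using i[of a c] unfolding index_minus_carrier[OF smult_carrier_mat[OF b] ac] using ac b by simp
      then show "lie_bracket K (lie_bracket e x) $$ (a, c) = (of_int (j + 1) \<cdot>\<^sub>m lie_bracket e x) $$ (a, c)"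
        using ac b by (simp add: algebra_simps)
    qed (use carrier_matD[OF lie_bracket_carrier[OF Kc b]] carrier_matD[OF b] in simp_all)
    moreover have "lie_bracket e x \<in> Alg" using x eA by (simp add: eigenspace_def Alg_lie_bracket)
    ultimately show "lie_bracket e x \<in> eigenspace K (of_int (j + 1))" by (simp add: eigenspace_def)
  qed
  have pj: "principal_part Lie F j = eigenspace K (of_int j)"
    "principal_part Lie F (j + 1) = eigenspace K (of_int (j + 1))"
    using j by (intro pp; simp)+
  show "lie_bracket e ` principal_part Lie F j \<subseteq> principal_part Lie F (j + 1)"
    unfolding pj by (rule sub)
  have lm: "linear_map class_ring (mat_subspace n (eigenspace K (of_int j)))
      (mat_subspace n (eigenspace K (of_int (j + 1)))) (lie_bracket e)"
    by (rule mat_subspace_linear_map[OF eigenspace_subspace[OF Kc] eigenspace_subspace[OF Kc] sub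
          lie_bracket_add_right[OF ec xc xc] lie_bracket_smult_right[OF ec xc]])
  show "principal_mult n Lie F (j + 1) \<le> ad_cokernel_dim n Lie F e j + principal_mult n Lie F j"
    unfolding principal_mult_def ad_cokernel_dim_def pj
    by (rule cokernel_dim_ge[OF lm mat_subspace_fin_dim[OF eigenspace_subspace[OF Kc]]
          mat_subspace_fin_dim[OF eigenspace_subspace[OF Kc]]])
qed

end

end

section \<open>A linear system with scalar solutions only\<close>

text \<open>Here \<open>W a r c s\<close> is the entry in row \<open>(a, r)\<close> and column \<open>(c, s)\<close> of the core block. Write \<open>W\<^sup>a\<^sup>c\<close> for
the \<open>m \<times> m\<close> matrix with entries \<open>W a r c s\<close>. The equation moves one step down the grid, so that \<open>W\<^sup>a\<^sup>c\<close> vanishes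
for \<open>a < c\<close>, all \<open>W\<^sup>a\<^sup>a\<close> are equal to one matrix \<open>D\<close>, and the subdiagonal \<open>W\<close> are equal as well.
The last of them vanishes in most rows; by the equation at \<open>a = c = 0\<close> this says that \<open>D\<close> commutes with the
shift there, and the corner condition then leaves only scalar \<open>D\<close>.\<close>

lemma core_scalar:
  fixes W :: "nat \<Rightarrow> nat \<Rightarrow> nat \<Rightarrow> nat \<Rightarrow> complex"
  assumes m: "2 \<le> m"
    and last: "\<And>a r s. Suc a < m \<Longrightarrow> r < m \<Longrightarrow> s < m \<Longrightarrow> W a r (m - 1) s = 0"
    and corner: "\<And>r. Suc r < m \<Longrightarrow> W (m - 1) r (m - 1) (m - 1) = 0"
    and eq: "\<And>a r c s. Suc a < m \<Longrightarrow> r < m \<Longrightarrow> c < m \<Longrightarrow> s < m \<Longrightarrow>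
      W (Suc a) r c s + (if a = 0 \<and> Suc r < m then W 0 (Suc r) c s else 0)
      = (if 1 \<le> c then W a r (c - 1) s else 0) + (if c = 0 \<and> 1 \<le> s then W a r 0 (s - 1) else 0)"
    and eq_last: "\<And>r s. Suc r < m \<Longrightarrow> s < m \<Longrightarrow> W (m - 1) r (m - 2) s = 0"
    and lt: "a < m" "r < m" "c < m" "s < m"
  shows "W a r c s = (if a = c \<and> r = s then W 0 0 0 0 else 0)"
proof -
  have up: "W a r c s = 0" if "a < c" "c < m" "r < m" "s < m" for a r c s
    using that
  proof (induction "m - 1 - c" arbitrary: a r c s)
    case 0
    then have "c = m - 1" by simp
    then show ?case using last[of a r s] 0 by simp
  next
    case (Suc k)
    then have c: "Suc c < m" by simp
    have a: "Suc a < m" and r: "r < m" and s: "s < m" and ac: "a < c" using Suc.prems c by linarith+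
    have 1: "W (Suc a) r (Suc c) s = 0" by (rule Suc.hyps(1)) (use Suc c in auto)
    have 2: "W 0 (Suc r) (Suc c) s = 0" if "Suc r < m" by (rule Suc.hyps(1)) (use Suc c that in auto)
    show ?case using eq[OF a r c s] 1 2 by (simp split: if_splits)
  qed
  define D where "D r s = W 0 r 0 s" for r s
  have diag: "W a r a s = D r s" if "a < m" "r < m" "s < m" for a r s
    using that(1)
  proof (induction a)
    case 0
    show ?case by (simp add: D_def)
  next
    case (Suc a)
    have "W 0 (Suc r) (Suc a) s = 0" if "Suc r < m" using up[of 0 "Suc a" "Suc r" s] Suc.prems that \<open>s < m\<close> by simp
    then show ?case using eq[OF Suc.prems \<open>r < m\<close> Suc.prems \<open>s < m\<close>] Suc by (simp split: if_splits)
  qed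
  have step: "W (Suc j) r j s = W 1 r 0 s" if "j \<le> m - 2" "r < m" "s < m" for j r s
    using that(1)
  proof (induction j)
    case 0
    show ?case by simp
  next
    case (Suc j)
    then have "Suc (Suc j) < m" "Suc j < m" using m by linarith+
    then show ?case using eq[of "Suc j" r "Suc j" s] Suc that by simp
  qed
  have W1: "W 1 r 0 s = 0" if "Suc r < m" "s < m" for r s
  proof -
    have "Suc (m - 2) = m - 1" "r < m" using m that by linarith+
    then show ?thesis using step[of "m - 2" r s] eq_last[OF that] that by simp
  qed
  have De: "D (Suc r) s = (if 1 \<le> s then D r (s - 1) else 0)" if "Suc r < m" "s < m" for r s
    using eq[of 0 r 0 s] W1[OF that] that m by (simp add: D_def)
  have Dup: "D r s = 0" if "r < s" "s < m" for r s
    using that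
  proof (induction "m - 1 - s" arbitrary: r s)
    case 0
    then have "s = m - 1" "Suc r < m" by linarith+
    then show ?case using corner[of r] diag[of "m - 1" r s] 0 by simp
  next
    case (Suc k)
    then have l: "Suc r < m" "Suc s < m" by linarith+
    have "D (Suc r) (Suc s) = 0" by (rule Suc.hyps(1)) (use Suc l in auto)
    then show ?case using De[OF l] by simp
  qed
  have Ddiag: "D r r = D 0 0" if "r < m" for r
    using that
  proof (induction r)
    case (Suc r)
    then show ?case using De[of r "Suc r"] by simp
  qed simp
  have Dlow: "D r s = 0" if "s < r" "r < m" for r s
    using that
  proof (induction s arbitrary: r)
    case 0
    then obtain r' where "r = Suc r'" by (cases r) auto
    then show ?case using De[of r' 0] 0 by simp
  next
    case (Suc s)
    then obtain r' where "r = Suc r'" by (cases r) auto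
    then show ?case using De[of r' "Suc s"] Suc by simp
  qed
  have D: "D r s = (if r = s then D 0 0 else 0)" if "r < m" "s < m" for r s
    using Dup[of r s] Dlow[of s r] Ddiag[of r] that by (cases r s rule: linorder_cases) auto
  have W1': "W 1 r 0 s = 0" if "r < m" "s < m" for r s
  proof (cases "Suc r < m")
    case False
    then have r: "r = m - 1" using that by simp
    have "(if 1 \<le> s then D r (s - 1) else 0) = 0" using D[of r "s - 1"] that r by auto
    then show ?thesis using eq[of 0 r 0 s] that m r by (simp add: D_def split: if_splits)
  qed (use W1 that in simp)
  have col0: "W a r 0 s = 0" if "1 \<le> a" "a < m" "r < m" "s < m" for a r s
    using that
  proof (induction a arbitrary: s rule: dec_induct)
    case base
    then show ?case using W1'[of r s] by simp
  next
    case (step a)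
    then show ?case using eq[of a r 0 s] step.IH[of "s - 1"] by (auto split: if_splits)
  qed
  have low: "W a r c s = 0" if "c < a" "a < m" "r < m" "s < m" for a r c s
    using that
  proof (induction c arbitrary: a)
    case 0
    then show ?case using col0 by simp
  next
    case (Suc c)
    then obtain a' where "a = Suc a'" by (cases a) auto
    then show ?case using eq[of a' r "Suc c" s] Suc by simp
  qed
  show ?thesis
    using up[of a c r s] low[of c a r s] diag[of a r s] D[of r s] lt
    by (cases a c rule: linorder_cases) (auto simp: D_def)
qed

text \<open>\<open>Z\<close> stands for the upper left quarter of a matrix in the kernel of the Kirillov form. Its support is restricted
twice: by \<open>S\<close> on the left half (\<open>upper\<close>), and, because the lower right quarter is the mirror image of \<open>Z\<close>, by \<open>S\<close>
on the right half (\<open>lower\<close>). The equation is the kernel equation at those positions where the lower left quarter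
does not contribute.\<close>

locale staircase_system =
  fixes m N :: nat and Z :: "nat \<Rightarrow> nat \<Rightarrow> complex"
  assumes m: "2 \<le> m" and N: "N = m * m"
    and upper: "\<And>p q. p < q \<Longrightarrow> q < 3 * N \<Longrightarrow>
      \<not> (q < N - m \<or> N - m \<le> p \<and> q < N - 1 \<or> N \<le> q \<and> even (q - N) \<and> q = Suc p) \<Longrightarrow> Z p q = 0"
    and lower: "\<And>p q. p < q \<Longrightarrow> q < 3 * N \<Longrightarrow>
      \<not> (q < N \<or> N \<le> p \<and> even (p - N) \<and> q = Suc p) \<Longrightarrow> Z q p = 0"
    and eq: "\<And>p q. p < 3 * N \<Longrightarrow> q < 3 * N \<Longrightarrow>
      p \<le> q \<or> p < N - m \<or> N - m \<le> q \<and> p < N - 1 \<or> N \<le> p \<and> even (p - N) \<and> p = Suc q \<Longrightarrow>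
      q \<le> p \<or> q < N \<or> N \<le> p \<and> even (p - N) \<and> q = Suc p \<Longrightarrow>
      (if p + m < N then Z (p + m) q else 0) + (if Suc p < m then Z (Suc p) q else 0)
        + (if N \<le> p \<and> even (p - N) then Z (p - 1) q + Z (Suc p) q else 0)
      = (if m \<le> q \<and> q < N then Z p (q - m) else 0) + (if 1 \<le> q \<and> q < m then Z p (q - 1) else 0)
        + (if N \<le> Suc q \<and> Suc q < 3 * N \<and> even (Suc q - N) then Z p (Suc q) else 0)
        + (if N < q \<and> even (q - 1 - N) then Z p (q - 1) else 0)"
begin

lemma mN: "2 * m \<le> N" "m < N" "1 < N"
proof -
  show "2 * m \<le> N" using m unfolding N by simp
  then show "m < N" "1 < N" using m by linarith+
qed

abbreviation v :: "nat \<Rightarrow> nat" where "v i \<equiv> N + 2 * i"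

abbreviation u :: "nat \<Rightarrow> nat" where "u i \<equiv> N + 2 * i - 1"

text \<open>The zigzag visits \<open>u 0, v 0, u 1, v 1, \<dots>\<close> and starts at the last core vertex \<open>u 0 = N - 1\<close>.\<close>

lemma tail_diag: "i < N \<Longrightarrow> Z (u i) (u i) = Z (v i) (v i)"
proof -
  assume i: "i < N"
  have 1: "Z (Suc (v i)) (u i) = 0" by (rule lower) (use i mN in auto)
  have 2: "Z (v i) (u i - m) = 0" if "u i < N" by (rule lower) (use i mN that in auto)
  have 3: "Z (v i) (u i - 1) = 0" if "N < u i" by (rule lower) (use i mN that in auto)
  have "v i < 3 * N" "u i < 3 * N" "u i \<le> v i" "v i = Suc (u i)" "\<not> v i + m < N" "\<not> Suc (v i) < m"
    "\<not> u i < m" "v i - 1 = u i" using i mN by linarith+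
  then show ?thesis using eq[of "v i" "u i"] 1 2 3 by (auto split: if_splits)
qed

lemma tail_diag_Suc:
  assumes i: "i < N"
  shows "Z (Suc (v i)) (Suc (v i)) = Z (v i) (v i)"
proof -
  have 1: "Z (u i) (Suc (v i)) = 0" by (rule upper) (use i mN in auto)
  have 2: "Z (v i) (Suc (Suc (v i))) = 0" if "Suc (Suc (v i)) < 3 * N" by (rule upper) (use i mN that in auto)
  have "v i < 3 * N" "Suc (v i) < 3 * N" "v i \<le> Suc (v i)" "\<not> v i + m < N" "\<not> Suc (v i) < m"
    "\<not> Suc (v i) < N" "\<not> Suc (v i) < m" "v i - 1 = u i" "N < Suc (v i)"
    using i mN by linarith+
  then show ?thesis using eq[of "v i" "Suc (v i)"] 1 2 by (auto split: if_splits)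
qed

lemma tail_edges_odd:
  assumes i: "i < N"
  shows "Z (u i) (v i) + Z (Suc (v i)) (v i) = 0"
proof -
  have "v i < 3 * N" "\<not> v i + m < N" "\<not> Suc (v i) < m" "\<not> v i < N" "\<not> v i < m" "v i - 1 = u i"
    using i mN by linarith+
  moreover have "odd (Suc (v i) - N)" by simp
  moreover have "odd (v i - 1 - N)" if "N < v i" using that by simp
  ultimately show ?thesis using eq[of "v i" "v i"] by (auto split: if_splits)
qed

lemma tail_edges_even:
  assumes i: "i < N"
  shows "Z (Suc (v i)) (v i) + (if Suc i < N then Z (Suc (v i)) (Suc (Suc (v i))) else 0) = 0"
proof -
  have "Suc (v i) < 3 * N" "\<not> Suc (v i) + m < N" "\<not> Suc (Suc (v i)) < m" "\<not> Suc (v i) < N" "\<not> Suc (v i) < m"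
    "N < Suc (v i)" "Suc (Suc (v i)) < 3 * N \<longleftrightarrow> Suc i < N"
    using i mN by linarith+
  moreover have "odd (Suc (v i) - N)" by simp
  ultimately show ?thesis using eq[of "Suc (v i)" "Suc (v i)"] by (auto simp: add.commute split: if_splits)
qed

text \<open>The relations couple neighbouring tail edges in a chain. At the far end of the tail a term is missing, so the
chain collapses from there.\<close>

lemma tail_edges_zero:
  assumes "i < N"
  shows "Z (Suc (v i)) (v i) = 0 \<and> Z (u i) (v i) = 0"
  using assms
proof (induction "N - Suc i" arbitrary: i)
  case 0
  then have "\<not> Suc i < N" by simp
  then have "Z (Suc (v i)) (v i) = 0" using tail_edges_even[OF 0(2)] by (simp only: if_False add_0_right)
  then show ?case using tail_edges_odd[OF 0(2)] by simp
next
  case (Suc k)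
  then have s: "Suc i < N" "k = N - Suc (Suc i)" by linarith+
  have "Z (Suc (v i)) (Suc (Suc (v i))) = 0" using Suc.hyps(1)[OF s(2,1)] by simp
  then have "Z (Suc (v i)) (v i) = 0" using tail_edges_even[OF Suc.prems] s(1) by (simp only: if_True add_0_right)
  then show ?case using tail_edges_odd[OF Suc.prems] by simp
qed

lemma tail_off_diag:
  assumes "p < q" "N \<le> q" "q < 3 * N"
  shows "Z p q = 0" "Z q p = 0"
proof -
  show "Z p q = 0"
  proof (cases "even (q - N) \<and> q = Suc p")
    case True
    then obtain i where i: "q = v i" using assms(2) by (metis evenE le_add_diff_inverse)
    then have "p = u i" "i < N" using True assms by simp_all
    then show ?thesis using tail_edges_zero[of i] i by simp
  next
    case False
    show ?thesis by (rule upper) (use assms False mN in auto)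
  qed
  show "Z q p = 0"
  proof (cases "N \<le> p \<and> even (p - N) \<and> q = Suc p")
    case True
    then obtain i where i: "p = v i" by (metis evenE le_add_diff_inverse)
    then have "q = Suc (v i)" "i < N" using True assms by simp_all
    then show ?thesis using tail_edges_zero[of i] i by simp
  next
    case False
    show ?thesis by (rule lower) (use assms False mN in auto)
  qed
qed

lemma tail_on_diag:
  assumes "N \<le> p" "p < 3 * N"
  shows "Z p p = Z (N - 1) (N - 1)"
proof -
  have U: "Z (u i) (u i) = Z (N - 1) (N - 1)" if "i \<le> N" for i
    using that
  proof (induction i)
    case (Suc i)
    then show ?case using tail_diag[of i] tail_diag_Suc[of i] by simp
  qed simp
  show ?thesis
  proof (cases "even (p - N)")
    case True
    then obtain i where i: "p = v i" using assms(1) by (metis evenE le_add_diff_inverse)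
    then have "i < N" using assms by simp
    then show ?thesis using U[of i] tail_diag[of i] i by simp
  next
    case False
    then obtain i where i: "p - N = 2 * i + 1" by (elim oddE)
    then have "p = u (Suc i)" "Suc i \<le> N" using assms by simp_all
    then show ?thesis using U[of "Suc i"] by simp
  qed
qed

lemma core_scalar_flat:
  assumes pq: "p < N" "q < N"
  shows "Z p q = (if p = q then Z 0 0 else 0)"
proof -
  define W where "W a r c s = Z (a * m + r) (c * m + s)" for a r c s
  have lt: "a * m + r < N" if "a < m" "r < m" for a r
  proof -
    have "Suc a * m \<le> m * m" using that by (intro mult_le_mono1) simp
    then show ?thesis using that unfolding N by simp
  qed
  have below: "a * m + r < N - m" if "Suc a < m" "r < m" for a r
  proof -
    have "Suc (Suc a) * m \<le> m * m" using that by (intro mult_le_mono1) simp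
    then show ?thesis using that unfolding N by simp
  qed
  have last: "(m - 1) * m = N - m" unfolding N by (simp add: diff_mult_distrib)
  have ZN: "Z p N = 0" if "p < N" for p by (rule tail_off_diag(1)) (use that mN in auto)
  have "W (p div m) (p mod m) (q div m) (q mod m)
      = (if p div m = q div m \<and> p mod m = q mod m then W 0 0 0 0 else 0)"
  proof (rule core_scalar[OF m])
    show "W a r (m - 1) s = 0" if "Suc a < m" "r < m" "s < m" for a r s
      unfolding W_def last by (rule upper) (use below[OF that(1,2)] mN that in auto)
    show "W (m - 1) r (m - 1) (m - 1) = 0" if "Suc r < m" for r
      unfolding W_def last by (rule upper) (use mN that in auto)
    show "W (Suc a) r c s + (if a = 0 \<and> Suc r < m then W 0 (Suc r) c s else 0)
      = (if 1 \<le> c then W a r (c - 1) s else 0) + (if c = 0 \<and> 1 \<le> s then W a r 0 (s - 1) else 0)"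
      if "Suc a < m" "r < m" "c < m" "s < m" for a r c s
    proof -
      let ?p = "a * m + r" and ?q = "c * m + s"
      have p: "?p < N - m" and q: "?q < N" by (rule below[OF that(1,2)], rule lt[OF that(3,4)])
      have c0: "?p < 3 * N" "?q < 3 * N" "?p + m < N" "\<not> N \<le> ?p" "\<not> N < ?q" "?p < N" using p q by linarith+
      have 1: "Z (?p + m) ?q = W (Suc a) r c s" by (simp add: W_def ac_simps)
      have 2: "(if Suc ?p < m then Z (Suc ?p) ?q else 0) = (if a = 0 \<and> Suc r < m then W 0 (Suc r) c s else 0)"
        by (cases a) (auto simp: W_def)
      have 3: "(if m \<le> ?q \<and> ?q < N then Z ?p (?q - m) else 0) = (if 1 \<le> c then W a r (c - 1) s else 0)"
        using q that by (cases c) (auto simp: W_def)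
      have 4: "(if 1 \<le> ?q \<and> ?q < m then Z ?p (?q - 1) else 0) = (if c = 0 \<and> 1 \<le> s then W a r 0 (s - 1) else 0)"
        using that by (cases c) (auto simp: W_def)
      have 5: "(if N \<le> Suc ?q \<and> Suc ?q < 3 * N \<and> even (Suc ?q - N) then Z ?p (Suc ?q) else 0) = 0"
      proof (cases "N \<le> Suc ?q")
        case True
        then have "Suc ?q = N" using q by simp
        then show ?thesis using ZN[OF c0(6)] by simp
      qed simp
      show ?thesis using eq[of ?p ?q] c0 p q unfolding 1 2 3 4 5 by simp
    qed
    show "W (m - 1) r (m - 2) s = 0" if "Suc r < m" "s < m" for r s
    proof -
      let ?p = "(m - 1) * m + r" and ?q = "(m - 1) * m + s"
      have p: "N - m \<le> ?p" "?p < N - 1" "N - m \<le> ?q" "?q < N" using that mN unfolding last by linarith+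
      have c0: "?p < 3 * N" "?q < 3 * N" "\<not> ?p + m < N" "\<not> Suc ?p < m" "\<not> N \<le> ?p" "\<not> N < ?q" "?p < N"
        "m \<le> ?q" "\<not> ?q < m" using p mN by linarith+
      have "(m - 2) * m + m = (m - 1) * m" using m by (cases m rule: nat.exhaust; cases "m - 1") (auto simp: algebra_simps)
      then have "?q - m = (m - 2) * m + s" by linarith
      then have 3: "Z ?p (?q - m) = W (m - 1) r (m - 2) s" unfolding W_def by (rule arg_cong)
      have 5: "(if N \<le> Suc ?q \<and> Suc ?q < 3 * N \<and> even (Suc ?q - N) then Z ?p (Suc ?q) else 0) = 0"
      proof (cases "N \<le> Suc ?q")
        case True
        then have "Suc ?q = N" using p by simp
        then show ?thesis using ZN[OF c0(7)] by simp
      qed simp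
      show ?thesis using eq[of ?p ?q] c0 p unfolding 3 5 by simp
    qed
  next
    show "p div m < m" "q div m < m" by (rule less_mult_imp_div_less, use pq in \<open>simp only: N\<close>)+
    show "p mod m < m" "q mod m < m" using m by simp_all
  qed
  moreover have "p div m = q div m \<and> p mod m = q mod m \<longleftrightarrow> p = q" by (metis div_mult_mod_eq)
  ultimately show ?thesis by (simp add: W_def)
qed

theorem scalar:
  assumes "p < 3 * N" "q < 3 * N"
  shows "Z p q = (if p = q then Z 0 0 else 0)"
proof (cases "p < N \<and> q < N")
  case True
  then show ?thesis using core_scalar_flat by blast
next
  case False
  have "Z (N - 1) (N - 1) = Z 0 0" using core_scalar_flat[of "N - 1" "N - 1"] mN by simp
  then show ?thesis
    using False tail_off_diag[of p q] tail_off_diag[of q p] tail_on_diag[of p] assms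
    by (cases p q rule: linorder_cases) auto
qed

end

section \<open>The blocks of the parabolic\<close>

lemma block_bounds:
  assumes "i < sum_list c"
  shows "sum_list (take (block c i) c) \<le> i" "i < sum_list (take (Suc (block c i)) c)"
    "block c i < length c"
proof -
  have "i < sum_list (take (Suc (length c)) c)" using assms by simp
  then show "i < sum_list (take (Suc (block c i)) c)" unfolding block_def by (rule LeastI)
  show "sum_list (take (block c i) c) \<le> i"
  proof (cases "block c i")
    case (Suc k)
    then have "\<not> i < sum_list (take (Suc k) c)"
      using not_less_Least[of k "\<lambda>k. i < sum_list (take (Suc k) c)"] by (simp add: block_def)
    then show ?thesis using Suc by simp
  qed simp
  have ne: "c \<noteq> []" using assms by auto
  then have "Suc (length c - 1) = length c" by (cases c) auto
  then have "i < sum_list (take (Suc (length c - 1)) c)" using assms by simp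
  then have "block c i \<le> length c - 1" unfolding block_def by (rule Least_le)
  then show "block c i < length c" using ne by (cases c) auto
qed

lemma block_append:
  assumes "i < sum_list xs + sum_list ys"
  shows "block (xs @ ys) i = (if i < sum_list xs then block xs i else length xs + block ys (i - sum_list xs))"
proof (cases "i < sum_list xs")
  case True
  note b = block_bounds[OF True]
  have "block (xs @ ys) i = block xs i"
    by (rule block_eqI) (use b in \<open>simp_all\<close>)
  then show ?thesis using True by simp
next
  case False
  then have i: "i - sum_list xs < sum_list ys" using assms by linarith
  note b = block_bounds[OF i]
  have "Suc (length xs + k) - length xs = Suc k" for k by simp
  then have "block (xs @ ys) i = length xs + block ys (i - sum_list xs)"
    by (intro block_eqI) (use b False in \<open>simp_all add: take_append\<close>)
  then show ?thesis using False by simp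
qed

lemma block_replicate:
  assumes "0 < d" "i < k * d"
  shows "block (replicate k d) i = i div d"
proof (rule block_eqI)
  have "i div d < k" using assms by (simp add: less_mult_imp_div_less)
  then have "min (i div d) k = i div d" "min (Suc (i div d)) k = Suc (i div d)" by simp_all
  then show "sum_list (take (i div d) (replicate k d)) \<le> i"
    "i < sum_list (take (Suc (i div d)) (replicate k d))"
    using assms by (simp_all add: sum_list_replicate dividend_less_div_times)
qed

lemma block_singleton: "i < a \<Longrightarrow> block [a] i = 0"
  by (rule block_eqI) simp_all

lemma block_append_left: "i < sum_list xs \<Longrightarrow> block (xs @ ys) i = block xs i"
  by (simp add: block_append)

lemma block_append_right:
  "j < sum_list ys \<Longrightarrow> i = sum_list xs + j \<Longrightarrow> block (xs @ ys) i = length xs + block ys j"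
  by (simp add: block_append)

text \<open>The shape of the composition below, for arbitrary lengths.\<close>

lemma block_shape:
  fixes a b k l d :: nat
  defines "c \<equiv> [a, b] @ replicate k 2 @ [1] @ replicate l 2 @ [d]"
  shows "i < a \<Longrightarrow> block c i = 0"
    and "j < b \<Longrightarrow> block c (a + j) = 1"
    and "j < 2 * k \<Longrightarrow> block c (a + b + j) = 2 + j div 2"
    and "block c (a + b + 2 * k) = 2 + k"
    and "j < 2 * l \<Longrightarrow> block c (a + b + 2 * k + 1 + j) = 3 + k + j div 2"
    and "j < d \<Longrightarrow> block c (a + b + 2 * k + 1 + 2 * l + j) = 3 + k + l"
proof -
  have sk: "sum_list (replicate r (2 :: nat)) = 2 * r" for r by (simp add: sum_list_replicate)
  have c: "c = [a] @ [b] @ replicate k 2 @ [1] @ replicate l 2 @ [d]" by (simp add: c_def)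
  show "block c i = 0" if "i < a"
    unfolding c using that by (simp add: block_append_left block_singleton del: append_Cons append_Nil)
  show "block c (a + j) = 1" if "j < b"
    unfolding c
    by (subst block_append_right[where j = j])
       (use that in \<open>simp_all add: block_append_left block_singleton del: append_Cons append_Nil\<close>)
  show "block c (a + b + j) = 2 + j div 2" if "j < 2 * k"
    unfolding c_def
    by (subst block_append_right[where j = j])
       (use that in \<open>simp_all add: sk block_append_left block_replicate\<close>)
  show "block c (a + b + 2 * k) = 2 + k"
    unfolding c_def
    apply (subst block_append_right[where j = "2 * k"], simp add: sk, simp)
    apply (subst block_append_right[where j = 0], simp, simp add: sk)
    by (subst block_append_left) (simp_all add: block_singleton)
  show "block c (a + b + 2 * k + 1 + j) = 3 + k + j div 2" if "j < 2 * l"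
    unfolding c_def
    apply (subst block_append_right[where j = "2 * k + (1 + j)"], use that in \<open>simp add: sk\<close>, simp)
    apply (subst block_append_right[where j = "1 + j"], use that in \<open>simp add: sk\<close>, simp add: sk)
    apply (subst block_append_right[where j = j], use that in \<open>simp add: sk\<close>, simp)
    by (subst block_append_left) (use that in \<open>simp_all add: sk block_replicate\<close>)
  show "block c (a + b + 2 * k + 1 + 2 * l + j) = 3 + k + l" if "j < d"
    unfolding c_def
    apply (subst block_append_right[where j = "2 * k + (1 + (2 * l + j))"], use that in \<open>simp add: sk\<close>, simp)
    apply (subst block_append_right[where j = "1 + (2 * l + j)"], use that in \<open>simp add: sk\<close>, simp add: sk)
    apply (subst block_append_right[where j = "2 * l + j"], use that in \<open>simp add: sk\<close>, simp)
    apply (subst block_append_right[where j = j], use that in simp, simp add: sk)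
    using that by (simp add: block_singleton)
qed

locale staircase =
  fixes m N :: nat
  assumes m: "2 \<le> m" and N: "N = m * m"
begin

definition comp :: "nat list" where
  "comp = [m * (m - 1), m - 1] @ replicate N 2 @ [1] @ replicate N 2 @ [N]"

lemma core_split: "m * (m - 1) + m = N" "m * (m - 1) + (m - 1) = N - 1" "2 * m \<le> N"
  using m unfolding N by (cases m; simp add: algebra_simps)+

lemma sum_comp: "sum_list comp = 6 * N"
proof -
  have "sum_list comp = m * (m - 1) + (m - 1) + 2 * N + 1 + 2 * N + N"
    by (simp add: comp_def sum_list_replicate)
  then show ?thesis using core_split m by linarith
qed

lemma composition_comp: "composition (6 * N) comp"
  unfolding composition_def sum_comp using m core_split by (auto simp: comp_def)

text \<open>The block index in closed form. The twos on the left start at \<open>N - 1\<close>, one vertex before the tail, so that the pairs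
of blocks on the two sides of the mirror are shifted against each other by one.\<close>

definition blk :: "nat \<Rightarrow> nat" where
  "blk i = (if i < N - m then 0 else if i < N - 1 then 1
     else if i < 3 * N - 1 then 2 + (i - (N - 1)) div 2
     else if i < 3 * N then 2 + N
     else if i < 5 * N then 3 + N + (i - 3 * N) div 2 else 3 + 2 * N)"

lemma block_comp:
  assumes i: "i < 6 * N"
  shows "block comp i = blk i"
proof -
  have c: "m * (m - 1) = N - m" "N - m + (m - 1) = N - 1" "m \<le> N" "0 < m" "0 < N"
    using core_split m by linarith+
  note sh = block_shape[where a = "m * (m - 1)" and b = "m - 1" and k = N and l = N and d = N,
      folded comp_def, unfolded c(1)]
  have i': "i < 6 * N" and c': "N - m + (m - 1) = N - 1" "m \<le> N" "0 < m" "0 < N" using i c by simp_all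
  have e: "blk i = (if i < N - m then 0 else if i < N - 1 then 1
     else if i < 3 * N - 1 then 2 + (i - (N - 1)) div 2
     else if i < 3 * N then 2 + N
     else if i < 5 * N then 3 + N + (i - 3 * N) div 2 else 3 + 2 * N)" by (rule blk_def)
  consider "i < N - m" | "N - m \<le> i" "i < N - 1" | "N - 1 \<le> i" "i < 3 * N - 1" | "i = 3 * N - 1"
    | "3 * N \<le> i" "i < 5 * N" | "5 * N \<le> i" by linarith
  then show ?thesis
  proof cases
    case 1
    then show ?thesis using sh(1) e by simp
  next
    case 2
    have "block comp (N - m + (i - (N - m))) = 1" by (rule sh(2)) (use 2 c' in linarith)
    moreover have "N - m + (i - (N - m)) = i" using 2 by linarith
    ultimately show ?thesis using e 2 by simp
  next
    case 3
    have "block comp (N - m + (m - 1) + (i - (N - 1))) = 2 + (i - (N - 1)) div 2"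
      by (rule sh(3)) (use 3 c' in linarith)
    moreover have "N - m + (m - 1) + (i - (N - 1)) = i" using 3 c' by linarith
    moreover have "\<not> i < N - m" "\<not> i < N - 1" using 3 c' by linarith+
    ultimately show ?thesis using e 3 by simp
  next
    case 4
    have "N - m + (m - 1) + 2 * N = i" using 4 c' by linarith
    moreover have "\<not> i < N - m" "\<not> i < N - 1" "\<not> i < 3 * N - 1" "i < 3 * N" using 4 c' by linarith+
    ultimately show ?thesis using sh(4) e by simp
  next
    case 5
    have "block comp (N - m + (m - 1) + 2 * N + 1 + (i - 3 * N)) = 3 + N + (i - 3 * N) div 2"
      by (rule sh(5)) (use 5 in linarith)
    moreover have "N - m + (m - 1) + 2 * N + 1 + (i - 3 * N) = i" using 5 c' by linarith
    moreover have "\<not> i < N - m" "\<not> i < N - 1" "\<not> i < 3 * N - 1" "\<not> i < 3 * N" using 5 c' by linarith+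
    ultimately show ?thesis using e 5 by simp
  next
    case 6
    have "block comp (N - m + (m - 1) + 2 * N + 1 + 2 * N + (i - 5 * N)) = 3 + N + N"
      by (rule sh(6)) (use 6 i' in linarith)
    moreover have "N - m + (m - 1) + 2 * N + 1 + 2 * N + (i - 5 * N) = i" using 6 c' by linarith
    moreover have "\<not> i < N - m" "\<not> i < N - 1" "\<not> i < 3 * N - 1" "\<not> i < 3 * N" "\<not> i < 5 * N" using 6 c' by linarith+
    ultimately show ?thesis using e by simp
  qed
qed

definition S :: "(nat \<times> nat) set" where
  "S = {(i, j). i < 6 * N \<and> j < 6 * N \<and> (j \<le> i \<or> blk i = blk j)}"

lemma blk_mono: "i \<le> j \<Longrightarrow> j < 6 * N \<Longrightarrow> blk i \<le> blk j"
  using block_mono[of i j comp] block_comp[of i] block_comp[of j] by (simp add: sum_comp)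

lemma incidence: "incidence_algebra (6 * N) S"
proof
  show "S \<subseteq> {..<6 * N} \<times> {..<6 * N}" by (auto simp: S_def)
  show "(i, i) \<in> S" if "i < 6 * N" for i using that by (simp add: S_def)
  show "(i, k) \<in> S" if "(i, j) \<in> S" "(j, k) \<in> S" for i j k
    using that blk_mono[of i j] blk_mono[of j i] blk_mono[of j k] blk_mono[of k j] blk_mono[of i k]
    unfolding S_def by fastforce
qed

lemma blk_left_right: "p < 3 * N \<Longrightarrow> 3 * N \<le> q \<Longrightarrow> blk p \<noteq> blk q"
  by (auto simp: blk_def)

abbreviation mir :: "nat \<Rightarrow> nat" where "mir p \<equiv> 6 * N - 1 - p"

text \<open>The last core vertex shares its block with the first tail vertex; this is the case \<open>q = N\<close> of the third
alternative.\<close>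

lemma blk_left:
  assumes "p < q" "q < 3 * N"
  shows "blk p = blk q \<longleftrightarrow> q < N - m \<or> N - m \<le> p \<and> q < N - 1 \<or> N \<le> q \<and> even (q - N) \<and> q = Suc p"
proof -
  have c: "m \<le> N" "1 < m" using m core_split by linarith+
  have pq: "p < q" "q < 3 * N" using assms by simp_all
  have b0: "blk r = 0" if "r < N - m" for r using that by (simp add: blk_def)
  have b1: "blk r = 1" if "N - m \<le> r" "r < N - 1" for r using that by (simp add: blk_def)
  have b2: "blk r = 2 + (r - (N - 1)) div 2" if "N - 1 \<le> r" "r < 3 * N" for r
  proof (cases "r < 3 * N - 1")
    case True
    moreover have "\<not> r < N - m" "\<not> r < N - 1" using that c by linarith+
    ultimately show ?thesis by (simp add: blk_def)
  next
    case False
    then have "(r - (N - 1)) div 2 = N" using that c by linarith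
    moreover have "\<not> r < N - m" "\<not> r < N - 1" using that c by linarith+
    ultimately show ?thesis using that False by (simp add: blk_def)
  qed
  consider "q < N - m" | "N - m \<le> q" "q < N - 1" | "N - 1 \<le> q" "p < N - 1" | "N - 1 \<le> p" by linarith
  then show ?thesis
  proof cases
    case 1
    then show ?thesis using b0[of p] b0[of q] pq by simp
  next
    case 2
    then show ?thesis using b0[of p] b1[of p] b1[of q] pq by (cases "p < N - m") auto
  next
    case 3
    have "blk p < 2" using b0[of p] b1[of p] 3 by (cases "p < N - m") auto
    moreover have "2 \<le> blk q" using b2[of q] 3 pq by simp
    ultimately show ?thesis using 3 c by auto
  next
    case 4
    obtain k where k: "p = N - 1 + k" using 4 le_Suc_ex by blast
    obtain l where l: "q = N - 1 + l" using 4 pq le_Suc_ex[of "N - 1" q] by auto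
    have kl: "k < l" using pq k l by simp
    have "blk p = 2 + k div 2" "blk q = 2 + l div 2" using b2[of p] b2[of q] 4 pq by (simp_all add: k l)
    then have "blk p = blk q \<longleftrightarrow> k div 2 = l div 2" by simp
    also have "\<dots> \<longleftrightarrow> l = Suc k \<and> even k" using kl by presburger
    also have "\<dots> \<longleftrightarrow> q = Suc p \<and> even (q - N)"
    proof (rule conj_cong)
      show "l = Suc k \<longleftrightarrow> q = Suc p" using k l by simp
      assume "q = Suc p"
      then have "q - N = k" using k c by simp
      then show "even k \<longleftrightarrow> even (q - N)" by simp
    qed
    finally have e: "blk p = blk q \<longleftrightarrow> q = Suc p \<and> even (q - N)" .
    have "N \<le> q" "\<not> q < N - m" "\<not> q < N - 1" using l kl c by linarith+
    then show ?thesis unfolding e by blast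
  qed
qed

lemma blk_mir:
  assumes "p < q" "q < 3 * N"
  shows "blk (mir p) = blk (mir q) \<longleftrightarrow> q < N \<or> N \<le> p \<and> even (p - N) \<and> q = Suc p"
proof -
  have c: "m \<le> N" "1 < m" using m core_split by linarith+
  have pq: "p < q" "q < 3 * N" using assms by simp_all
  have b0: "blk (6 * N - 1 - r) = 3 + 2 * N" if "r < N" for r
  proof -
    have "5 * N \<le> 6 * N - 1 - r" using that by linarith
    then show ?thesis using c unfolding blk_def by auto
  qed
  have b1: "blk (6 * N - 1 - r) = 3 + N + (3 * N - 1 - r) div 2" if "N \<le> r" "r < 3 * N" for r
  proof -
    have "3 * N \<le> 6 * N - 1 - r" "6 * N - 1 - r < 5 * N" "6 * N - 1 - r - 3 * N = 3 * N - 1 - r"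
      using that by linarith+
    then show ?thesis using c unfolding blk_def by auto
  qed
  consider "q < N" | "N \<le> q" "p < N" | "N \<le> p" by linarith
  then show ?thesis
  proof cases
    case 1
    then show ?thesis using b0[of p] b0[of q] pq by simp
  next
    case 2
    then have "(3 * N - 1 - q) div 2 < N" using pq by linarith
    then show ?thesis using 2 b0[of p] b1[of q] pq by simp
  next
    case 3
    obtain k where k: "p = N + k" using 3 le_Suc_ex by blast
    obtain l where l: "q = N + l" using 3 pq le_Suc_ex[of N q] by auto
    have kl: "k < l" "l < 2 * N" using pq k l by simp_all
    have d: "3 * N - 1 - p = 2 * N - 1 - k" "3 * N - 1 - q = 2 * N - 1 - l" using k l by simp_all
    have "blk (6 * N - 1 - p) = blk (6 * N - 1 - q) \<longleftrightarrow> (2 * N - 1 - k) div 2 = (2 * N - 1 - l) div 2"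
      using b1[of p] b1[of q] 3 pq unfolding d by simp
    also have "\<dots> \<longleftrightarrow> l = Suc k \<and> even k"
    proof -
      obtain e where e: "l = k + e" "1 \<le> e" using kl(1) less_imp_Suc_add[of k l] by auto
      obtain b where b: "2 * N = Suc (b + l)" using kl(2) less_imp_Suc_add[of l "2 * N"] by (auto simp: add.commute)
      have 1: "2 * N - 1 - l = b" "2 * N - 1 - k = b + e" using b e by simp_all
      have "(b + e) div 2 = b div 2 \<longleftrightarrow> e = 1 \<and> even b" using e(2) by presburger
      moreover have "even b \<longleftrightarrow> even k" if "e = 1"
      proof -
        have "even (Suc (b + (k + 1)))" using b e that by (metis dvd_triv_left)
        then show ?thesis by simp
      qed
      ultimately show ?thesis unfolding 1 using e(1) by auto
    qed
    also have "\<dots> \<longleftrightarrow> even (p - N) \<and> q = Suc p" using k l by auto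
    finally have e: "blk (6 * N - 1 - p) = blk (6 * N - 1 - q) \<longleftrightarrow> even (p - N) \<and> q = Suc p" .
    have "\<not> q < N" using 3 pq by simp
    then show ?thesis unfolding e using 3 by blast
  qed
qed

end

section \<open>A Frobenius functional with diagonal principal element\<close>

lemma sum_pick:
  fixes n c :: nat
  shows "(\<Sum>l<n. (if P \<and> l = c then 1 else 0) * f l) = (if P \<and> c < n then f c else (0 :: complex))"
proof -
  have "(\<Sum>l<n. (if P \<and> l = c then 1 else 0) * f l) = (\<Sum>l<n. if l = c then (if P then f c else 0) else 0)"
    by (rule sum.cong) auto
  also have "\<dots> = (if P \<and> c < n then f c else 0)" by (simp add: sum.delta)
  finally show ?thesis .
qed

context staircase
begin

sublocale incidence_algebra "6 * N" S
  by (rule incidence)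

lemma Lie_eq: "Lie = parabolic (6 * N) comp"
proof (rule Set.set_eqI, rule iffI)
  have one: "block [6 * N] i = 0" if "i < 6 * N" for i by (rule block_eqI) (use that in simp_all)
  fix x
  have ok: "(i, j) \<in> S \<longleftrightarrow> i = j \<or> (i > j \<and> block [6 * N] i = block [6 * N] j) \<or> (i < j \<and> block comp i = block comp j)"
    if "i < 6 * N" "j < 6 * N" for i j
    using that one[OF that(1)] one[OF that(2)] block_comp[OF that(1)] block_comp[OF that(2)]
    by (auto simp: S_def)
  show "x \<in> parabolic (6 * N) comp" if "x \<in> Lie"
    using LieD[OF that] supported_zero[OF LieD(1)[OF that]] ok
    unfolding parabolic_def seaweed_def sl_def by blast
  assume "x \<in> parabolic (6 * N) comp"
  then have x: "x \<in> carrier_mat (6 * N) (6 * N)" "mat_trace x = 0"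
    "\<And>i j. i < 6 * N \<Longrightarrow> j < 6 * N \<Longrightarrow> (i, j) \<notin> S \<Longrightarrow> x $$ (i, j) = 0"
    using ok unfolding parabolic_def seaweed_def sl_def by blast+
  have "x \<in> Alg" by (rule supportedI) (rule x; assumption)+
  then show "x \<in> Lie" using x(2) by (simp add: Lie_def)
qed

text \<open>The edges, in this order: down the grid, along the first row of the grid, backwards and forwards along the tail
from every second tail vertex, and to the mirror image.\<close>

definition g :: "complex mat" where
  "g = Matrix.mat (6 * N) (6 * N) (\<lambda>(p, i).
     (if p + m < N \<and> i = p + m then 1 else 0) + (if Suc p < m \<and> i = Suc p then 1 else 0)
     + (if (N \<le> p \<and> p < 3 * N \<and> even (p - N)) \<and> i = p - 1 then 1 else 0)
     + (if (N \<le> p \<and> p < 3 * N \<and> even (p - N)) \<and> i = Suc p then 1 else 0)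
     + (if p < 3 * N \<and> i = mir p then 1 else 0))"

lemma g_carrier: "g \<in> carrier_mat (6 * N) (6 * N)"
  by (simp add: g_def)

lemma N_ge: "m < N" "1 < N"
  using core_split m by linarith+

lemma g_col:
  assumes "p < 6 * N" "i < 6 * N"
  shows "g $$ (p, i) =
     (if (m \<le> i \<and> i < N) \<and> p = i - m then 1 else 0) + (if (1 \<le> i \<and> i < m) \<and> p = i - 1 then 1 else 0)
     + (if (N \<le> Suc i \<and> Suc i < 3 * N \<and> even (Suc i - N)) \<and> p = Suc i then 1 else 0)
     + (if (N < i \<and> i < 3 * N \<and> even (i - 1 - N)) \<and> p = i - 1 then 1 else 0)
     + (if 3 * N \<le> i \<and> p = mir i then 1 else 0)"
proof -
  have 1: "(p + m < N \<and> i = p + m) = ((m \<le> i \<and> i < N) \<and> p = i - m)" by auto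
  have 2: "(Suc p < m \<and> i = Suc p) = ((1 \<le> i \<and> i < m) \<and> p = i - 1)" by auto
  have 3: "((N \<le> p \<and> p < 3 * N \<and> even (p - N)) \<and> i = p - 1) =
      ((N \<le> Suc i \<and> Suc i < 3 * N \<and> even (Suc i - N)) \<and> p = Suc i)" using N_ge by auto
  have 4: "((N \<le> p \<and> p < 3 * N \<and> even (p - N)) \<and> i = Suc p) =
      ((N < i \<and> i < 3 * N \<and> even (i - 1 - N)) \<and> p = i - 1)"
  proof -
    have "Suc p < 3 * N" if h: "N \<le> p" "p < 3 * N" "even (p - N)"
    proof (rule ccontr)
      assume "\<not> Suc p < 3 * N"
      then have "p - N = 2 * N - 1" using h by linarith
      then show False using h(3) N_ge by simp
    qed
    then show ?thesis using N_ge by auto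
  qed
  have 5: "(p < 3 * N \<and> i = mir p) = (3 * N \<le> i \<and> p = mir i)" using assms by auto
  show ?thesis using assms unfolding g_def by (simp only: index_mat prod.case 1 2 3 4 5)
qed

lemma g_mult:
  assumes x: "x \<in> carrier_mat (6 * N) (6 * N)" and pq: "p < 3 * N" "q < 6 * N"
  shows "(g * x) $$ (p, q) = (if p + m < N then x $$ (p + m, q) else 0)
    + (if Suc p < m then x $$ (Suc p, q) else 0)
    + (if N \<le> p \<and> even (p - N) then x $$ (p - 1, q) + x $$ (Suc p, q) else 0) + x $$ (mir p, q)"
proof -
  have p: "p < 6 * N" using pq by simp
  have "(g * x) $$ (p, q) = (\<Sum>l<6 * N. g $$ (p, l) * x $$ (l, q))"
    by (rule index_mult_sum[OF g_carrier x p pq(2)])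
  also have "\<dots> = (\<Sum>l<6 * N. (if p + m < N \<and> l = p + m then 1 else 0) * x $$ (l, q)
     + (if Suc p < m \<and> l = Suc p then 1 else 0) * x $$ (l, q)
     + (if (N \<le> p \<and> p < 3 * N \<and> even (p - N)) \<and> l = p - 1 then 1 else 0) * x $$ (l, q)
     + (if (N \<le> p \<and> p < 3 * N \<and> even (p - N)) \<and> l = Suc p then 1 else 0) * x $$ (l, q)
     + (if p < 3 * N \<and> l = mir p then 1 else 0) * x $$ (l, q))"
    by (rule sum.cong[OF refl]) (use p in \<open>simp add: g_def distrib_right\<close>)
  finally show ?thesis
    unfolding sum.distrib sum_pick using pq N_ge by (simp add: less_imp_diff_less del: even_diff_nat)
qed

lemma g_mult_high:
  assumes x: "x \<in> carrier_mat (6 * N) (6 * N)" and pq: "3 * N \<le> p" "p < 6 * N" "q < 6 * N"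
  shows "(g * x) $$ (p, q) = 0"
  unfolding index_mult_sum[OF g_carrier x pq(2,3)]
  by (rule sum.neutral) (use pq N_ge in \<open>auto simp: g_def\<close>)

lemma mult_g:
  assumes x: "x \<in> carrier_mat (6 * N) (6 * N)" and pq: "p < 6 * N" "q < 6 * N"
  shows "(x * g) $$ (p, q) = (if m \<le> q \<and> q < N then x $$ (p, q - m) else 0)
    + (if 1 \<le> q \<and> q < m then x $$ (p, q - 1) else 0)
    + (if N \<le> Suc q \<and> Suc q < 3 * N \<and> even (Suc q - N) then x $$ (p, Suc q) else 0)
    + (if N < q \<and> q < 3 * N \<and> even (q - 1 - N) then x $$ (p, q - 1) else 0)
    + (if 3 * N \<le> q then x $$ (p, mir q) else 0)"
proof -
  have "(x * g) $$ (p, q) = (\<Sum>l<6 * N. g $$ (l, q) * x $$ (p, l))"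
    unfolding index_mult_sum[OF x g_carrier pq] by (simp add: mult.commute)
  also have "\<dots> = (\<Sum>l<6 * N. (if (m \<le> q \<and> q < N) \<and> l = q - m then 1 else 0) * x $$ (p, l)
     + (if (1 \<le> q \<and> q < m) \<and> l = q - 1 then 1 else 0) * x $$ (p, l)
     + (if (N \<le> Suc q \<and> Suc q < 3 * N \<and> even (Suc q - N)) \<and> l = Suc q then 1 else 0) * x $$ (p, l)
     + (if (N < q \<and> q < 3 * N \<and> even (q - 1 - N)) \<and> l = q - 1 then 1 else 0) * x $$ (p, l)
     + (if 3 * N \<le> q \<and> l = mir q then 1 else 0) * x $$ (p, l))"
  proof (rule sum.cong[OF refl])
    fix l assume "l \<in> {..<6 * N}"
    then have l: "l < 6 * N" by simp
    show "g $$ (l, q) * x $$ (p, l) = (if (m \<le> q \<and> q < N) \<and> l = q - m then 1 else 0) * x $$ (p, l)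
     + (if (1 \<le> q \<and> q < m) \<and> l = q - 1 then 1 else 0) * x $$ (p, l)
     + (if (N \<le> Suc q \<and> Suc q < 3 * N \<and> even (Suc q - N)) \<and> l = Suc q then 1 else 0) * x $$ (p, l)
     + (if (N < q \<and> q < 3 * N \<and> even (q - 1 - N)) \<and> l = q - 1 then 1 else 0) * x $$ (p, l)
     + (if 3 * N \<le> q \<and> l = mir q then 1 else 0) * x $$ (p, l)"
      unfolding g_col[OF l pq(2)] distrib_right by (rule refl)
  qed
  finally show ?thesis
    unfolding sum.distrib sum_pick using pq N_ge by (simp add: less_imp_diff_less del: even_diff_nat)
qed

text \<open>For a kernel matrix \<open>x\<close>, the equation at a left row and a right column identifies the entry with its mirror
image. At a right row and a right column, where \<open>g\<close> has no row, it kills an entry of the lower left corner. The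
equations at a left row and a left column then give the system for the upper left quarter, and once that quarter is
scalar they kill the rest of the corner.\<close>

lemma g_nondegenerate: "nondegenerate g"
  unfolding nondegenerate_def
proof (intro ballI impI)
  fix x assume xA: "x \<in> Alg" and tr: "mat_trace x = 0" and c0: "\<forall>(p, q)\<in>S. lie_bracket g x $$ (q, p) = 0"
  note x = supported_carrier[OF xA]
  have comm: "(g * x) $$ (r, c) = (x * g) $$ (r, c)" if "(c, r) \<in> S" for r c
  proof -
    have rc: "r < 6 * N" "c < 6 * N" using that by (auto simp: S_def)
    have "lie_bracket g x $$ (r, c) = 0" using c0 that by auto
    then show ?thesis
      unfolding lie_bracket_def index_minus_carrier[OF mult_carrier_mat[OF x g_carrier] rc] by simp
  qed
  have mm: "mir (mir p) = p" "mir p < 6 * N" "3 * N \<le> mir p" "\<not> mir p < 3 * N" if "p < 3 * N" for p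
    using that by linarith+
  have low_high: "x $$ (p, q) = 0" if "p < 3 * N" "3 * N \<le> q" "q < 6 * N" for p q
    by (rule supported_zero[OF xA]) (use that blk_left_right in \<open>auto simp: S_def\<close>)
  have mirror: "x $$ (mir p, mir q) = x $$ (p, q)" if pq: "p < 3 * N" "q < 3 * N" for p q
  proof -
    have "(mir q, p) \<in> S" using pq by (auto simp: S_def)
    note e = comm[OF this]
    have q: "\<not> mir q < N" "\<not> mir q < m" "\<not> Suc (mir q) < 3 * N" "\<not> mir q < 3 * N"
      using pq N_ge by linarith+
    have "(g * x) $$ (p, mir q) = x $$ (mir p, mir q)"
    proof -
      have "Suc p < 3 * N" if "N \<le> p" "even (p - N)"
      proof (rule ccontr)
        assume "\<not> Suc p < 3 * N"
        then have "p - N = 2 * N - 1" using pq by linarith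
        then show False using that N_ge by simp
      qed
      then show ?thesis
        unfolding g_mult[OF x pq(1) mm(2)[OF pq(2)]]
        using low_high[OF _ mm(3,2)[OF pq(2)]] N_ge pq by (simp add: less_imp_diff_less del: even_diff_nat)
    qed
    moreover have "(x * g) $$ (p, mir q) = x $$ (p, q)"
      using mult_g[OF x _ mm(2)[OF pq(2)], of p] q mm(1,3)[OF pq(2)] pq by simp
    ultimately show ?thesis using e by simp
  qed
  have corner: "x $$ (mir p, q) = 0" if pq: "p < 3 * N" "q < 3 * N" and S: "q \<le> p \<or> blk (mir p) = blk (mir q)" for p q
  proof -
    have "(mir q, mir p) \<in> S" using pq S by (auto simp: S_def)
    note e = comm[OF this]
    have q: "\<not> mir q < N" "\<not> mir q < m" "\<not> Suc (mir q) < 3 * N" "\<not> mir q < 3 * N"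
      using pq N_ge by linarith+
    have "(g * x) $$ (mir p, mir q) = 0"
      by (rule g_mult_high[OF x]) (use mm pq in blast)+
    moreover have "(x * g) $$ (mir p, mir q) = x $$ (mir p, q)"
      using mult_g[OF x mm(2)[OF pq(1)] mm(2)[OF pq(2)]] q mm(1,3)[OF pq(2)] by simp
    ultimately show ?thesis using e by simp
  qed
  have half: "(if p + m < N then x $$ (p + m, q) else 0) + (if Suc p < m then x $$ (Suc p, q) else 0)
        + (if N \<le> p \<and> even (p - N) then x $$ (p - 1, q) + x $$ (Suc p, q) else 0) + x $$ (mir p, q)
      = (if m \<le> q \<and> q < N then x $$ (p, q - m) else 0) + (if 1 \<le> q \<and> q < m then x $$ (p, q - 1) else 0)
        + (if N \<le> Suc q \<and> Suc q < 3 * N \<and> even (Suc q - N) then x $$ (p, Suc q) else 0)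
        + (if N < q \<and> even (q - 1 - N) then x $$ (p, q - 1) else 0)"
    if pq: "p < 3 * N" "q < 3 * N" and S: "p \<le> q \<or> blk q = blk p" for p q
  proof -
    have "(q, p) \<in> S" using pq S by (auto simp: S_def)
    note e = comm[OF this]
    have "(x * g) $$ (p, q) = (if m \<le> q \<and> q < N then x $$ (p, q - m) else 0) + (if 1 \<le> q \<and> q < m then x $$ (p, q - 1) else 0)
        + (if N \<le> Suc q \<and> Suc q < 3 * N \<and> even (Suc q - N) then x $$ (p, Suc q) else 0)
        + (if N < q \<and> even (q - 1 - N) then x $$ (p, q - 1) else 0)"
      using mult_g[OF x, of p q] pq by simp
    then show ?thesis using e g_mult[OF x pq(1), of q] pq by simp
  qed
  interpret Z: staircase_system m N "\<lambda>p q. x $$ (p, q)"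
  proof
    show "2 \<le> m" by (rule m)
    show "N = m * m" by (rule N)
    show "x $$ (p, q) = 0" if "p < q" "q < 3 * N"
      "\<not> (q < N - m \<or> N - m \<le> p \<and> q < N - 1 \<or> N \<le> q \<and> even (q - N) \<and> q = Suc p)" for p q
      by (rule supported_zero[OF xA]) (use that blk_left[OF that(1,2)] in \<open>auto simp: S_def\<close>)
    show "x $$ (q, p) = 0" if "p < q" "q < 3 * N" "\<not> (q < N \<or> N \<le> p \<and> even (p - N) \<and> q = Suc p)" for p q
    proof -
      have "x $$ (mir q, mir p) = 0"
        by (rule supported_zero[OF xA]) (use that blk_mir[OF that(1,2)] in \<open>auto simp: S_def\<close>)
      then show ?thesis using mirror[of q p] that by simp
    qed
    fix p q
    assume pq: "p < 3 * N" "q < 3 * N"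
      and 1: "p \<le> q \<or> p < N - m \<or> N - m \<le> q \<and> p < N - 1 \<or> N \<le> p \<and> even (p - N) \<and> p = Suc q"
      and 2: "q \<le> p \<or> q < N \<or> N \<le> p \<and> even (p - N) \<and> q = Suc p"
    have S: "p \<le> q \<or> blk q = blk p" using 1 blk_left[of q p] pq by (cases "p \<le> q") auto
    have "q \<le> p \<or> blk (mir p) = blk (mir q)" using 2 blk_mir[of p q] pq by (cases "q \<le> p") auto
    then show "(if p + m < N then x $$ (p + m, q) else 0) + (if Suc p < m then x $$ (Suc p, q) else 0)
        + (if N \<le> p \<and> even (p - N) then x $$ (p - 1, q) + x $$ (Suc p, q) else 0)
      = (if m \<le> q \<and> q < N then x $$ (p, q - m) else 0) + (if 1 \<le> q \<and> q < m then x $$ (p, q - 1) else 0)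
        + (if N \<le> Suc q \<and> Suc q < 3 * N \<and> even (Suc q - N) then x $$ (p, Suc q) else 0)
        + (if N < q \<and> even (q - 1 - N) then x $$ (p, q - 1) else 0)"
      using half[OF pq S] corner[OF pq] by simp
  qed
  define z where "z = x $$ (0, 0)"
  have sc: "x $$ (p, q) = (if p = q then z else 0)" if "p < 3 * N" "q < 3 * N" for p q
    using Z.scalar[OF that] by (simp add: z_def)
  have corner0: "x $$ (mir p, q) = 0" if pq: "p < 3 * N" "q < 3 * N" for p q
  proof (cases "q \<le> p")
    case True
    then show ?thesis using corner pq by blast
  next
    case False
    then have "p \<le> q" by simp
    have 1: "(if p + m < N then x $$ (p + m, q) else 0) = (if m \<le> q \<and> q < N then x $$ (p, q - m) else 0)"
      using sc[of "p + m" q] sc[of p "q - m"] pq by auto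
    have 2: "(if Suc p < m then x $$ (Suc p, q) else 0) = (if 1 \<le> q \<and> q < m then x $$ (p, q - 1) else 0)"
      using sc[of "Suc p" q] sc[of p "q - 1"] pq N_ge by auto
    have 3: "(if N \<le> p \<and> even (p - N) then x $$ (p - 1, q) else 0)
        = (if N \<le> Suc q \<and> Suc q < 3 * N \<and> even (Suc q - N) then x $$ (p, Suc q) else 0)"
      using sc[of "p - 1" q] sc[of p "Suc q"] pq N_ge False by auto
    have 4: "(if N \<le> p \<and> even (p - N) then x $$ (Suc p, q) else 0)
        = (if N < q \<and> even (q - 1 - N) then x $$ (p, q - 1) else 0)"
    proof -
      have "Suc p < 3 * N" using False pq by simp
      then show ?thesis using sc[of "Suc p" q] sc[of p "q - 1"] pq N_ge by auto
    qed
    show ?thesis using half[OF pq] \<open>p \<le> q\<close> 1 2 3 4 by (simp split: if_splits)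
  qed
  have all: "x $$ (i, j) = (if i = j then z else 0)" if ij: "i < 6 * N" "j < 6 * N" for i j
  proof -
    have mi: "mir r < 3 * N" "mir (mir r) = r" if "\<not> r < 3 * N" "r < 6 * N" for r using that by linarith+
    consider "i < 3 * N" "j < 3 * N" | "i < 3 * N" "\<not> j < 3 * N" | "\<not> i < 3 * N" "j < 3 * N"
      | "\<not> i < 3 * N" "\<not> j < 3 * N" by blast
    then show ?thesis
    proof cases
      case 1
      then show ?thesis by (rule sc)
    next
      case 2
      then show ?thesis using low_high[of i j] ij by auto
    next
      case 3
      then show ?thesis using corner0[of "mir i" j] mi[of i] ij by auto
    next
      case 4
      have "x $$ (i, j) = x $$ (mir i, mir j)"
        using mirror[of "mir i" "mir j"] mi[OF 4(1) ij(1)] mi[OF 4(2) ij(2)] by simp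
      also have "\<dots> = (if mir i = mir j then z else 0)"
        by (rule sc) (use mi 4 ij in blast)+
      also have "mir i = mir j \<longleftrightarrow> i = j" using ij by linarith
      finally show ?thesis .
    qed
  qed
  have "mat_trace x = (\<Sum>i<6 * N. z)"
    unfolding mat_trace_carrier[OF x] by (rule sum.cong) (use all in auto)
  then have "z = 0" using tr N_ge by simp
  then show "x = 0\<^sub>m (6 * N) (6 * N)"
    by (intro eq_matI) (use all x in auto)
qed

text \<open>The heights: the grid descends from \<open>0\<close> at its last vertex to \<open>-2 (m - 1)\<close> at its first one, the tail alternates between
\<open>-1\<close> and \<open>0\<close>, and the mirror image lies one higher.\<close>

definition \<mu> :: "nat \<Rightarrow> int" where
  "\<mu> p = (let q = min p (mir p) in
     if q < N then int (q div m) + int (q mod m) - 2 * (int m - 1) else - int ((q + 1 - N) mod 2))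
     + (if p < 3 * N then 0 else 1)"

lemma \<mu>_core: "p < N \<Longrightarrow> \<mu> p = int (p div m) + int (p mod m) - 2 * (int m - 1)"
  and \<mu>_tail: "i < 2 * N \<Longrightarrow> \<mu> (N + i) = - int (Suc i mod 2)"
  and \<mu>_mir: "p < 3 * N \<Longrightarrow> \<mu> (mir p) = \<mu> p + 1"
  by (auto simp: \<mu>_def min_def Let_def)

lemma g_edge:
  assumes pi: "p < 6 * N" "i < 6 * N" and "g $$ (p, i) \<noteq> 0"
  shows "\<mu> i = \<mu> p + 1"
proof -
  have "(p + m < N \<and> i = p + m) \<or> (Suc p < m \<and> i = Suc p)
     \<or> ((N \<le> p \<and> p < 3 * N \<and> even (p - N)) \<and> (i = p - 1 \<or> i = Suc p)) \<or> (p < 3 * N \<and> i = mir p)"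
    using assms by (auto simp: g_def split: if_splits)
  then consider "p + m < N" "i = p + m" | "Suc p < m" "i = Suc p"
    | k where "p = N + 2 * k" "k < N" "i = p - 1" | k where "p = N + 2 * k" "k < N" "i = Suc p"
    | "p < 3 * N" "i = mir p"
  proof (elim disjE)
    assume h: "(N \<le> p \<and> p < 3 * N \<and> even (p - N)) \<and> (i = p - 1 \<or> i = Suc p)"
    then have "even (p - N)" by blast
    then obtain k where k: "p - N = 2 * k" by (rule evenE)
    have "p = N + 2 * k" "k < N" using h k by linarith+
    with h show thesis by (elim conjE disjE) (rule that(3), assumption+, rule that(4), assumption+)
  qed (elim conjE, rule that, assumption+)+
  then show ?thesis
  proof cases
    case 1
    then show ?thesis using m by (simp add: \<mu>_core)
  next
    case 2
    then show ?thesis using N_ge by (simp add: \<mu>_core)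
  next
    case 3
    have "\<mu> p = - 1" using \<mu>_tail[of "2 * k"] 3 by simp
    moreover have "\<mu> i = 0"
    proof (cases k)
      case 0
      have "(m * m - 1) div m = m - 1" "(m * m - 1) mod m = m - 1"
      proof -
        have e: "m * m - 1 = (m - 1) * m + (m - 1)" using m by (cases m) auto
        have "(c * m + r) div m = c" "(c * m + r) mod m = r" if "r < m" for c r using that by simp_all
        moreover have "m - 1 < m" using m by simp
        ultimately show "(m * m - 1) div m = m - 1" "(m * m - 1) mod m = m - 1" unfolding e by blast+
      qed
      then show ?thesis using 0 3 N_ge m \<mu>_core[of "N - 1"] by (simp add: N)
    next
      case (Suc l)
      then have "i = N + Suc (2 * l)" using 3 by simp
      then show ?thesis using \<mu>_tail[of "Suc (2 * l)"] Suc 3 by simp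
    qed
    ultimately show ?thesis by simp
  next
    case 4
    have "\<mu> p = - 1" using \<mu>_tail[of "2 * k"] 4 by simp
    moreover have "\<mu> i = 0" using \<mu>_tail[of "Suc (2 * k)"] 4 by simp
    ultimately show ?thesis by simp
  next
    case 5
    show ?thesis unfolding 5(2) by (rule \<mu>_mir[OF 5(1)])
  qed
qed

lemma g_trace: "mat_trace g = 0"
proof -
  have "g $$ (p, p) = 0" if "p < 6 * N" for p
    using g_edge[OF that that] by fastforce
  then show ?thesis unfolding mat_trace_carrier[OF g_carrier] by simp
qed

definition d :: "nat \<Rightarrow> complex" where
  "d i = of_int (\<mu> i) - (\<Sum>i<6 * N. of_int (\<mu> i)) / of_nat (6 * N)"

lemma d_diff: "d i - d k = of_int j \<longleftrightarrow> \<mu> i - \<mu> k = j"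
proof -
  have "d i - d k = of_int (\<mu> i - \<mu> k)" by (simp add: d_def)
  then show ?thesis by (simp only: of_int_eq_iff)
qed

lemma principal_d: "principal g (Matrix.mat (6 * N) (6 * N) (\<lambda>(i, j). if i = j then d i else 0))"
proof -
  let ?H = "Matrix.mat (6 * N) (6 * N) (\<lambda>(i, j). if i = j then d i else 0)"
  have H: "?H \<in> carrier_mat (6 * N) (6 * N)" by simp
  have "?H \<in> Alg" by (rule supportedI) (use S_refl in auto)
  moreover have "mat_trace ?H = 0"
  proof -
    have "mat_trace ?H = (\<Sum>i<6 * N. d i)" unfolding mat_trace_carrier[OF H] by (rule sum.cong) auto
    also have "\<dots> = 0" unfolding d_def sum_subtractf using N_ge by simp
    finally show ?thesis .
  qed
  moreover have "lie_bracket g ?H $$ (q, p) = g $$ (q, p)" if "q < 6 * N" "p < 6 * N" for p q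
  proof -
    have "lie_bracket g ?H $$ (q, p) = - (lie_bracket ?H g $$ (q, p))"
      unfolding lie_bracket_swap[OF g_carrier H] using that lie_bracket_carrier[OF H g_carrier] by simp
    also have "\<dots> = (d p - d q) * g $$ (q, p)"
      unfolding diag_lie_bracket_index[OF g_carrier that] by (simp add: algebra_simps)
    also have "\<dots> = g $$ (q, p)"
    proof (cases "g $$ (q, p) = 0")
      case False
      then have "d p - d q = of_int 1" using g_edge[OF that False] unfolding d_diff by simp
      then show ?thesis by simp
    qed simp
    finally show ?thesis .
  qed
  ultimately show ?thesis unfolding principal_def by (auto simp: S_def)
qed

end

section \<open>Pairs of grid points by level difference\<close>

definition lvl :: "nat \<Rightarrow> nat \<Rightarrow> nat" where
  "lvl m q = q div m + q mod m"

text \<open>A point of level \<open>t\<close> in a grid with \<open>k\<close> rows of length \<open>m\<close> is determined by its row.\<close>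

lemma card_lvl:
  assumes m: "0 < m"
  shows "card {q. q < k * m \<and> lvl m q = t} = min (Suc t) k - (Suc t - m)"
proof -
  define A where "A = {Suc t - m..<min (Suc t) k}"
  have "bij_betw (\<lambda>a. a * m + (t - a)) A {q. q < k * m \<and> lvl m q = t}"
  proof (rule bij_betw_byWitness[where f' = "\<lambda>q. q div m"])
    have *: "t - a < m" "a \<le> t" "a < k" if "a \<in> A" for a using that by (auto simp: A_def)
    have dm: "(c * m + r) div m = c" "(c * m + r) mod m = r" if "r < m" for c r using that by simp_all
    show "\<forall>a\<in>A. (a * m + (t - a)) div m = a" by (intro ballI dm(1) *(1))
    show "\<forall>q\<in>{q. q < k * m \<and> lvl m q = t}. q div m * m + (t - q div m) = q"
    proof
      fix q assume "q \<in> {q. q < k * m \<and> lvl m q = t}"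
      then have "t - q div m = q mod m" by (auto simp: lvl_def)
      then show "q div m * m + (t - q div m) = q" by simp
    qed
    show "(\<lambda>a. a * m + (t - a)) ` A \<subseteq> {q. q < k * m \<and> lvl m q = t}"
    proof (rule image_subsetI)
      fix a assume a: "a \<in> A"
      have "Suc a * m \<le> k * m" by (intro mult_le_mono1 Suc_leI *(3)[OF a])
      then have "a * m + (t - a) < k * m" using *(1)[OF a] by simp
      then show "a * m + (t - a) \<in> {q. q < k * m \<and> lvl m q = t}"
        using *(2)[OF a] unfolding lvl_def mem_Collect_eq dm[OF *(1)[OF a]] by simp
    qed
    show "(\<lambda>q. q div m) ` {q. q < k * m \<and> lvl m q = t} \<subseteq> A"
    proof (rule image_subsetI)
      fix q assume q: "q \<in> {q. q < k * m \<and> lvl m q = t}"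
      then have "q div m < k" by (simp add: less_mult_imp_div_less)
      moreover have "q mod m < m" using m by simp
      moreover have "q div m + q mod m = t" using q by (simp add: lvl_def)
      ultimately show "q div m \<in> A" unfolding A_def atLeastLessThan_iff by linarith
    qed
  qed
  then have "card {q. q < k * m \<and> lvl m q = t} = card A" by (simp add: bij_betw_same_card)
  then show ?thesis by (simp add: A_def)
qed

lemma lvl_le: "0 < m \<Longrightarrow> q < m * m \<Longrightarrow> lvl m q \<le> 2 * (m - 1)"
proof -
  assume m: "0 < m" and q: "q < m * m"
  have "q div m < m" using q by (rule less_mult_imp_div_less)
  moreover have "q mod m < m" using m by simp
  ultimately show ?thesis unfolding lvl_def by linarith
qed

lemma card_lvl_in:
  assumes m: "0 < m" and T: "finite T"
  shows "card {q. q < k * m \<and> lvl m q \<in> T} = (\<Sum>t\<in>T. min (Suc t) k - (Suc t - m))"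
proof -
  have "{q. q < k * m \<and> lvl m q \<in> T} = (\<Union>t\<in>T. {q. q < k * m \<and> lvl m q = t})" by auto
  also have "card \<dots> = (\<Sum>t\<in>T. card {q. q < k * m \<and> lvl m q = t})"
    by (rule card_UN_disjoint) (use T in auto)
  finally show ?thesis by (simp only: card_lvl[OF m])
qed

lemma card_pairs:
  assumes "finite A" "finite B"
  shows "card {(p, q). p \<in> A \<and> q \<in> B \<and> R p q} = (\<Sum>p\<in>A. card {q. q \<in> B \<and> R p q})"
    and "card {(p, q). p \<in> A \<and> q \<in> B \<and> R p q} = (\<Sum>q\<in>B. card {p. p \<in> A \<and> R p q})"
proof -
  have "{(p, q). p \<in> A \<and> q \<in> B \<and> R p q} = (SIGMA p:A. {q. q \<in> B \<and> R p q})" by auto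
  then show "card {(p, q). p \<in> A \<and> q \<in> B \<and> R p q} = (\<Sum>p\<in>A. card {q. q \<in> B \<and> R p q})"
    using assms by simp
  have "{(p, q). p \<in> A \<and> q \<in> B \<and> R p q} = prod.swap ` (SIGMA q:B. {p. p \<in> A \<and> R p q})" by force
  then have "card {(p, q). p \<in> A \<and> q \<in> B \<and> R p q} = card (SIGMA q:B. {p. p \<in> A \<and> R p q})"
    by (simp add: card_image)
  then show "card {(p, q). p \<in> A \<and> q \<in> B \<and> R p q} = (\<Sum>q\<in>B. card {p. p \<in> A \<and> R p q})"
    using assms by simp
qed

lemma triangle: "2 * (\<Sum>s<k. J - s) = J * Suc J" if "J \<le> k" for J k :: nat
  using that
proof (induction k arbitrary: J)
  case (Suc k)
  show ?case
  proof (cases "J \<le> k")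
    case True
    then show ?thesis using Suc.IH[OF True] by simp
  next
    case False
    then have J: "J = Suc k" using Suc.prems by simp
    have "(\<Sum>s<Suc k. J - s) = J + (\<Sum>s<k. k - s)" unfolding J by (subst sum.lessThan_Suc_shift) simp
    then show ?thesis using Suc.IH[of k] J by simp
  qed
qed simp

lemma int_triangle: "2 * x = y * Suc y \<Longrightarrow> 2 * int x = int y * (int y + 1)"
  by (drule arg_cong[where f = int]) (simp add: algebra_simps)

definition core_pairs :: "nat \<Rightarrow> nat \<Rightarrow> (nat \<times> nat) set" where
  "core_pairs m i = {(p, q). p \<in> {..<m * m} \<and> q \<in> {..<m * m} \<and> lvl m p = lvl m q + i}"

text \<open>For fixed \<open>q\<close>, passing from \<open>i\<close> to \<open>i + 1\<close> changes the number of partners \<open>p\<close> by at most one, with a sign that depends on the side of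
the longest antidiagonal on which the target level lies. What remains is to count the \<open>q\<close> with a given sign; these are
triangular numbers.\<close>

lemma core_pairs_diff:
  assumes m: "0 < m" and i: "i < m"
  shows "2 * (int (card (core_pairs m i)) - int (card (core_pairs m (Suc i))))
    = 4 * int m * int i - 3 * (int i)\<^sup>2 + 2 * int m - 3 * int i"
proof -
  define cc where "cc t = min (Suc t) m - (Suc t - m)" for t
  have cp: "card (core_pairs m i) = (\<Sum>q<m * m. cc (lvl m q + i))" for i
    unfolding core_pairs_def
    by (subst card_pairs(2)) (use card_lvl[OF m, of m] in \<open>simp_all add: cc_def\<close>)
  define A B where "A = {2 * m - 1 - i..<2 * m}" and "B = {..<m - 1 - i}"
  have step: "int (cc (l + i)) - int (cc (l + Suc i)) = 1 - of_bool (l \<in> A) - 2 * of_bool (l \<in> B)"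
    if "l \<le> 2 * (m - 1)" for l
  proof -
    consider "l \<in> B" "l \<notin> A" | "l \<notin> B" "l \<in> A" | "l \<notin> B" "l \<notin> A" unfolding A_def B_def by fastforce
    then show ?thesis using that i unfolding A_def B_def cc_def by cases auto
  qed
  have cin: "(\<Sum>q<m * m. of_bool (lvl m q \<in> T) :: int) = int (\<Sum>t\<in>T. cc t)" if "finite T" for T
  proof -
    have "(\<Sum>q<m * m. of_bool (lvl m q \<in> T) :: int) = int (card {q. q < m * m \<and> lvl m q \<in> T})"
      by (simp add: sum_of_bool_eq Int_def)
    then show ?thesis using card_lvl_in[OF m that, of m] by (simp add: cc_def)
  qed
  have "int (card (core_pairs m i)) - int (card (core_pairs m (Suc i)))
      = (\<Sum>q<m * m. int (cc (lvl m q + i)) - int (cc (lvl m q + Suc i)))"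
    unfolding cp by (simp add: sum_subtractf)
  also have "\<dots> = (\<Sum>q<m * m. 1 - of_bool (lvl m q \<in> A) - 2 * of_bool (lvl m q \<in> B))"
    by (rule sum.cong[OF refl]) (use step lvl_le[OF m] in simp)
  also have "\<dots> = int (m * m) - int (\<Sum>t\<in>A. cc t) - 2 * int (\<Sum>t\<in>B. cc t)"
    unfolding sum_subtractf sum_distrib_left[symmetric] using cin[of A] cin[of B]
    by (simp add: A_def B_def)
  finally have e: "int (card (core_pairs m i)) - int (card (core_pairs m (Suc i)))
      = int (m * m) - int (\<Sum>t\<in>A. cc t) - 2 * int (\<Sum>t\<in>B. cc t)" .
  have "(\<Sum>t\<in>A. cc t) = (\<Sum>s<Suc i. i - s)"
    by (rule sum.reindex_bij_witness[where i = "\<lambda>s. 2 * m - 1 - i + s" and j = "\<lambda>t. t - (2 * m - 1 - i)"])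
       (use i in \<open>auto simp: A_def cc_def\<close>)
  then have "2 * (\<Sum>t\<in>A. cc t) = i * Suc i" using triangle[of i "Suc i"] by simp
  note a = int_triangle[OF this]
  have "(\<Sum>t\<in>B. cc t) = (\<Sum>s<m - 1 - i. (m - 1 - i) - s)"
    by (rule sum.reindex_bij_witness[where i = "\<lambda>s. m - 2 - i - s" and j = "\<lambda>s. m - 2 - i - s"])
       (use i in \<open>auto simp: B_def cc_def\<close>)
  then have "2 * (\<Sum>t\<in>B. cc t) = (m - 1 - i) * Suc (m - 1 - i)" using triangle[of "m - 1 - i" "m - 1 - i"] by simp
  then have "2 * int (\<Sum>t\<in>B. cc t) = int (m - 1 - i) * (int (m - 1 - i) + 1)"
    by (rule int_triangle)
  moreover have "int (m - 1 - i) = int m - 1 - int i" using i by linarith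
  ultimately have b: "2 * int (\<Sum>t\<in>B. cc t) = (int m - 1 - int i) * (int m - int i)" by simp
  show ?thesis unfolding e right_diff_distrib a
    using b by (simp add: algebra_simps power2_eq_square)
qed

text \<open>These pairs point from the first block into the second one, against the order, and are absent from the parabolic.\<close>

lemma split_pairs:
  assumes m: "0 < m" and j: "0 < j" "j < m"
  shows "2 * int (card {(p, q). p < m * (m - 1) \<and> m * (m - 1) \<le> q \<and> q < m * m - 1 \<and> lvl m p = lvl m q + j})
    = (int m - 1 - int j) * (int m - int j)"
proof -
  define B where "B = {m * (m - 1)..<m * m - 1}"
  have "{(p, q). p < m * (m - 1) \<and> m * (m - 1) \<le> q \<and> q < m * m - 1 \<and> lvl m p = lvl m q + j}
      = {(p, q). p \<in> {..<(m - 1) * m} \<and> q \<in> B \<and> lvl m p = lvl m q + j}"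
    by (auto simp: B_def mult.commute)
  then have "card {(p, q). p < m * (m - 1) \<and> m * (m - 1) \<le> q \<and> q < m * m - 1 \<and> lvl m p = lvl m q + j}
      = (\<Sum>q\<in>B. min (Suc (lvl m q + j)) (m - 1) - (Suc (lvl m q + j) - m))"
    using card_pairs(2)[of "{..<(m - 1) * m}" B "\<lambda>p q. lvl m p = lvl m q + j"] card_lvl[OF m, of "m - 1"]
    by (simp add: B_def)
  also have "\<dots> = (\<Sum>s<m - 1. (m - 1 - j) - s)"
  proof (rule sum.reindex_bij_witness[where i = "\<lambda>s. m * (m - 1) + s" and j = "\<lambda>q. q - m * (m - 1)"])
    have mm: "m * m - 1 = m * (m - 1) + (m - 1)" using m by (cases m) auto
    fix q assume q: "q \<in> B"
    then obtain s where s: "q = m * (m - 1) + s" "s < m - 1"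
      unfolding B_def mm using le_Suc_ex by fastforce
    then have "lvl m q = m - 1 + s" by (simp add: lvl_def)
    then show "m - 1 - j - (q - m * (m - 1)) = min (Suc (lvl m q + j)) (m - 1) - (Suc (lvl m q + j) - m)"
      using s j by simp
    show "m * (m - 1) + (q - m * (m - 1)) = q" "q - m * (m - 1) \<in> {..<m - 1}" using s by simp_all
  next
    have mm: "m * m - 1 = m * (m - 1) + (m - 1)" using m by (cases m) auto
    show "m * (m - 1) + s - m * (m - 1) = s" for s by simp
    show "m * (m - 1) + s \<in> B" if "s \<in> {..<m - 1}" for s using that unfolding B_def mm by simp
  qed
  finally have "2 * card {(p, q). p < m * (m - 1) \<and> m * (m - 1) \<le> q \<and> q < m * m - 1 \<and> lvl m p = lvl m q + j}
     = (m - 1 - j) * Suc (m - 1 - j)"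
    using triangle[of "m - 1 - j" "m - 1"] by simp
  then have "2 * int (card {(p, q). p < m * (m - 1) \<and> m * (m - 1) \<le> q \<and> q < m * m - 1 \<and> lvl m p = lvl m q + j})
     = int (m - 1 - j) * (int (m - 1 - j) + 1)"
    by (rule int_triangle)
  moreover have "int (m - 1 - j) = int m - 1 - int j" using j by linarith
  ultimately show ?thesis by simp
qed

section \<open>The principal multiplicities\<close>

lemma sum_alternating: "(\<Sum>x<2 * k. c + Suc x mod 2) = k * (2 * c + 1)" for c k :: nat
proof (induction k)
  case (Suc k)
  have "2 * Suc k = Suc (Suc (2 * k))" "Suc (2 * k) mod 2 = 1" "Suc (Suc (2 * k)) mod 2 = 0" by simp_all
  then show ?case using Suc by simp
qed simp

context staircase
begin

lemma \<mu>_lvl: "p < N \<Longrightarrow> \<mu> p = int (lvl m p) - 2 * (int m - 1)"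
  by (simp add: \<mu>_core lvl_def)

lemma lvl_bound: "p < N \<Longrightarrow> lvl m p \<le> 2 * (m - 1)"
  using lvl_le[of m p] m by (simp add: N)

lemma \<mu>_nonpos: "p < 3 * N \<Longrightarrow> \<mu> p \<le> 0"
proof (cases "p < N")
  case True
  have "int (lvl m p) \<le> int (2 * (m - 1))" using lvl_bound[OF True] by (simp only: of_nat_le_iff)
  then show ?thesis using m by (simp add: \<mu>_lvl[OF True] of_nat_diff)
next
  case False
  assume "p < 3 * N"
  then have "p - N < 2 * N" "N + (p - N) = p" using False by linarith+
  then show ?thesis using \<mu>_tail[of "p - N"] by simp
qed

lemma \<mu>_tail_ge: "N \<le> p \<Longrightarrow> p < 3 * N \<Longrightarrow> - 1 \<le> \<mu> p"
proof -
  assume "N \<le> p" "p < 3 * N"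
  then have "p - N < 2 * N" "N + (p - N) = p" by linarith+
  moreover have "Suc (p - N) mod 2 \<le> 1" by simp
  ultimately show ?thesis using \<mu>_tail[of "p - N"] by simp
qed

text \<open>For height difference at least two the second vertex is in the core: the tail is too high.\<close>

lemma target_core: "p < 3 * N \<Longrightarrow> q < 3 * N \<Longrightarrow> 2 \<le> \<mu> p - \<mu> q \<Longrightarrow> q < N"
  using \<mu>_nonpos[of p] \<mu>_tail_ge[of q] by linarith

lemma \<mu>_diff_core: "p < N \<Longrightarrow> q < N \<Longrightarrow> \<mu> p - \<mu> q = int i \<longleftrightarrow> lvl m p = lvl m q + i"
  by (simp add: \<mu>_lvl) linarith

definition tail_pairs :: "nat \<Rightarrow> (nat \<times> nat) set" where
  "tail_pairs i = {(p, q). p \<in> {N..<3 * N} \<and> q \<in> {..<N} \<and> \<mu> p - \<mu> q = int i}"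

lemma card_tail_pairs:
  assumes i: "i + 2 \<le> m"
  shows "card (tail_pairs i) = N * (2 * i + 3)"
proof -
  have c: "card {q. q \<in> {..<N} \<and> \<mu> (N + x) - \<mu> q = int i} = Suc i + Suc x mod 2" if x: "x < 2 * N" for x
  proof -
    define e where "e = Suc x mod 2"
    have e: "e \<le> 1" by (simp add: e_def)
    define T where "T = 2 * (m - 1) - i - e"
    have T: "T + i + e + 2 = 2 * m" unfolding T_def using i e m by linarith
    have eq: "\<mu> (N + x) - \<mu> q = int i \<longleftrightarrow> lvl m q = T" if "q < N" for q
    proof -
      have "\<mu> (N + x) = - int e" using \<mu>_tail[OF x] by (simp add: e_def)
      moreover have "int T + int i + int e + 2 = 2 * int m" using arg_cong[OF T, of int] by simp
      ultimately have "\<mu> (N + x) - \<mu> q = int i \<longleftrightarrow> int (lvl m q) = int T"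
        using \<mu>_lvl[OF that] by auto
      then show ?thesis by (simp only: of_nat_eq_iff)
    qed
    have 1: "{q. q \<in> {..<N} \<and> \<mu> (N + x) - \<mu> q = int i} = {q. q < m * m \<and> lvl m q = T}"
      using eq by (auto simp flip: N)
    have "card {q. q < m * m \<and> lvl m q = T}
        = min (Suc (T)) m - (Suc (T) - m)"
      by (rule card_lvl) (use m in simp)
    also have "\<dots> = Suc i + e"
      using T e i by linarith
    finally show ?thesis unfolding 1 e_def .
  qed
  have "card (tail_pairs i) = (\<Sum>p\<in>{N..<3 * N}. card {q. q \<in> {..<N} \<and> \<mu> p - \<mu> q = int i})"
    unfolding tail_pairs_def by (rule card_pairs(1)) simp_all
  also have "\<dots> = (\<Sum>x<2 * N. card {q. q \<in> {..<N} \<and> \<mu> (N + x) - \<mu> q = int i})"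
    by (rule sum.reindex_bij_witness[where i = "\<lambda>x. N + x" and j = "\<lambda>p. p - N"]) auto
  also have "\<dots> = (\<Sum>x<2 * N. Suc i + Suc x mod 2)"
    by (rule sum.cong[OF refl]) (use c in simp)
  finally show ?thesis unfolding sum_alternating by (simp add: algebra_simps)
qed

definition split_set :: "nat \<Rightarrow> (nat \<times> nat) set" where
  "split_set j = {(p, q). p < m * (m - 1) \<and> m * (m - 1) \<le> q \<and> q < m * m - 1 \<and> lvl m p = lvl m q + j}"

lemma left_pair_iff:
  assumes "2 \<le> i"
  shows "p < 3 * N \<and> q < 3 * N \<and> \<mu> p - \<mu> q = int i \<longleftrightarrow> (p, q) \<in> core_pairs m i \<or> (p, q) \<in> tail_pairs i"
proof
  assume h: "p < 3 * N \<and> q < 3 * N \<and> \<mu> p - \<mu> q = int i"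
  then have q: "q < N" using target_core[of p q] assms by linarith
  show "(p, q) \<in> core_pairs m i \<or> (p, q) \<in> tail_pairs i"
  proof (cases "p < N")
    case True
    then show ?thesis using \<mu>_diff_core[OF True q, of i] h q by (simp add: core_pairs_def N)
  next
    case False
    then show ?thesis using h q by (simp add: tail_pairs_def)
  qed
next
  assume "(p, q) \<in> core_pairs m i \<or> (p, q) \<in> tail_pairs i"
  then show "p < 3 * N \<and> q < 3 * N \<and> \<mu> p - \<mu> q = int i"
  proof
    assume "(p, q) \<in> core_pairs m i"
    then have "p < N" "q < N" "lvl m p = lvl m q + i" by (simp_all add: core_pairs_def N)
    then show ?thesis using \<mu>_diff_core[of p q i] by simp
  qed (simp add: tail_pairs_def)
qed

lemma finite_pairs: "finite (core_pairs m i)" "finite (tail_pairs i)"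
  by (rule finite_subset[of _ "{..<m * m} \<times> {..<m * m}"], auto simp: core_pairs_def)
     (rule finite_subset[of _ "{..<3 * N} \<times> {..<N}"], auto simp: tail_pairs_def)

lemma core_pair_less: "(p, q) \<in> core_pairs m i \<Longrightarrow> p < N \<and> q < N"
  by (simp add: core_pairs_def N)

lemma tail_pair_bounds: "(p, q) \<in> tail_pairs i \<Longrightarrow> N \<le> p \<and> p < 3 * N \<and> q < N"
  by (simp add: tail_pairs_def)

lemma core_tail_disjoint: "core_pairs m i \<inter> tail_pairs j = {}"
proof (rule equals0I)
  fix s assume s: "s \<in> core_pairs m i \<inter> tail_pairs j"
  obtain p q where "s = (p, q)" by (cases s)
  then show False using s core_pair_less[of p q i] tail_pair_bounds[of p q j] by simp
qed

lemma lvl_last: "lvl m (N - 1) = 2 * (m - 1)"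
proof -
  have e: "N - 1 = (m - 1) * m + (m - 1)" using m unfolding N by (cases m) auto
  have "(c * m + r) div m = c" "(c * m + r) mod m = r" if "r < m" for c r using that by simp_all
  moreover have "m - 1 < m" using m by simp
  ultimately have "(N - 1) div m = m - 1" "(N - 1) mod m = m - 1" unfolding e by blast+
  then show ?thesis by (simp add: lvl_def)
qed

lemma split_set_subset: "split_set j \<subseteq> core_pairs m j"
proof -
  have "m * (m - 1) \<le> m * m" by (intro mult_le_mono2) simp
  then show ?thesis unfolding split_set_def core_pairs_def by auto
qed

lemma core_pair_left:
  assumes "(p, q) \<in> core_pairs m j" "0 < j"
  shows "(p, q) \<in> S \<longleftrightarrow> (p, q) \<notin> split_set j"
proof -
  have pq: "p < N" "q < N" and l: "lvl m p = lvl m q + j" using assms by (simp_all add: core_pairs_def N)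
  have S: "(p, q) \<in> S \<longleftrightarrow> q \<le> p \<or> blk p = blk q" using pq by (simp add: S_def)
  have c: "m * (m - 1) = N - m" "m \<le> N" "m * m = N" using core_split N by linarith+
  have B: "(p, q) \<in> split_set j \<longleftrightarrow> p < N - m \<and> N - m \<le> q \<and> q < N - 1"
    unfolding split_set_def c using l by simp
  show ?thesis
  proof (cases "q \<le> p")
    case True
    then show ?thesis unfolding S B by auto
  next
    case False
    have "q \<noteq> N - 1"
    proof
      assume "q = N - 1"
      then have "lvl m q = 2 * (m - 1)" using lvl_last by simp
      then show False using l lvl_bound[OF pq(1)] assms(2) by linarith
    qed
    then have "q < N - 1" using pq by linarith
    moreover have "blk p = blk q \<longleftrightarrow> q < N - m \<or> N - m \<le> p \<and> q < N - 1 \<or> N \<le> q \<and> even (q - N) \<and> q = Suc p"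
      by (rule blk_left) (use False pq in linarith)+
    ultimately show ?thesis unfolding S B using False pq by linarith
  qed
qed

text \<open>Modulo the mirror there are three kinds of pairs: from right to left, where everything is admissible and the difference
in the left half is \<open>j - 1\<close>; within the left half, where the split pairs are missing and the tail contributes; and within the
right half, where exactly the core pairs occur. No admissible pair goes from left to right.\<close>

lemma card_graded:
  assumes j: "3 \<le> j" "j + 2 \<le> m"
  shows "int (card {(i, k) \<in> S. \<mu> i - \<mu> k = int j})
    = int (card (core_pairs m (j - 1))) + 2 * int (card (core_pairs m j)) - int (card (split_set j))
      + int N * (4 * int j + 4)"
proof -
  let ?C = "core_pairs m" and ?T = tail_pairs
  let ?f = "\<lambda>(p, q). (mir p, q)" and ?h = "\<lambda>(p, q). (mir p, mir q)"
  have pair: "p < 3 * N \<and> q < 3 * N" if "(p, q) \<in> ?C i \<or> (p, q) \<in> ?T i" for p q i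
    using that core_pair_less[of p q i] tail_pair_bounds[of p q i] by auto
  define X1 X2 X3 where "X1 = ?f ` (?C (j - 1) \<union> ?T (j - 1))" and "X2 = (?C j - split_set j) \<union> ?T j"
    and "X3 = ?h ` ?C j"
  have low: "p < 3 * N \<and> q < 3 * N" if "(p, q) \<in> X2" for p q using that pair unfolding X2_def by blast
  have right: "(mir p, mir q) \<in> S \<longleftrightarrow> p < N" if h: "(p, q) \<in> ?C j \<or> (p, q) \<in> ?T j" for p q
  proof -
    have pq: "p < 3 * N" "q < N" using h core_pair_less[of p q j] tail_pair_bounds[of p q j] by auto
    show ?thesis
    proof (cases "p \<le> q")
      case True
      then show ?thesis using pq by (auto simp: S_def)
    next
      case False
      then have "(mir p, mir q) \<in> S \<longleftrightarrow> blk (mir q) = blk (mir p)" using pq by (auto simp: S_def)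
      then show ?thesis using blk_mir[of q p] False pq by auto
    qed
  qed
  have D: "{(i, k) \<in> S. \<mu> i - \<mu> k = int j} = X1 \<union> X2 \<union> X3"
  proof (rule Set.set_eqI)
    fix s
    obtain i k :: nat where s: "s = (i, k)" by (cases s)
    have mm: "mir (mir r) = r" "mir r < 3 * N" if "3 * N \<le> r" "r < 6 * N" for r using that by linarith+
    have hi: "\<mu> r = \<mu> (mir r) + 1" if "3 * N \<le> r" "r < 6 * N" for r
      using \<mu>_mir[OF mm(2)[OF that]] mm(1)[OF that] by simp
    have X1: "(i, k) \<in> X1 \<longleftrightarrow> 3 * N \<le> i \<and> i < 6 * N \<and> (mir i, k) \<in> ?C (j - 1) \<union> ?T (j - 1)" for i k
    proof
      assume "(i, k) \<in> X1"
      then obtain p where p: "i = mir p" "(p, k) \<in> ?C (j - 1) \<union> ?T (j - 1)" unfolding X1_def by auto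
      then have "p < 3 * N" using pair by blast
      then have "mir i = p" "3 * N \<le> i" "i < 6 * N" using p(1) by linarith+
      then show "3 * N \<le> i \<and> i < 6 * N \<and> (mir i, k) \<in> ?C (j - 1) \<union> ?T (j - 1)" using p(2) by simp
    next
      assume h: "3 * N \<le> i \<and> i < 6 * N \<and> (mir i, k) \<in> ?C (j - 1) \<union> ?T (j - 1)"
      show "(i, k) \<in> X1" unfolding X1_def
        by (rule image_eqI[where x = "(mir i, k)"]) (use h mm(1)[of i] in simp_all)
    qed
    have X3: "(i, k) \<in> X3 \<longleftrightarrow> 3 * N \<le> i \<and> i < 6 * N \<and> 3 * N \<le> k \<and> k < 6 * N \<and> (mir i, mir k) \<in> ?C j" for i k
    proof
      assume "(i, k) \<in> X3"
      then obtain p q where p: "i = mir p" "k = mir q" "(p, q) \<in> ?C j" unfolding X3_def by auto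
      then have "p < 3 * N" "q < 3 * N" using pair by blast+
      then have "mir i = p" "3 * N \<le> i" "i < 6 * N" "mir k = q" "3 * N \<le> k" "k < 6 * N" using p(1,2) by linarith+
      then show "3 * N \<le> i \<and> i < 6 * N \<and> 3 * N \<le> k \<and> k < 6 * N \<and> (mir i, mir k) \<in> ?C j" using p(3) by simp
    next
      assume h: "3 * N \<le> i \<and> i < 6 * N \<and> 3 * N \<le> k \<and> k < 6 * N \<and> (mir i, mir k) \<in> ?C j"
      show "(i, k) \<in> X3" unfolding X3_def
        by (rule image_eqI[where x = "(mir i, mir k)"]) (use h mm(1)[of i] mm(1)[of k] in simp_all)
    qed
    have j1: "int (j - 1) = int j - 1" "2 \<le> j - 1" "2 \<le> j" using j by auto
    consider (LL) "i < 3 * N" "k < 3 * N" | (LR) "i < 3 * N" "3 * N \<le> k" | (RL) "3 * N \<le> i" "i < 6 * N" "k < 3 * N"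
      | (RR) "3 * N \<le> i" "i < 6 * N" "3 * N \<le> k" "k < 6 * N" | (out) "6 * N \<le> i \<or> 6 * N \<le> k" by linarith
    then have "(i, k) \<in> S \<and> \<mu> i - \<mu> k = int j \<longleftrightarrow> (i, k) \<in> X1 \<or> (i, k) \<in> X2 \<or> (i, k) \<in> X3"
    proof cases
      case LL
      have "(i, k) \<in> X2 \<longleftrightarrow> (i, k) \<in> S \<and> \<mu> i - \<mu> k = int j"
      proof -
        have "(i, k) \<in> S" if "(i, k) \<in> ?T j"
          using tail_pair_bounds[OF that] by (auto simp: S_def)
        moreover have "(i, k) \<notin> split_set j" if "(i, k) \<in> ?T j"
          using tail_pair_bounds[OF that] core_pair_less[of i k j] split_set_subset[of j] by auto
        ultimately show ?thesis
          using left_pair_iff[OF j1(3), of i k] core_pair_left[of i k j] LL j unfolding X2_def by auto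
      qed
      then show ?thesis using X1[of i k] X3[of i k] LL by auto
    next
      case LR
      then have "(i, k) \<notin> S" using blk_left_right[of i k] by (auto simp: S_def)
      then show ?thesis using X1[of i k] X3[of i k] LR low[of i k] by auto
    next
      case RL
      have "(i, k) \<in> S" using RL by (auto simp: S_def)
      moreover have "\<mu> i - \<mu> k = int j \<longleftrightarrow> (i, k) \<in> X1"
        unfolding X1 using hi[OF RL(1,2)] left_pair_iff[OF j1(2), of "mir i" k] mm(2)[OF RL(1,2)] RL j1(1) by auto
      ultimately show ?thesis using X3[of i k] RL low[of i k] by auto
    next
      case RR
      have "(i, k) \<in> X3 \<longleftrightarrow> (i, k) \<in> S \<and> \<mu> i - \<mu> k = int j"
        unfolding X3 using hi[OF RR(1,2)] hi[OF RR(3,4)] left_pair_iff[OF j1(3), of "mir i" "mir k"]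
          mm[OF RR(1,2)] mm[OF RR(3,4)] RR right[of "mir i" "mir k"]
          core_pair_less[of "mir i" "mir k" j] tail_pair_bounds[of "mir i" "mir k" j] by auto
      moreover have "(i, k) \<notin> X1" using X1[of i k] pair[of "mir i" k "j - 1"] RR by auto
      ultimately show ?thesis using RR low[of i k] by auto
    next
      case out
      have "(i, k) \<notin> S" using out by (auto simp: S_def)
      moreover have "(i, k) \<notin> X1"
      proof
        assume "(i, k) \<in> X1"
        then have "i < 6 * N" "k < 3 * N" using X1[of i k] pair[of "mir i" k "j - 1"] by blast+
        then show False using out by linarith
      qed
      moreover have "(i, k) \<notin> X2"
      proof
        assume "(i, k) \<in> X2"
        then have "i < 3 * N" "k < 3 * N" using low by blast+
        then show False using out by linarith
      qed
      moreover have "(i, k) \<notin> X3"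
      proof
        assume "(i, k) \<in> X3"
        then have "i < 6 * N" "k < 6 * N" using X3[of i k] by blast+
        then show False using out by linarith
      qed
      ultimately show ?thesis by blast
    qed
    then show "s \<in> {(i, k) \<in> S. \<mu> i - \<mu> k = int j} \<longleftrightarrow> s \<in> X1 \<union> X2 \<union> X3" unfolding s by auto
  qed
  have "card (X1 \<union> X2 \<union> X3) = card X1 + card X2 + card X3"
  proof -
    have "finite X1" "finite X2" "finite X3" unfolding X1_def X2_def X3_def using finite_pairs by auto
    moreover have b1: "3 * N \<le> fst s \<and> snd s < 3 * N" if "s \<in> X1" for s
    proof -
      obtain t where t: "t \<in> ?C (j - 1) \<union> ?T (j - 1)" "s = ?f t" using \<open>s \<in> X1\<close> unfolding X1_def by (elim imageE)
      obtain p q where e: "t = (p, q)" by (cases t)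
      have "p < 3 * N \<and> q < 3 * N" using t(1) pair[of p q "j - 1"] unfolding e by blast
      then show ?thesis unfolding t(2) e by auto
    qed
    have b3: "3 * N \<le> fst s \<and> 3 * N \<le> snd s" if "s \<in> X3" for s
    proof -
      obtain t where t: "t \<in> ?C j" "s = ?h t" using \<open>s \<in> X3\<close> unfolding X3_def by (elim imageE)
      obtain p q where e: "t = (p, q)" by (cases t)
      have "p < 3 * N \<and> q < 3 * N" using t(1) pair[of p q j] unfolding e by blast
      then show ?thesis unfolding t(2) e by auto
    qed
    have b2: "fst s < 3 * N" if "s \<in> X2" for s using low[of "fst s" "snd s"] that by simp
    have "X1 \<inter> X2 = {}" using b1 b2 by fastforce
    moreover have "(X1 \<union> X2) \<inter> X3 = {}" using b1 b2 b3 by fastforce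
    ultimately show ?thesis by (simp add: card_Un_disjoint)
  qed
  moreover have "card X1 = card (?C (j - 1)) + card (?T (j - 1))"
  proof -
    have "inj_on ?f (?C (j - 1) \<union> ?T (j - 1))"
    proof (rule inj_onI)
      fix s t assume h: "s \<in> ?C (j - 1) \<union> ?T (j - 1)" "t \<in> ?C (j - 1) \<union> ?T (j - 1)" "?f s = ?f t"
      obtain p q where e1: "s = (p, q)" by (cases s)
      obtain p' q' where e2: "t = (p', q')" by (cases t)
      note e = e1 e2
      have "p < 3 * N" "p' < 3 * N" using h(1,2) pair[of p q "j - 1"] pair[of p' q' "j - 1"] unfolding e by blast+
      then show "s = t" using h(3) unfolding e by auto
    qed
    then have "card X1 = card (?C (j - 1) \<union> ?T (j - 1))" unfolding X1_def by (rule card_image)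
    then show ?thesis by (simp add: card_Un_disjoint finite_pairs core_tail_disjoint)
  qed
  moreover have "card X2 + card (split_set j) = card (?C j) + card (?T j)"
  proof -
    have "(?C j - split_set j) \<inter> ?T j = {}" using core_tail_disjoint[of j j] by blast
    then have "card X2 = card (?C j - split_set j) + card (?T j)"
      unfolding X2_def by (intro card_Un_disjoint) (simp_all add: finite_pairs)
    moreover have "card (?C j - split_set j) = card (?C j) - card (split_set j)"
      by (rule card_Diff_subset[OF finite_subset[OF split_set_subset finite_pairs(1)] split_set_subset])
    moreover have "card (split_set j) \<le> card (?C j)" by (rule card_mono[OF finite_pairs(1) split_set_subset])
    ultimately show ?thesis by linarith
  qed
  moreover have "card X3 = card (?C j)"
  proof -
    have "inj_on ?h (?C j)"
    proof (rule inj_onI)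
      fix s t assume h: "s \<in> ?C j" "t \<in> ?C j" "?h s = ?h t"
      obtain p q where e1: "s = (p, q)" by (cases s)
      obtain p' q' where e2: "t = (p', q')" by (cases t)
      note e = e1 e2
      have "p < N" "p' < N" "q < N" "q' < N" using h(1,2) core_pair_less unfolding e by blast+
      then show "s = t" using h(3) unfolding e by auto
    qed
    then show ?thesis unfolding X3_def by (rule card_image)
  qed
  moreover have "card (?T j) + card (?T (j - 1)) = N * (4 * j + 4)"
  proof -
    have "card (?T j) = N * (2 * j + 3)" "card (?T (j - 1)) = N * (2 * (j - 1) + 3)"
      using j by (intro card_tail_pairs; linarith)+
    moreover have "(2 * j + 3) + (2 * (j - 1) + 3) = 4 * j + 4" using j by linarith
    ultimately show ?thesis by (simp only: distrib_left[symmetric])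
  qed
  moreover have "int (N * (4 * j + 4)) = int N * (4 * int j + 4)" by simp
  ultimately show ?thesis unfolding D by linarith
qed

theorem count_step:
  assumes j: "3 \<le> j" "j + 3 \<le> m"
  shows "2 * (int (card {(i, k) \<in> S. \<mu> i - \<mu> k = int (Suc j)}) - int (card {(i, k) \<in> S. \<mu> i - \<mu> k = int j}))
    = 8 * (int m)\<^sup>2 - 12 * int m * int j + 9 * (int j)\<^sup>2 + int j - 2"
proof -
  have "0 < m" using m by simp
  have "2 * (int (card (core_pairs m (j - 1))) - int (card (core_pairs m (Suc (j - 1)))))
      = 4 * int m * int (j - 1) - 3 * (int (j - 1))\<^sup>2 + 2 * int m - 3 * int (j - 1)"
    by (rule core_pairs_diff) (use j in linarith)+
  moreover have "int (j - 1) = int j - 1" "Suc (j - 1) = j" using j by linarith+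
  ultimately have d1: "2 * (int (card (core_pairs m (j - 1))) - int (card (core_pairs m j)))
      = 4 * int m * (int j - 1) - 3 * (int j - 1)\<^sup>2 + 2 * int m - 3 * (int j - 1)" by simp
  have d2: "2 * (int (card (core_pairs m j)) - int (card (core_pairs m (Suc j))))
      = 4 * int m * int j - 3 * (int j)\<^sup>2 + 2 * int m - 3 * int j"
    by (rule core_pairs_diff) (use j in linarith)+
  have s1: "2 * int (card (split_set j)) = (int m - 1 - int j) * (int m - int j)"
    unfolding split_set_def by (rule split_pairs) (use j in linarith)+
  have s2: "2 * int (card (split_set (Suc j))) = (int m - 1 - int (Suc j)) * (int m - int (Suc j))"
    unfolding split_set_def by (rule split_pairs) (use j in linarith)+
  have c1: "3 \<le> j" "j + 2 \<le> m" "3 \<le> Suc j" "Suc j + 2 \<le> m" using j by linarith+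
  have NN: "int N = int m * int m" by (simp add: N)
  show ?thesis
    unfolding card_graded[OF c1(1,2)] card_graded[OF c1(3,4)] NN diff_Suc_1
    using d1 d2 s1 s2 by (simp add: algebra_simps power2_eq_square)
qed

end

section \<open>The rise of the multiplicities\<close>

context staircase
begin

lemma size_pos: "6 * N > 0"
  using N_ge by simp

lemmas graded = size_pos g_carrier g_trace g_nondegenerate principal_d

lemma frobenius_staircase: "frobenius (6 * N) (parabolic (6 * N) comp)"
  using frobenius_Lie[OF graded] by (simp only: Lie_eq)

lemma ad_staircase:
  assumes F: "frobenius_functional (6 * N) (parabolic (6 * N) comp) F" and j: "j > 0"
    and e: "e \<in> principal_part (parabolic (6 * N) comp) F 1"
  shows "lie_bracket e ` principal_part (parabolic (6 * N) comp) F j \<subseteq> principal_part (parabolic (6 * N) comp) F (j + 1)"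
    and "principal_mult (6 * N) (parabolic (6 * N) comp) F (j + 1)
      \<le> ad_cokernel_dim (6 * N) (parabolic (6 * N) comp) F e j + principal_mult (6 * N) (parabolic (6 * N) comp) F j"
  using ad_principal_part[OF graded, of F j e] F j e unfolding Lie_eq by blast+

lemma principal_mult_step:
  assumes F: "frobenius_functional (6 * N) (parabolic (6 * N) comp) F" and j: "3 \<le> j" "j + 3 \<le> m"
  shows "2 * (int (principal_mult (6 * N) (parabolic (6 * N) comp) F (int j + 1))
      - int (principal_mult (6 * N) (parabolic (6 * N) comp) F (int j)))
    = 8 * (int m)\<^sup>2 - 12 * int m * int j + 9 * (int j)\<^sup>2 + int j - 2"
proof -
  have c: "principal_mult (6 * N) (parabolic (6 * N) comp) F i = card {(p, q) \<in> S. \<mu> p - \<mu> q = i}" if "i \<noteq> 0" for i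
    using principal_mult_eq_card(2)[OF graded, of F i] F that unfolding Lie_eq d_diff by blast
  have "int (Suc j) \<noteq> 0" "int j \<noteq> 0" using j by simp_all
  note e = this[THEN c]
  have "int j + 1 = int (Suc j)" by simp
  then show ?thesis using count_step[OF j] by (simp only: e)
qed

end

text \<open>The closed form of the sum of the steps, with \<open>\<Sum> j\<close> and \<open>\<Sum> j\<^sup>2\<close> over \<open>3 \<le> j < k + 3\<close> evaluated.\<close>

lemma rise_sum:
  fixes h :: "nat \<Rightarrow> int" and m :: int
  assumes "\<And>j. 3 \<le> j \<Longrightarrow> j < k + 3 \<Longrightarrow> 2 * (h (Suc j) - h j) = 8 * m\<^sup>2 - 12 * m * int j + 9 * (int j)\<^sup>2 + int j - 2"
  shows "4 * (h (k + 3) - h 3) = 16 * m\<^sup>2 * int k - 12 * m * int k * (int k + 5)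
    + 3 * (int k + 2) * (int k + 3) * (2 * int k + 5) - 90 + int k * (int k + 5) - 4 * int k"
  using assms
proof (induction k)
  case (Suc k)
  have "4 * (h (k + 3) - h 3) = 16 * m\<^sup>2 * int k - 12 * m * int k * (int k + 5)
    + 3 * (int k + 2) * (int k + 3) * (2 * int k + 5) - 90 + int k * (int k + 5) - 4 * int k"
    by (rule Suc.IH) (rule Suc.prems; simp)
  moreover have "2 * (h (Suc (k + 3)) - h (k + 3))
      = 8 * m\<^sup>2 - 12 * m * int (k + 3) + 9 * (int (k + 3))\<^sup>2 + int (k + 3) - 2"
    by (rule Suc.prems) simp_all
  ultimately show ?case by (simp add: algebra_simps power2_eq_square)
qed simp

theorem theoremA:
  fixes L :: nat
  assumes "L \<ge> 1"
  shows "\<exists>n b. n \<ge> 1 \<and> composition n b \<and> frobenius n (parabolic n b) \<and>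
    (\<forall>F. frobenius_functional n (parabolic n b) F \<longrightarrow>
      (let \<gg>\<^sub>p = principal_part (parabolic n b) F;
           h = principal_mult n (parabolic n b) F
       in
        (\<forall>j\<in>{3..int L + 2}. int (h j) - int (h (j + 1)) \<le> - (2 * (int L + 5)\<^sup>2 - 1)) \<and>
        (\<forall>j\<in>{3..int L + 2}. h j < h (j + 1)) \<and>
        real (h (int L + 3)) - real (h 3)
          = real L * (5 * (real L)\<^sup>2 + 43 * real L + 106) / 2 \<and>
        (\<forall>e\<in>\<gg>\<^sub>p 1. \<forall>j\<in>{3..int L + 2}.
          lie_bracket e ` \<gg>\<^sub>p j \<subseteq> \<gg>\<^sub>p (j + 1) \<and>
          int (ad_cokernel_dim n (parabolic n b) F e j) \<ge> 2 * (int L + 5)\<^sup>2 - 1)))"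
proof -
  define m where "m = L + 5"
  interpret staircase m "m * m" by unfold_locales (simp_all add: m_def)
  let ?n = "6 * (m * m)"
  let ?p = "parabolic ?n comp"
  have main: "(\<forall>j\<in>{3..int L + 2}. int (principal_mult ?n ?p F j) - int (principal_mult ?n ?p F (j + 1)) \<le> - (2 * (int L + 5)\<^sup>2 - 1)) \<and>
        (\<forall>j\<in>{3..int L + 2}. principal_mult ?n ?p F j < principal_mult ?n ?p F (j + 1)) \<and>
        real (principal_mult ?n ?p F (int L + 3)) - real (principal_mult ?n ?p F 3)
          = real L * (5 * (real L)\<^sup>2 + 43 * real L + 106) / 2 \<and>
        (\<forall>e\<in>principal_part ?p F 1. \<forall>j\<in>{3..int L + 2}.
          lie_bracket e ` principal_part ?p F j \<subseteq> principal_part ?p F (j + 1) \<and>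
          int (ad_cokernel_dim ?n ?p F e j) \<ge> 2 * (int L + 5)\<^sup>2 - 1)"
    if F: "frobenius_functional ?n ?p F" for F
  proof -
    define h where "h = principal_mult ?n ?p F"
    have mL: "int m = int L + 5" by (simp add: m_def)
    have step: "2 * (int (h (int j + 1)) - int (h (int j)))
        = 8 * (int m)\<^sup>2 - 12 * int m * int j + 9 * (int j)\<^sup>2 + int j - 2" if "3 \<le> j" "j < L + 3" for j
      unfolding h_def by (rule principal_mult_step[OF F]) (use that in \<open>simp_all add: m_def\<close>)
    have drop: "int (h j) - int (h (j + 1)) \<le> - (2 * (int L + 5)\<^sup>2 - 1)" if j: "j \<in> {3..int L + 2}" for j
    proof -
      have "3 \<le> nat j" "nat j < L + 3" "int (nat j) = j" using j by auto
      then have "2 * (int (h (j + 1)) - int (h j)) = 8 * (int m)\<^sup>2 - 12 * int m * j + 9 * j\<^sup>2 + j - 2"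
        using step[of "nat j"] by simp
      \<comment> \<open>Completing the square avoids any case distinction on \<open>j\<close>.\<close>
      also have "\<dots> = 4 * (int m)\<^sup>2 + (2 * int m - 3 * j)\<^sup>2 + j - 2" by (simp add: algebra_simps power2_eq_square)
      finally have "4 * (int m)\<^sup>2 \<le> 2 * (int (h (j + 1)) - int (h j))" using j by simp
      then show ?thesis unfolding mL[symmetric] by simp
    qed
    have big: "0 < 2 * (int L + 5)\<^sup>2 - 1"
    proof -
      have "0 < (int L + 5)\<^sup>2" by simp
      moreover define A where "A = (int L + 5)\<^sup>2"
      ultimately show ?thesis unfolding A_def[symmetric] by linarith
    qed
    have "4 * (int (h (int (L + 3))) - int (h (int 3))) = 16 * (int m)\<^sup>2 * int L - 12 * int m * int L * (int L + 5)
        + 3 * (int L + 2) * (int L + 3) * (2 * int L + 5) - 90 + int L * (int L + 5) - 4 * int L"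
      by (rule rise_sum[where h = "\<lambda>j. int (h (int j))"]) (use step in \<open>simp add: add.commute\<close>)
    also have "\<dots> = 2 * (int L * (5 * (int L)\<^sup>2 + 43 * int L + 106))"
      unfolding mL by (simp add: algebra_simps power2_eq_square)
    finally have "2 * (int (h (int L + 3)) - int (h 3)) = int L * (5 * (int L)\<^sup>2 + 43 * int L + 106)" by simp
    then have "real_of_int (2 * (int (h (int L + 3)) - int (h 3))) = real_of_int (int L * (5 * (int L)\<^sup>2 + 43 * int L + 106))"
      by (simp only:)
    then have rise: "real (h (int L + 3)) - real (h 3) = real L * (5 * (real L)\<^sup>2 + 43 * real L + 106) / 2" by simp
    have "int (ad_cokernel_dim ?n ?p F e j) \<ge> 2 * (int L + 5)\<^sup>2 - 1"
      "lie_bracket e ` principal_part ?p F j \<subseteq> principal_part ?p F (j + 1)"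
      if e: "e \<in> principal_part ?p F 1" and j: "j \<in> {3..int L + 2}" for e j
    proof -
      have "j > 0" using j by simp
      note ad = ad_staircase[OF F this e, folded h_def]
      show "lie_bracket e ` principal_part ?p F j \<subseteq> principal_part ?p F (j + 1)" by (rule ad(1))
      show "int (ad_cokernel_dim ?n ?p F e j) \<ge> 2 * (int L + 5)\<^sup>2 - 1" using ad(2) drop[OF j] by linarith
    qed
    moreover have "h j < h (j + 1)" if "j \<in> {3..int L + 2}" for j using drop[OF that] big by linarith
    ultimately show ?thesis using drop rise unfolding h_def[symmetric] by simp
  qed
  have "?n \<ge> 1" using size_pos by linarith
  then show ?thesis unfolding Let_def
    using composition_comp frobenius_staircase main by blast
qed

end
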